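(* Let $R$ be a commutative ring, and regard $\mathrm{Spec}(R)$ as a subset of $\mathrm{inj}_R$ via $P\mapsto E(R/P)$. Then the restrictions to $\mathrm{Spec}(R)$ of the following topologies on $\mathrm{inj}_R$ have as their open sets, respectively, exactly the following types of set: 1. full support topology: the sets $\bigcup_\lambda V(I_\lambda)$ for any set $\{I_\lambda\}_\lambda$ of ideals of $R$; these are precisely the specialisation-closed subsets of $\mathrm{Spec}(R)$; 2. Ziegler topology: the sets $\bigcup_\lambda V(I_\lambda)$ for any set $\{I_\lambda\}_\lambda$ of pp-definable ideals of $R$; 3. Zariski$^\ast$ (= Thomason) topology: the sets $\bigcup_\lambda V(I_\lambda)$ for any set $\{I_\lambda\}_\lambda$ of finitely generated ideals of $R$. If $R$ is coherent then the topologies in 2 and 3 on $\mathrm{Spec}(R)$ coincide; if $R$ is noetherian then all three coincide.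
   Context: $\mathrm{inj}_R$ is the set of isomorphism types of indecomposable injective $R$-modules, $E(-)$ denotes injective hull, and for an ideal $I$, $V(I)=\{P\in\mathrm{Spec}(R): I\subseteq P\}$. A subset $X\subseteq \mathrm{Spec}(R)$ is specialisation-closed if $P\in X$ and $P\subseteq Q\in \mathrm{Spec}(R)$ imply $Q\in X$. For an $R$-module $M$ put $(M)=\{E\in\mathrm{inj}_R:\mathrm{Hom}_R(M,E)\neq 0\}$. The full support topology on $\mathrm{inj}_R$ has the sets $(M)$, $M$ an arbitrary $R$-module (equivalently $(R/I)$ with $I$ an arbitrary ideal), as basis of open sets. The Ziegler topology on $\mathrm{inj}_R$ is the restriction of the Ziegler topology on the set $\mathrm{pinj}_R$ of indecomposable pure-injective modules, so has as basis of open sets the sets $\{E\in\mathrm{inj}_R:\phi(E)\neq \psi(E)\}$ where $\psi\le\phi$ is a pair of pp formulas in finitely many free variables. The Zariski$^\ast$ (= Thomason) topology on $\mathrm{inj}_R$ is the topology generated by the sets $(R/I)$ with $I$ a finitely generated ideal. A pp (positive primitive) formula $\phi(x_1,\dots,x_n)$ is an existentially quantified finite system of homogeneous $R$-linear equations; $\phi(M)\subseteq M^n$ denotes its solution set in $M$, and $\psi\le\phi$ means $\psi(M)\subseteq\phi(M)$ for every module $M$. An ideal is pp-definable if it has the form $\phi(R)$ for some pp formula $\phi$ in one free variable. (These ideals are also described as those belonging to $\mathcal{A}(R)$, the smallest, not necessarily full, abelian subcategory of $\mathrm{Mod}\text{-}R$ generated by the finitely presented modules.) *)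

theory Defs
  imports
    "HOL-Algebra.Module"
    "HOL-Algebra.QuotRing"
    "HOL-Algebra.Ring_Divisibility"
    "HOL-Analysis.Abstract_Topology"
begin

text \<open>
  Modules over a commutative ring are records of type \<^typ>\<open>('a, 'm) module\<close>; the fields
  \<open>mult\<close> and \<open>one\<close> inherited from rings carry no meaning for them.

  \<^emph>\<open>Universe.\<close> The phrase ``all modules'' is read as ``all modules whose carrier is a subset of
  the type \<open>'m\<close>''; the type \<open>'m\<close> plays the role of the set-theoretic universe and is an arbitrary
  type that is large enough in the following sense. With \<open>\<kappa> = max |R| \<aleph>\<^sub>0\<close>, an injective hull of a
  cyclic module embeds in a power of \<open>Hom\<^sub>\<int>(R, \<rat>/\<int>)\<close> with exponent at most \<open>|R|\<close>, and an
  indecomposable pure-injective module has at most \<open>2\<^sup>\<kappa>\<close> elements. So \<open>'m\<close> contains copies of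
  all points of the spaces below, of all finitely generated modules and of all ideals, and
  injectivity against monomorphisms in \<open>'m\<close> is injectivity (by Baer's criterion).
\<close>

definition large_universe :: "('a, 'r) ring_scheme \<Rightarrow> 'm itself \<Rightarrow> bool" where
  "large_universe R (_ :: 'm itself) \<longleftrightarrow>
     (\<exists>f :: 'a list set \<Rightarrow> 'm. inj_on f (Pow (lists (carrier R))))"


section \<open>Modules and homomorphisms\<close>

definition mod_hom ::
  "('a, 'r) ring_scheme \<Rightarrow> ('a, 'm) module \<Rightarrow> ('a, 'n) module \<Rightarrow> ('m \<Rightarrow> 'n) set" where
  "mod_hom R M N = {f \<in> carrier M \<rightarrow> carrier N.
     (\<forall>x\<in>carrier M. \<forall>y\<in>carrier M. f (x \<oplus>\<^bsub>M\<^esub> y) = f x \<oplus>\<^bsub>N\<^esub> f y) \<and>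
     (\<forall>r\<in>carrier R. \<forall>x\<in>carrier M. f (r \<odot>\<^bsub>M\<^esub> x) = r \<odot>\<^bsub>N\<^esub> f x)}"

definition mod_mono ::
  "('a, 'r) ring_scheme \<Rightarrow> ('a, 'm) module \<Rightarrow> ('a, 'n) module \<Rightarrow> ('m \<Rightarrow> 'n) set" where
  "mod_mono R M N = {f \<in> mod_hom R M N. inj_on f (carrier M)}"

definition nonzero_hom ::
  "('a, 'r) ring_scheme \<Rightarrow> ('a, 'm) module \<Rightarrow> ('a, 'n) module \<Rightarrow> bool" where
  "nonzero_hom R M N \<longleftrightarrow> (\<exists>f\<in>mod_hom R M N. \<exists>x\<in>carrier M. f x \<noteq> \<zero>\<^bsub>N\<^esub>)"

definition iso_type ::
  "('a, 'r) ring_scheme \<Rightarrow> ('a, 'm) module \<Rightarrow> ('a, 'm) module set" where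
  "iso_type R M =
     {N. module R N \<and> (\<exists>f\<in>mod_hom R M N. bij_betw f (carrier M) (carrier N))}"

definition ring_module :: "('a, 'r) ring_scheme \<Rightarrow> ('a, 'a) module" where
  "ring_module R = \<lparr>carrier = carrier R, monoid.mult = mult R, one = one R,
     ring.zero = ring.zero R, add = add R, smult = mult R\<rparr>"

definition quot_module :: "('a, 'r) ring_scheme \<Rightarrow> 'a set \<Rightarrow> ('a, 'a set) module" where
  "quot_module R I = \<lparr>carrier = carrier (R Quot I), monoid.mult = mult (R Quot I),
     one = one (R Quot I), ring.zero = ring.zero (R Quot I), add = add (R Quot I),
     smult = (\<lambda>r X. (I +>\<^bsub>R\<^esub> r) \<otimes>\<^bsub>R Quot I\<^esub> X)\<rparr>"

definition free_module :: "('a, 'r) ring_scheme \<Rightarrow> nat \<Rightarrow> ('a, 'a list) module" where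
  "free_module R n = \<lparr>carrier = {xs. length xs = n \<and> set xs \<subseteq> carrier R},
     monoid.mult = undefined, one = undefined, ring.zero = replicate n \<zero>\<^bsub>R\<^esub>,
     add = map2 (add R), smult = (\<lambda>r. map (mult R r))\<rparr>"

definition submodule_span ::
  "('a, 'r) ring_scheme \<Rightarrow> ('a, 'm) module \<Rightarrow> 'm set \<Rightarrow> 'm set" where
  "submodule_span R M A = \<Inter>{H. submodule H R M \<and> A \<subseteq> H}"

definition finitely_presented :: "('a, 'r) ring_scheme \<Rightarrow> ('a, 'm) module \<Rightarrow> bool" where
  "finitely_presented R M \<longleftrightarrow> module R M \<and>
     (\<exists>n. \<exists>f\<in>mod_hom R (free_module R n) M.
        f ` carrier (free_module R n) = carrier M \<and>
        (\<exists>A. finite A \<and> A \<subseteq> carrier (free_module R n) \<and>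
           {x \<in> carrier (free_module R n). f x = \<zero>\<^bsub>M\<^esub>} = submodule_span R (free_module R n) A))"


section \<open>Ideals, spectrum, coherence\<close>

definition fg_ideal :: "('a, 'r) ring_scheme \<Rightarrow> 'a set \<Rightarrow> bool" where
  "fg_ideal R I \<longleftrightarrow> (\<exists>A\<subseteq>carrier R. finite A \<and> I = Idl\<^bsub>R\<^esub> A)"

definition coherent_ring :: "('a, 'r) ring_scheme \<Rightarrow> bool" where
  "coherent_ring R \<longleftrightarrow> cring R \<and>
     (\<forall>I. fg_ideal R I \<longrightarrow> finitely_presented R ((ring_module R)\<lparr>carrier := I\<rparr>))"

definition Spec :: "('a, 'r) ring_scheme \<Rightarrow> 'a set set" where
  "Spec R = {P. primeideal P R}"

definition V :: "('a, 'r) ring_scheme \<Rightarrow> 'a set \<Rightarrow> 'a set set" where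
  "V R I = {P \<in> Spec R. I \<subseteq> P}"

definition specialisation_closed :: "('a, 'r) ring_scheme \<Rightarrow> 'a set set \<Rightarrow> bool" where
  "specialisation_closed R X \<longleftrightarrow>
     X \<subseteq> Spec R \<and> (\<forall>P\<in>X. \<forall>Q\<in>Spec R. P \<subseteq> Q \<longrightarrow> Q \<in> X)"


section \<open>Positive primitive formulas\<close>

text \<open>
  The formula \<open>\<exists>y\<^sub>1 \<dots> y\<^sub>m. \<And>\<^sub>k (\<Sum>\<^sub>i r\<^sub>k\<^sub>i x\<^sub>i + \<Sum>\<^sub>j s\<^sub>k\<^sub>j y\<^sub>j = 0)\<close> in the free variables \<open>x\<^sub>1, \<dots>, x\<^sub>n\<close> is given
  by \<open>n\<close>, \<open>m\<close> and the list of the pairs \<open>(r\<^sub>k, s\<^sub>k)\<close> of coefficient vectors.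
\<close>

record 'a pp_formula =
  free_vars :: nat
  bound_vars :: nat
  equations :: "('a list \<times> 'a list) list"

definition pp_over :: "('a, 'r) ring_scheme \<Rightarrow> 'a pp_formula \<Rightarrow> bool" where
  "pp_over R \<phi> \<longleftrightarrow> (\<forall>(r, s)\<in>set (equations \<phi>).
     length r = free_vars \<phi> \<and> set r \<subseteq> carrier R \<and>
     length s = bound_vars \<phi> \<and> set s \<subseteq> carrier R)"

definition lin_form :: "('a, 'm) module \<Rightarrow> 'a list \<Rightarrow> 'm list \<Rightarrow> 'm" where
  "lin_form M r x = (\<Oplus>\<^bsub>M\<^esub> i\<in>{..<length x}. (r ! i) \<odot>\<^bsub>M\<^esub> (x ! i))"

definition pp_sol :: "('a, 'm) module \<Rightarrow> 'a pp_formula \<Rightarrow> 'm list set" where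
  "pp_sol M \<phi> = {x. length x = free_vars \<phi> \<and> set x \<subseteq> carrier M \<and>
     (\<exists>y. length y = bound_vars \<phi> \<and> set y \<subseteq> carrier M \<and>
        (\<forall>(r, s)\<in>set (equations \<phi>). lin_form M r x \<oplus>\<^bsub>M\<^esub> lin_form M s y = \<zero>\<^bsub>M\<^esub>))}"

definition pp_le ::
  "'m itself \<Rightarrow> ('a, 'r) ring_scheme \<Rightarrow> 'a pp_formula \<Rightarrow> 'a pp_formula \<Rightarrow> bool" where
  "pp_le (_ :: 'm itself) R \<psi> \<phi> \<longleftrightarrow> free_vars \<psi> = free_vars \<phi> \<and>
     (\<forall>M :: ('a, 'm) module. module R M \<longrightarrow> pp_sol M \<psi> \<subseteq> pp_sol M \<phi>)"

definition pp_definable_ideal :: "('a, 'r) ring_scheme \<Rightarrow> 'a set \<Rightarrow> bool" where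
  "pp_definable_ideal R I \<longleftrightarrow> ideal I R \<and>
     (\<exists>\<phi>. pp_over R \<phi> \<and> free_vars \<phi> = 1 \<and> I = {a. [a] \<in> pp_sol (ring_module R) \<phi>})"


section \<open>Injective and pure-injective modules\<close>

definition injective_module :: "('a, 'r) ring_scheme \<Rightarrow> ('a, 'm) module \<Rightarrow> bool" where
  "injective_module R E \<longleftrightarrow> module R E \<and>
     (\<forall>(A :: ('a, 'm) module) (B :: ('a, 'm) module). module R A \<longrightarrow> module R B \<longrightarrow>
        (\<forall>i\<in>mod_mono R A B. \<forall>f\<in>mod_hom R A E.
           \<exists>g\<in>mod_hom R B E. \<forall>x\<in>carrier A. g (i x) = f x))"

definition pure_mono ::
  "('a, 'r) ring_scheme \<Rightarrow> ('a, 'm) module \<Rightarrow> ('a, 'n) module \<Rightarrow> ('m \<Rightarrow> 'n) set" where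
  "pure_mono R M N = {f \<in> mod_mono R M N. \<forall>\<phi> x. pp_over R \<phi> \<longrightarrow> set x \<subseteq> carrier M \<longrightarrow>
     map f x \<in> pp_sol N \<phi> \<longrightarrow> x \<in> pp_sol M \<phi>}"

definition pure_injective_module :: "('a, 'r) ring_scheme \<Rightarrow> ('a, 'm) module \<Rightarrow> bool" where
  "pure_injective_module R E \<longleftrightarrow> module R E \<and>
     (\<forall>(A :: ('a, 'm) module) (B :: ('a, 'm) module). module R A \<longrightarrow> module R B \<longrightarrow>
        (\<forall>i\<in>pure_mono R A B. \<forall>f\<in>mod_hom R A E.
           \<exists>g\<in>mod_hom R B E. \<forall>x\<in>carrier A. g (i x) = f x))"

definition indecomposable_module :: "('a, 'r) ring_scheme \<Rightarrow> ('a, 'm) module \<Rightarrow> bool" where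
  "indecomposable_module R M \<longleftrightarrow> module R M \<and> carrier M \<noteq> {\<zero>\<^bsub>M\<^esub>} \<and>
     (\<forall>A B. submodule A R M \<longrightarrow> submodule B R M \<longrightarrow>
        A \<inter> B = {\<zero>\<^bsub>M\<^esub>} \<longrightarrow> A <+>\<^bsub>M\<^esub> B = carrier M \<longrightarrow> A = {\<zero>\<^bsub>M\<^esub>} \<or> B = {\<zero>\<^bsub>M\<^esub>})"

definition essential_mono ::
  "('a, 'r) ring_scheme \<Rightarrow> ('a, 'm) module \<Rightarrow> ('a, 'n) module \<Rightarrow> ('m \<Rightarrow> 'n) set" where
  "essential_mono R M N = {f \<in> mod_mono R M N. \<forall>H. submodule H R N \<longrightarrow>
     H \<inter> f ` carrier M = {\<zero>\<^bsub>N\<^esub>} \<longrightarrow> H = {\<zero>\<^bsub>N\<^esub>}}"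

definition injective_hull ::
  "('a, 'r) ring_scheme \<Rightarrow> ('a, 'n) module \<Rightarrow> ('a, 'm) module \<Rightarrow> bool" where
  "injective_hull R M E \<longleftrightarrow> injective_module R E \<and> essential_mono R M E \<noteq> {}"


section \<open>The spaces of points and their topologies\<close>

definition inj_types :: "('a, 'r) ring_scheme \<Rightarrow> ('a, 'm) module set set" where
  "inj_types R = iso_type R ` {E. injective_module R E \<and> indecomposable_module R E}"

definition pinj_types :: "('a, 'r) ring_scheme \<Rightarrow> ('a, 'm) module set set" where
  "pinj_types R = iso_type R ` {E. pure_injective_module R E \<and> indecomposable_module R E}"

text \<open>The isomorphism type of \<open>E(R/P)\<close>, as the set of all injective hulls of \<open>R/P\<close>.\<close>

definition hull_type :: "('a, 'r) ring_scheme \<Rightarrow> 'a set \<Rightarrow> ('a, 'm) module set" where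
  "hull_type R P = {E. injective_hull R (quot_module R P) E}"

definition hom_support ::
  "('a, 'r) ring_scheme \<Rightarrow> ('a, 'n) module \<Rightarrow> ('a, 'm) module set set" where
  "hom_support R M = {C \<in> inj_types R. \<exists>E\<in>C. nonzero_hom R M E}"

text \<open>
  The generating families in the first two topologies are bases of these topologies, so
  \<^const>\<open>generate_topology_on\<close> yields exactly their unions.
\<close>

definition full_support_topology :: "('a, 'r) ring_scheme \<Rightarrow> ('a, 'm) module set topology" where
  "full_support_topology R =
     topology_generated_by {hom_support R M | M :: ('a, 'm) module. module R M}"

definition ziegler_pinj_topology :: "('a, 'r) ring_scheme \<Rightarrow> ('a, 'm) module set topology" where
  "ziegler_pinj_topology R = topology_generated_by
     {{C \<in> pinj_types R. \<exists>E\<in>C. pp_sol E \<phi> \<noteq> pp_sol E \<psi>} | \<phi> \<psi>.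
        pp_over R \<phi> \<and> pp_over R \<psi> \<and> pp_le TYPE('m) R \<psi> \<phi>}"

definition ziegler_topology :: "('a, 'r) ring_scheme \<Rightarrow> ('a, 'm) module set topology" where
  "ziegler_topology R = subtopology (ziegler_pinj_topology R) (inj_types R)"

definition thomason_topology :: "('a, 'r) ring_scheme \<Rightarrow> ('a, 'm) module set topology" where
  "thomason_topology R =
     topology_generated_by {hom_support R (quot_module R I) | I. fg_ideal R I}"

definition restrict_to_Spec ::
  "('a, 'r) ring_scheme \<Rightarrow> ('a, 'm) module set topology \<Rightarrow> 'a set topology" where
  "restrict_to_Spec R T = pullback_topology (Spec R) (hull_type R) T"

end

theory Submission
  imports Defs
begin

text \<open>
  Write \<open>E(P)\<close> for the injective hull of \<open>R/P\<close> with \<open>P\<close> prime.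

  \<^emph>\<open>Hulls.\<close> The module of functions \<open>R \<times> R \<rightarrow> \<rat>/\<int>\<close> that are additive in the first argument is
  injective, contains an element with annihilator \<open>I\<close> for every ideal \<open>I\<close>, and fits into the
  universe \<open>'m\<close> (\<open>ambient_injective\<close>). A maximal essential extension of \<open>R/P\<close> inside it is a direct
  summand, hence injective (\<open>injective_hull_exists\<close>). A hull of \<open>R/P\<close> is treated as an injective
  module \<open>E\<close> with an element \<open>e\<close> of annihilator \<open>P\<close> such that every nonzero element of \<open>E\<close> has a
  nonzero multiple in \<open>R e\<close> (\<open>injective_hull_iff\<close>). If \<open>P\<close> is prime, then such a multiple again has
  annihilator \<open>P\<close> (\<open>essential_generator_prime\<close>). So every nonzero element of \<open>E(P)\<close> has its
  annihilator inside \<open>P\<close>, \<open>E(P)\<close> is indecomposable, and \<open>E(P)\<close> determines \<open>P\<close>.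

  \<^emph>\<open>Full support and Thomason topologies.\<close> By this fact about annihilators, a nonzero homomorphism
  \<open>R/I \<rightarrow> E(P)\<close> exists iff \<open>I \<subseteq> P\<close>. If \<open>M \<rightarrow> E(P)\<close> is nonzero, some \<open>x\<close> in \<open>M\<close> has its annihilator
  inside \<open>P\<close>; for \<open>P \<subseteq> Q\<close> this gives a map \<open>R x \<rightarrow> R/Q \<rightarrow> E(Q)\<close>, which extends to \<open>M\<close>. Thus supports
  of modules are specialisation-closed.

  \<^emph>\<open>Ziegler topology.\<close> In an injective module \<open>E\<close> a finite linear system is solvable iff it is
  consistent, so \<open>\<phi>(E)\<close> is the set of all \<open>x \<in> E\<^sup>n\<close> killed by a submodule \<open>D\<^sub>\<phi>\<close> of \<open>R\<^sup>n\<close>, which is the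
  solution set in \<open>R\<close> of the dual formula (\<open>pp_sol_injective_iff\<close>). Hence for \<open>\<psi> \<le> \<phi>\<close> the sets
  \<open>\<phi>(E(P))\<close> and \<open>\<psi>(E(P))\<close> differ iff \<open>(D\<^sub>\<phi> : d) \<subseteq> P\<close> for some \<open>d \<in> D\<^sub>\<psi>\<close> (\<open>pp_pair_open_iff\<close>). The
  ideals \<open>(D\<^sub>\<phi> : d)\<close> are pp-definable (\<open>pp_definable_residual\<close>). Conversely every pp-definable ideal is
  of the form \<open>D\<^sub>\<phi>\<close> (\<open>pp_definable_dual\<close>), so that its \<open>V(I)\<close> is the open set of the pair of \<open>\<phi>\<close> and
  the formula \<open>x = 0\<close>.

  In each case the sets \<open>V(I)\<close> in question are closed under binary intersection, so the open sets are
  exactly their unions (\<open>openin_restrict_to_Spec_generated\<close>).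

  \<^emph>\<open>Comparison.\<close> Finitely generated ideals are pp-definable. Over a coherent ring the solutions of a
  finite homogeneous linear system form a finitely generated module, so pp-definable ideals are finitely
  generated (\<open>coherent_pp_definable_fg\<close>). Over a noetherian ring all ideals are finitely generated.
\<close>


section \<open>Characters with values in the rationals modulo the integers\<close>

text \<open>
  The group \<open>\<rat>/\<int>\<close>. Its divisibility makes characters extend, its torsion provides separating
  characters, and its countability bounds the size of the modules built from it.
\<close>

quotient_type qz = rat / "\<lambda>x y. x - y \<in> \<int>"
proof (rule equivpI)
  show "reflp (\<lambda>x y :: rat. x - y \<in> \<int>)" by (rule reflpI) simp
  show "symp (\<lambda>x y :: rat. x - y \<in> \<int>)"
    by (rule sympI) (metis Ints_minus minus_diff_eq)
  show "transp (\<lambda>x y :: rat. x - y \<in> \<int>)"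
  proof (rule transpI)
    fix a b c :: rat assume "a - b \<in> \<int>" "b - c \<in> \<int>"
    then have "(a - b) + (b - c) \<in> \<int>" by (rule Ints_add)
    then show "a - c \<in> \<int>" by simp
  qed
qed

instantiation qz :: ab_group_add
begin

lift_definition zero_qz :: qz is 0 .

lift_definition plus_qz :: "qz \<Rightarrow> qz \<Rightarrow> qz" is "(+)"
  by (simp only: add_diff_add Ints_add)

lift_definition uminus_qz :: "qz \<Rightarrow> qz" is uminus
  by (simp only: minus_diff_minus Ints_minus)

lift_definition minus_qz :: "qz \<Rightarrow> qz \<Rightarrow> qz" is "(-)"
proof -
  fix a b c d :: rat assume "a - b \<in> \<int>" "c - d \<in> \<int>"
  then have "(a - b) - (c - d) \<in> \<int>" by (rule Ints_diff)
  then show "(a - c) - (b - d) \<in> \<int>" by (simp add: algebra_simps)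
qed

instance
  by standard (transfer; simp add: algebra_simps)+

end

text \<open>
  Integer multiples in \<open>\<rat>/\<int>\<close>.
\<close>

lift_definition qz_scale :: "int \<Rightarrow> qz \<Rightarrow> qz" is "\<lambda>k x. of_int k * x"
  by (simp flip: right_diff_distrib)

lemma qz_scale_add: "qz_scale (k + l) q = qz_scale k q + qz_scale l q"
  by transfer (simp add: algebra_simps)

lemma qz_scale_diff: "qz_scale (k - l) q = qz_scale k q - qz_scale l q"
  by transfer (simp add: algebra_simps)

lemma qz_scale_mult: "qz_scale (k * l) q = qz_scale k (qz_scale l q)"
  by transfer (simp add: algebra_simps)

lemma qz_scale_0 [simp]: "qz_scale 0 q = 0" and qz_scale_1 [simp]: "qz_scale 1 q = q"
  and qz_scale_zero [simp]: "qz_scale k 0 = 0"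
  by (transfer; simp)+

lemma qz_divisible: "k \<noteq> 0 \<Longrightarrow> \<exists>q. qz_scale k q = p"
  by transfer (rule_tac x = "p / of_int k" in exI, simp)

lemma qz_torsion: "k \<noteq> 1 \<Longrightarrow> k \<ge> 0 \<Longrightarrow> \<exists>q. q \<noteq> 0 \<and> qz_scale k q = 0"
proof -
  assume k: "k \<noteq> 1" "k \<ge> (0::int)"
  have "\<exists>x::rat. x \<notin> \<int> \<and> of_int k * x \<in> \<int>"
  proof (cases "k = 0")
    case True
    have "(1/2 :: rat) \<notin> \<int>"
    proof
      assume "(1/2 :: rat) \<in> \<int>"
      then obtain z :: int where "1/2 = (of_int z :: rat)" by (auto simp: Ints_def)
      then have "(of_int (2 * z) :: rat) = of_int 1" by simp
      then have "2 * z = 1" by (simp only: of_int_eq_iff)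
      then show False by presburger
    qed
    with True show ?thesis by (intro exI[of _ "1/2"]) simp
  next
    case False
    have "(1 / of_int k :: rat) \<notin> \<int>"
    proof
      assume "(1 / of_int k :: rat) \<in> \<int>"
      then obtain z :: int where "1 / of_int k = (of_int z :: rat)" by (auto simp: Ints_def)
      then have "(of_int (k * z) :: rat) = of_int 1" using False by (simp add: field_simps)
      then have "k * z = 1" by (simp only: of_int_eq_iff)
      then show False using k zmult_eq_1_iff[of k z] by auto
    qed
    with False show ?thesis by (intro exI[of _ "1 / of_int k"]) simp
  qed
  then show ?thesis by transfer simp
qed

lemma qz_embeds_nat: "\<exists>f :: qz \<Rightarrow> nat. inj f"
proof -
  have "inj (\<lambda>q. to_nat (rep_qz q))"
  proof (rule injI)
    fix x y :: qz assume "to_nat (rep_qz x) = to_nat (rep_qz y)"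
    then have "abs_qz (rep_qz x) = abs_qz (rep_qz y)" by simp
    then show "x = y" by (simp only: Quotient3_abs_rep[OF Quotient3_qz])
  qed
  then show ?thesis by blast
qed

text \<open>
  The graph of an additive function into \<open>\<rat>/\<int>\<close> whose domain is a subgroup of the additive group
  of \<open>B\<close>. Graphs turn extension into inclusion, as needed for Zorn's lemma.
\<close>

definition partial_character :: "('b, 'c) ring_scheme \<Rightarrow> ('b \<times> qz) set \<Rightarrow> bool" where
  "partial_character B G \<longleftrightarrow> G \<subseteq> carrier B \<times> UNIV \<and> (\<zero>\<^bsub>B\<^esub>, 0) \<in> G \<and>
     (\<forall>x p y q. (x, p) \<in> G \<longrightarrow> (y, q) \<in> G \<longrightarrow> (x \<ominus>\<^bsub>B\<^esub> y, p - q) \<in> G) \<and>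
     (\<forall>q. (\<zero>\<^bsub>B\<^esub>, q) \<in> G \<longrightarrow> q = 0)"

context abelian_group
begin

lemma int_mult_0 [simp]: "[(0::int)] \<cdot> x = \<zero>"
  by (simp add: add_pow_def)

lemma int_mult_1 [simp]: "x \<in> carrier G \<Longrightarrow> [(1::int)] \<cdot> x = x"
  using add.int_pow_1[of x] by simp

lemma int_mult_diff:
  assumes "x \<in> carrier G" shows "[(k - l::int)] \<cdot> x = [k] \<cdot> x \<ominus> [l] \<cdot> x"
  using add.int_pow_diff[OF assms] by (simp add: a_minus_def)

context
  fixes H assumes H: "partial_character G H"
begin

lemma pc_carrier: "(x, p) \<in> H \<Longrightarrow> x \<in> carrier G"
  and pc_zero: "(\<zero>, 0) \<in> H"
  and pc_diff: "(x, p) \<in> H \<Longrightarrow> (y, q) \<in> H \<Longrightarrow> (x \<ominus> y, p - q) \<in> H"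
  and pc_zeroD: "(\<zero>, q) \<in> H \<Longrightarrow> q = 0"
  using H unfolding partial_character_def by auto

lemma pc_neg: "(x, p) \<in> H \<Longrightarrow> (\<ominus> x, - p) \<in> H"
  using pc_diff[OF pc_zero, of x p] pc_carrier[of x p] by (simp add: a_minus_def)

lemma pc_add: "(x, p) \<in> H \<Longrightarrow> (y, q) \<in> H \<Longrightarrow> (x \<oplus> y, p + q) \<in> H"
  using pc_diff[of x p "\<ominus> y" "- q"] pc_neg pc_carrier[of y q] by (simp add: a_minus_def)

lemma pc_unique: "(x, p) \<in> H \<Longrightarrow> (x, q) \<in> H \<Longrightarrow> p = q"
  using pc_zeroD[of "p - q"] pc_diff[of x p x q] pc_carrier[of x p] by (simp add: a_minus_def r_neg)

lemma pc_scale_nat: "(x, p) \<in> H \<Longrightarrow> ([int n] \<cdot> x, qz_scale (int n) p) \<in> H"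
proof (induction n)
  case 0 then show ?case using pc_zero by simp
next
  case (Suc n)
  note x = pc_carrier[OF Suc.prems]
  have "[int (Suc n)] \<cdot> x = [int n] \<cdot> x \<oplus> [(1::int)] \<cdot> x"
    using add.int_pow_mult[OF x, of "int n" 1] by (simp only: of_nat_Suc Groups.add_ac)
  moreover have "qz_scale (int (Suc n)) p = qz_scale (int n) p + p"
    using qz_scale_add[of "int n" 1 p] by (simp only: of_nat_Suc qz_scale_1 Groups.add_ac)
  ultimately show ?case
    using pc_add[OF Suc.IH[OF Suc.prems] Suc.prems] by (simp only: int_mult_1[OF x])
qed

lemma pc_scale:
  assumes "(x, p) \<in> H" shows "([(k::int)] \<cdot> x, qz_scale k p) \<in> H"
proof (cases "k \<ge> 0")
  case True then show ?thesis using pc_scale_nat[OF assms, of "nat k"] by simp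
next
  case False
  have x: "x \<in> carrier G" using assms pc_carrier by blast
  have "[k] \<cdot> x = \<ominus> ([int (nat (- k))] \<cdot> x)"
    using False int_mult_diff[OF x, of 0 "- k"] x by (simp add: a_minus_def)
  moreover have "qz_scale k p = - qz_scale (- k) p"
    using qz_scale_diff[of 0 "- k" p] by simp
  ultimately show ?thesis
    using pc_neg[OF pc_scale_nat[OF assms, of "nat (- k)"]] False by simp
qed

text \<open>
  A value \<open>q\<close> at \<open>b\<close> that is compatible with all multiples of \<open>b\<close> in the domain; these multiples
  are the multiples of one of them, \<open>n b\<close>, and \<open>q\<close> is a solution of \<open>n q = H(n b)\<close>. The second
  conjunct concerns the zero character on a subgroup without \<open>b\<close>: then \<open>n \<noteq> 1\<close>, and torsion of
  \<open>\<rat>/\<int>\<close> allows \<open>q \<noteq> 0\<close>.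
\<close>

lemma pc_value:
  assumes b: "b \<in> carrier G"
  shows "\<exists>q. (\<forall>k p. ([(k::int)] \<cdot> b, p) \<in> H \<longrightarrow> p = qz_scale k q) \<and>
    ((\<forall>p. (b, p) \<notin> H) \<and> (\<forall>x p. (x, p) \<in> H \<longrightarrow> p = 0) \<longrightarrow> q \<noteq> 0)"
proof -
  define J where "J = {n::nat. n > 0 \<and> (\<exists>p. ([int n] \<cdot> b, p) \<in> H)}"
  show ?thesis
  proof (cases "J = {}")
    case True
    have zero: "k = 0" if "([(k::int)] \<cdot> b, p) \<in> H" for k p
    proof (rule ccontr)
      assume "k \<noteq> 0"
      have "\<exists>p. ([\<bar>k\<bar>] \<cdot> b, p) \<in> H"
      proof (cases "k > 0")
        case False
        have "[\<bar>k\<bar>] \<cdot> b = \<ominus> ([k] \<cdot> b)"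
          using False int_mult_diff[OF b, of 0 k] b by (simp add: a_minus_def)
        then show ?thesis using pc_neg[OF that] by auto
      qed (use that in auto)
      then have "nat \<bar>k\<bar> \<in> J" unfolding J_def using \<open>k \<noteq> 0\<close> by auto
      then show False using True by simp
    qed
    obtain q :: qz where q: "q \<noteq> 0" using qz_torsion[of 0] by auto
    have "p = qz_scale k q" if "([(k::int)] \<cdot> b, p) \<in> H" for k p
      using zero[OF that] that pc_zeroD by simp
    then show ?thesis using q by blast
  next
    case False
    define n where "n = (LEAST n. n \<in> J)"
    have nJ: "n \<in> J" and nmin: "\<And>m. m \<in> J \<Longrightarrow> n \<le> m"
      unfolding n_def using False by (auto intro: LeastI Least_le)
    then obtain p0 where n0: "n > 0" and p0: "([int n] \<cdot> b, p0) \<in> H" by (auto simp: J_def)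
    have key: "p = qz_scale k q" if q: "qz_scale (int n) q = p0" and kp: "([(k::int)] \<cdot> b, p) \<in> H" for q k p
    proof -
      define m r where "m = k div int n" and "r = k mod int n"
      have k: "k = m * int n + r" by (simp add: m_def r_def)
      have mm: "([(m * int n)] \<cdot> b, qz_scale m p0) \<in> H"
        using pc_scale[OF p0, of m] add.int_pow_pow[OF b, of m "int n"] by (simp add: mult.commute)
      have "([r] \<cdot> b, p - qz_scale m p0) \<in> H"
        using pc_diff[OF kp mm] int_mult_diff[OF b, of k "m * int n"] k by simp
      moreover have "r \<ge> 0" "r < int n" using n0 by (auto simp: r_def)
      ultimately have "r = 0" using nmin[of "nat r"]
        unfolding J_def by (cases "r = 0") force+
      with k mm kp have "p = qz_scale m p0" using pc_unique by auto
      then show ?thesis using k \<open>r = 0\<close> q by (simp add: qz_scale_mult)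
    qed
    show ?thesis
    proof (cases "(\<forall>p. (b, p) \<notin> H) \<and> (\<forall>x p. (x, p) \<in> H \<longrightarrow> p = 0)")
      case True
      then have "int n \<noteq> 1" "p0 = 0" using p0 b by (auto simp: add.int_pow_1)
      then obtain q where "q \<noteq> 0" "qz_scale (int n) q = p0" using qz_torsion[of "int n"] by auto
      then show ?thesis using key by blast
    next
      case False
      obtain q where "qz_scale (int n) q = p0" using qz_divisible[of "int n" p0] n0 by auto
      then show ?thesis using key False by metis
    qed
  qed
qed

lemma pc_adjoin:
  assumes b: "b \<in> carrier G" and q: "\<And>k p. ([(k::int)] \<cdot> b, p) \<in> H \<Longrightarrow> p = qz_scale k q"
  shows "partial_character G {(x \<oplus> [(k::int)] \<cdot> b, p + qz_scale k q) | x p k. (x, p) \<in> H}"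
    (is "partial_character G ?H'")
  unfolding partial_character_def
proof (intro conjI allI impI)
  show "?H' \<subseteq> carrier G \<times> UNIV" using pc_carrier b by auto
  show "(\<zero>, 0) \<in> ?H'" using pc_zero b by (force intro: exI[of _ "0::int"])
  show "(x \<ominus> y, p - p') \<in> ?H'" if "(x, p) \<in> ?H'" "(y, p') \<in> ?H'" for x p y p'
  proof -
    from that obtain u r k u' r' k' where
      h: "(u, r) \<in> H" "x = u \<oplus> [(k::int)] \<cdot> b" "p = r + qz_scale k q"
         "(u', r') \<in> H" "y = u' \<oplus> [(k'::int)] \<cdot> b" "p' = r' + qz_scale k' q" by auto
    have c: "u \<in> carrier G" "u' \<in> carrier G" "[k] \<cdot> b \<in> carrier G" "[k'] \<cdot> b \<in> carrier G"
      using h pc_carrier b by auto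
    then have "x \<ominus> y = (u \<ominus> u') \<oplus> [(k - k')] \<cdot> b"
      using h by (simp add: int_mult_diff[OF b] a_minus_def minus_add a_ac)
    moreover have "p - p' = (r - r') + qz_scale (k - k') q" using h by (simp add: qz_scale_diff)
    ultimately show ?thesis using pc_diff[OF h(1) h(4)] by blast
  qed
  show "r = 0" if "(\<zero>, r) \<in> ?H'" for r
  proof -
    from that obtain u s k where h: "(u, s) \<in> H" "u \<oplus> [(k::int)] \<cdot> b = \<zero>" "r = s + qz_scale k q" by auto
    have "[k] \<cdot> b = \<ominus> u"
      using h pc_carrier[OF h(1)] b by (metis add.int_pow_closed a_comm minus_equality minus_minus)
    then have "- s = qz_scale k q" using pc_neg[OF h(1)] q by metis
    then show ?thesis using h by (metis add.right_inverse)
  qed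
qed

end

lemma partial_character_extends:
  assumes "partial_character G H"
  shows "\<exists>\<chi>. (\<forall>x\<in>carrier G. \<forall>y\<in>carrier G. \<chi> (x \<oplus> y) = \<chi> x + \<chi> y) \<and>
    (\<forall>x p. (x, p) \<in> H \<longrightarrow> \<chi> x = p)"
proof -
  let ?A = "{K. partial_character G K \<and> H \<subseteq> K}"
  have "\<exists>M\<in>?A. \<forall>X\<in>?A. M \<subseteq> X \<longrightarrow> X = M"
  proof (rule subset_Zorn_nonempty)
    show "?A \<noteq> {}" using assms by blast
    fix C assume C: "C \<noteq> {}" "subset.chain ?A C"
    then have CA: "\<And>K. K \<in> C \<Longrightarrow> partial_character G K \<and> H \<subseteq> K"
      and lin: "\<And>K L. K \<in> C \<Longrightarrow> L \<in> C \<Longrightarrow> K \<subseteq> L \<or> L \<subseteq> K"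
      using C(2) unfolding subset_chain_def by blast+
    have "partial_character G (\<Union>C)"
      unfolding partial_character_def
    proof (intro conjI allI impI)
      show "\<Union>C \<subseteq> carrier G \<times> UNIV" using CA unfolding partial_character_def by blast
      show "(\<zero>, 0) \<in> \<Union>C" using CA C unfolding partial_character_def by blast
      show "q = 0" if "(\<zero>, q) \<in> \<Union>C" for q using that CA unfolding partial_character_def by blast
      fix x p y q assume "(x, p) \<in> \<Union>C" "(y, q) \<in> \<Union>C"
      then obtain K where "K \<in> C" "(x, p) \<in> K" "(y, q) \<in> K" using lin by blast
      then show "(x \<ominus> y, p - q) \<in> \<Union>C" using CA pc_diff by blast
    qed
    then show "\<Union>C \<in> ?A" using CA C by blast
  qed
  then obtain M where M: "partial_character G M" "H \<subseteq> M"
    and max: "\<And>X. partial_character G X \<Longrightarrow> M \<subseteq> X \<Longrightarrow> X = M" by auto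
  have dom: "\<exists>p. (b, p) \<in> M" if b: "b \<in> carrier G" for b
  proof -
    obtain q where q: "\<And>k p. ([(k::int)] \<cdot> b, p) \<in> M \<Longrightarrow> p = qz_scale k q"
      using pc_value[OF M(1) b] by blast
    let ?X = "{(x \<oplus> [(k::int)] \<cdot> b, p + qz_scale k q) | x p k. (x, p) \<in> M}"
    have "M \<subseteq> ?X"
    proof (clarify)
      fix x p assume xp: "(x, p) \<in> M"
      then have "x = x \<oplus> [(0::int)] \<cdot> b" "p = p + qz_scale 0 q" using pc_carrier[OF M(1)] by auto
      then show "\<exists>x' p' k. (x, p) = (x' \<oplus> [(k::int)] \<cdot> b, p' + qz_scale k q) \<and> (x', p') \<in> M"
        using xp by blast
    qed
    then have "?X = M" by (intro max pc_adjoin[OF M(1) b q])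
    moreover have "(\<zero> \<oplus> [(1::int)] \<cdot> b, 0 + qz_scale 1 q) \<in> ?X" using pc_zero[OF M(1)] by blast
    ultimately have "(\<zero> \<oplus> [(1::int)] \<cdot> b, 0 + qz_scale 1 q) \<in> M" by (simp only:)
    then show ?thesis using b by auto
  qed
  define \<chi> where "\<chi> b = (THE p. (b, p) \<in> M)" for b
  have \<chi>: "\<chi> b = p" if "(b, p) \<in> M" for b p
    unfolding \<chi>_def using that pc_unique[OF M(1)] by blast
  show ?thesis
  proof (intro exI[of _ \<chi>] conjI ballI allI impI)
    show "\<chi> x = p" if "(x, p) \<in> H" for x p using \<chi> that M by blast
    fix x y assume "x \<in> carrier G" "y \<in> carrier G"
    then obtain p q where "(x, p) \<in> M" "(y, q) \<in> M" using dom by blast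
    then show "\<chi> (x \<oplus> y) = \<chi> x + \<chi> y" using pc_add[OF M(1)] \<chi> by metis
  qed
qed

lemma separating_character:
  assumes P: "subgroup P (add_monoid G)" and b: "b \<in> carrier G" "b \<notin> P"
  shows "\<exists>\<chi> :: 'a \<Rightarrow> qz. (\<forall>x\<in>carrier G. \<forall>y\<in>carrier G. \<chi> (x \<oplus> y) = \<chi> x + \<chi> y) \<and>
    (\<forall>x\<in>P. \<chi> x = 0) \<and> \<chi> b \<noteq> 0"
proof -
  let ?H = "P \<times> {0::qz}"
  have H: "partial_character G ?H"
    using subgroup.subset[OF P] subgroup.one_closed[OF P] subgroup.m_closed[OF P] subgroup.m_inv_closed[OF P]
    unfolding partial_character_def a_minus_def a_inv_def by auto
  have "(\<forall>p. (b, p) \<notin> ?H) \<and> (\<forall>x p. (x, p) \<in> ?H \<longrightarrow> p = 0)" using b(2) by auto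
  then obtain q where q: "\<And>k p. ([(k::int)] \<cdot> b, p) \<in> ?H \<Longrightarrow> p = qz_scale k q" and q0: "q \<noteq> 0"
    using pc_value[OF H b(1)] by meson
  define K where "K = {(x \<oplus> [(k::int)] \<cdot> b, p + qz_scale k q) | x p k. (x, p) \<in> ?H}"
  have K: "partial_character G K" unfolding K_def by (intro pc_adjoin[OF H b(1)] q)
  obtain \<chi> where add: "\<forall>x\<in>carrier G. \<forall>y\<in>carrier G. \<chi> (x \<oplus> y) = \<chi> x + \<chi> y"
    and ext: "\<And>x p. (x, p) \<in> K \<Longrightarrow> \<chi> x = p"
    using partial_character_extends[OF K] by blast
  have "(\<zero> \<oplus> [(1::int)] \<cdot> b, 0 + qz_scale 1 q) \<in> K" unfolding K_def using pc_zero[OF H] by blast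
  then have "\<chi> (\<zero> \<oplus> [(1::int)] \<cdot> b) = 0 + qz_scale 1 q" by (rule ext)
  then have "\<chi> b \<noteq> 0" using q0 b by simp
  moreover have "\<chi> x = 0" if "x \<in> P" for x
  proof -
    have "(x \<oplus> [(0::int)] \<cdot> b, 0 + qz_scale 0 q) \<in> K" unfolding K_def using that by blast
    then have "\<chi> (x \<oplus> [(0::int)] \<cdot> b) = 0 + qz_scale 0 q" by (rule ext)
    then show ?thesis using subgroup.subset[OF P] that by auto
  qed
  ultimately show ?thesis using add by blast
qed

end


section \<open>Homomorphisms and a coinduced injective module\<close>

lemma mod_homI:
  assumes "\<And>x. x \<in> carrier M \<Longrightarrow> f x \<in> carrier N"
    and "\<And>x y. x \<in> carrier M \<Longrightarrow> y \<in> carrier M \<Longrightarrow> f (x \<oplus>\<^bsub>M\<^esub> y) = f x \<oplus>\<^bsub>N\<^esub> f y"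
    and "\<And>r x. r \<in> carrier R \<Longrightarrow> x \<in> carrier M \<Longrightarrow> f (r \<odot>\<^bsub>M\<^esub> x) = r \<odot>\<^bsub>N\<^esub> f x"
  shows "f \<in> mod_hom R M N"
  using assms unfolding mod_hom_def by auto

lemma mod_hom_closed: "f \<in> mod_hom R M N \<Longrightarrow> x \<in> carrier M \<Longrightarrow> f x \<in> carrier N"
  and mod_hom_add: "f \<in> mod_hom R M N \<Longrightarrow> x \<in> carrier M \<Longrightarrow> y \<in> carrier M \<Longrightarrow>
    f (x \<oplus>\<^bsub>M\<^esub> y) = f x \<oplus>\<^bsub>N\<^esub> f y"
  and mod_hom_smult: "f \<in> mod_hom R M N \<Longrightarrow> r \<in> carrier R \<Longrightarrow> x \<in> carrier M \<Longrightarrow>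
    f (r \<odot>\<^bsub>M\<^esub> x) = r \<odot>\<^bsub>N\<^esub> f x"
  unfolding mod_hom_def by auto

lemma mod_hom_comp: "f \<in> mod_hom R L M \<Longrightarrow> g \<in> mod_hom R M N \<Longrightarrow> g \<circ> f \<in> mod_hom R L N"
  unfolding mod_hom_def by (auto simp: Pi_iff)

lemma module_cring: "module R M \<Longrightarrow> cring R"
  by (simp add: module_def)

lemma mod_hom_zero:
  assumes "module R M" "module R N" "f \<in> mod_hom R M N"
  shows "f \<zero>\<^bsub>M\<^esub> = \<zero>\<^bsub>N\<^esub>"
proof -
  interpret M: module R M by fact
  interpret N: module R N by fact
  have "f \<zero>\<^bsub>M\<^esub> = f (\<zero>\<^bsub>R\<^esub> \<odot>\<^bsub>M\<^esub> \<zero>\<^bsub>M\<^esub>)" by simp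
  also have "\<dots> = \<zero>\<^bsub>R\<^esub> \<odot>\<^bsub>N\<^esub> f \<zero>\<^bsub>M\<^esub>" by (rule mod_hom_smult[OF assms(3)]) auto
  also have "\<dots> = \<zero>\<^bsub>N\<^esub>" using mod_hom_closed[OF assms(3)] by simp
  finally show ?thesis .
qed

lemma mod_hom_minus:
  assumes "module R M" "module R N" "f \<in> mod_hom R M N" "x \<in> carrier M"
  shows "f (\<ominus>\<^bsub>M\<^esub> x) = \<ominus>\<^bsub>N\<^esub> f x"
proof -
  interpret M: module R M by fact
  interpret N: module R N by fact
  have "f x \<oplus>\<^bsub>N\<^esub> f (\<ominus>\<^bsub>M\<^esub> x) = \<zero>\<^bsub>N\<^esub>"
    using mod_hom_add[OF assms(3,4), of "\<ominus>\<^bsub>M\<^esub> x"] mod_hom_zero[OF assms(1-3)] assms(4)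
    by (simp add: M.M.r_neg)
  then show ?thesis
    using mod_hom_closed[OF assms(3)] assms(4)
    by (metis N.M.a_comm N.M.minus_equality M.M.a_inv_closed)
qed

lemma mod_hom_inj_onI:
  assumes "module R M" "module R N" "f \<in> mod_hom R M N"
    and ker: "\<And>x. x \<in> carrier M \<Longrightarrow> f x = \<zero>\<^bsub>N\<^esub> \<Longrightarrow> x = \<zero>\<^bsub>M\<^esub>"
  shows "inj_on f (carrier M)"
proof (rule inj_onI)
  interpret M: module R M by fact
  interpret N: module R N by fact
  fix x y assume xy: "x \<in> carrier M" "y \<in> carrier M" "f x = f y"
  have "f (x \<oplus>\<^bsub>M\<^esub> \<ominus>\<^bsub>M\<^esub> y) = \<zero>\<^bsub>N\<^esub>"
    using xy mod_hom_add[OF assms(3)] mod_hom_minus[OF assms(1-3)] mod_hom_closed[OF assms(3)]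
    by (simp add: N.M.r_neg)
  then have "x \<oplus>\<^bsub>M\<^esub> \<ominus>\<^bsub>M\<^esub> y = \<zero>\<^bsub>M\<^esub>" using ker xy by simp
  then show "x = y" using xy by (metis M.M.minus_equality M.M.minus_minus M.M.a_inv_closed)
qed

text \<open>
  The annihilator of an element.
\<close>

definition annihilator :: "('a, 'r) ring_scheme \<Rightarrow> ('a, 'm) module \<Rightarrow> 'm \<Rightarrow> 'a set" where
  "annihilator R M x = {r \<in> carrier R. r \<odot>\<^bsub>M\<^esub> x = \<zero>\<^bsub>M\<^esub>}"

text \<open>
  The module structure on \<open>j ` carrier M\<close> for which an injection \<open>j\<close> is an isomorphism; it serves
  to move modules into the universe \<open>'m\<close>.
\<close>

definition transport :: "('m \<Rightarrow> 'n) \<Rightarrow> ('a, 'm) module \<Rightarrow> ('a, 'n) module" where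
  "transport j M = \<lparr>carrier = j ` carrier M, monoid.mult = undefined, one = undefined,
     ring.zero = j \<zero>\<^bsub>M\<^esub>,
     add = (\<lambda>x y. j (inv_into (carrier M) j x \<oplus>\<^bsub>M\<^esub> inv_into (carrier M) j y)),
     smult = (\<lambda>r x. j (r \<odot>\<^bsub>M\<^esub> inv_into (carrier M) j x))\<rparr>"

lemma transport_module:
  assumes "module R M" and j: "inj_on j (carrier M)"
  shows "module R (transport j M)"
proof -
  interpret M: module R M by fact
  have [simp]: "\<And>x. x \<in> carrier M \<Longrightarrow> inv_into (carrier M) j (j x) = x"
    using j by (rule inv_into_f_f)
  show ?thesis
  proof (rule moduleI)
    show "cring R" by (rule M.R.cring_axioms)
    show "abelian_group (transport j M)"
    proof (rule abelian_groupI)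
      fix x assume "x \<in> carrier (transport j M)"
      then obtain u where "u \<in> carrier M" "x = j u" by (auto simp: transport_def)
      then show "\<exists>y\<in>carrier (transport j M). y \<oplus>\<^bsub>transport j M\<^esub> x = \<zero>\<^bsub>transport j M\<^esub>"
        by (intro bexI[of _ "j (\<ominus>\<^bsub>M\<^esub> u)"]) (auto simp: transport_def M.M.l_neg)
    qed (auto simp: transport_def M.M.a_ac)
  qed (auto simp: transport_def M.smult_l_distr M.smult_r_distr M.smult_assoc1)
qed

lemma transport_hom:
  assumes "module R M" and j: "inj_on j (carrier M)"
  shows "j \<in> mod_hom R M (transport j M)"
    and "inv_into (carrier M) j \<in> mod_hom R (transport j M) M"
proof -
  interpret M: module R M by fact
  have [simp]: "\<And>x. x \<in> carrier M \<Longrightarrow> inv_into (carrier M) j (j x) = x"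
    using j by (rule inv_into_f_f)
  show "j \<in> mod_hom R M (transport j M)"
    by (rule mod_homI) (auto simp: transport_def)
  show "inv_into (carrier M) j \<in> mod_hom R (transport j M) M"
    by (rule mod_homI) (auto simp: transport_def)
qed

text \<open>
  The product of \<open>R\<close> copies of the coinduced module \<open>Hom\<^sub>\<int>(R, \<rat>/\<int>)\<close>: functions \<open>F(s, x)\<close> that are
  additive in \<open>s\<close>, where \<open>x\<close> indexes the factor. The functions are set to \<open>0\<close> outside \<open>R \<times> R\<close>, so
  that equality of elements is equality of functions.
\<close>

definition coinduced :: "('a, 'r) ring_scheme \<Rightarrow> ('a, 'a \<times> 'a \<Rightarrow> qz) module" where
  "coinduced R = \<lparr>carrier = {F. (\<forall>s x. s \<notin> carrier R \<or> x \<notin> carrier R \<longrightarrow> F (s, x) = 0) \<and>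
       (\<forall>s\<in>carrier R. \<forall>t\<in>carrier R. \<forall>x\<in>carrier R. F (s \<oplus>\<^bsub>R\<^esub> t, x) = F (s, x) + F (t, x))},
     monoid.mult = undefined, one = undefined, ring.zero = (\<lambda>_. 0),
     add = (\<lambda>F G p. F p + G p),
     smult = (\<lambda>r F (s, x). if s \<in> carrier R \<and> x \<in> carrier R then F (s \<otimes>\<^bsub>R\<^esub> r, x) else 0)\<rparr>"

lemma coinduced_carrier: "F \<in> carrier (coinduced R) \<longleftrightarrow>
    (\<forall>s x. s \<notin> carrier R \<or> x \<notin> carrier R \<longrightarrow> F (s, x) = 0) \<and>
    (\<forall>s\<in>carrier R. \<forall>t\<in>carrier R. \<forall>x\<in>carrier R. F (s \<oplus>\<^bsub>R\<^esub> t, x) = F (s, x) + F (t, x))"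
  and coinduced_zero: "\<zero>\<^bsub>coinduced R\<^esub> = (\<lambda>_. 0)"
  and coinduced_add: "F \<oplus>\<^bsub>coinduced R\<^esub> G = (\<lambda>p. F p + G p)"
  and coinduced_smult: "r \<odot>\<^bsub>coinduced R\<^esub> F =
    (\<lambda>(s, x). if s \<in> carrier R \<and> x \<in> carrier R then F (s \<otimes>\<^bsub>R\<^esub> r, x) else 0)"
  by (simp_all add: coinduced_def)

lemma coinduced_module:
  assumes "cring R"
  shows "module R (coinduced R)"
proof -
  interpret R: cring R by fact
  note simps = coinduced_carrier coinduced_zero coinduced_add coinduced_smult
  show ?thesis
  proof (rule moduleI)
    show "abelian_group (coinduced R)"
    proof (rule abelian_groupI)
      fix F assume "F \<in> carrier (coinduced R)"
      then show "\<exists>G\<in>carrier (coinduced R). G \<oplus>\<^bsub>coinduced R\<^esub> F = \<zero>\<^bsub>coinduced R\<^esub>"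
        by (intro bexI[of _ "\<lambda>p. - F p"]) (auto simp: simps)
    qed (auto simp: simps ac_simps)
    show "\<one>\<^bsub>R\<^esub> \<odot>\<^bsub>coinduced R\<^esub> F = F" if "F \<in> carrier (coinduced R)" for F
      using that by (auto simp: simps fun_eq_iff)
  qed (use assms in \<open>auto simp: simps fun_eq_iff R.l_distr R.r_distr R.m_assoc R.m_comm R.m_lcomm\<close>)
qed

text \<open>
  A homomorphism \<open>f\<close> into the coinduced module is given by the characters \<open>a \<mapsto> f(a)(1, x)\<close>, and these
  extend along \<open>i\<close>.
\<close>

lemma coinduced_injective:
  fixes A :: "('a, 'b) module" and B :: "('a, 'c) module"
  assumes "module R A" "module R B" and i: "i \<in> mod_mono R A B"
    and f: "f \<in> mod_hom R A (coinduced R)"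
  shows "\<exists>g\<in>mod_hom R B (coinduced R). \<forall>a\<in>carrier A. g (i a) = f a"
proof -
  interpret A: module R A by fact
  interpret B: module R B by fact
  interpret W: module R "coinduced R" by (intro coinduced_module A.R.cring_axioms)
  note simps = coinduced_carrier coinduced_zero coinduced_add coinduced_smult
  have ihom: "i \<in> mod_hom R A B" and iinj: "inj_on i (carrier A)" using i by (auto simp: mod_mono_def)
  note hi = mod_hom_closed[OF ihom] mod_hom_add[OF ihom] mod_hom_minus[OF assms(1,2) ihom]
    mod_hom_smult[OF ihom] mod_hom_zero[OF assms(1,2) ihom]
  note hf = mod_hom_closed[OF f] mod_hom_add[OF f] mod_hom_smult[OF f]
    mod_hom_zero[OF assms(1) W.module_axioms f] mod_hom_minus[OF assms(1) W.module_axioms f]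
  have fneg: "f (\<ominus>\<^bsub>A\<^esub> a) p = - f a p" if "a \<in> carrier A" for a p
  proof -
    have "f (a \<oplus>\<^bsub>A\<^esub> \<ominus>\<^bsub>A\<^esub> a) p = 0" using that hf(4) by (simp add: A.M.r_neg simps)
    then have "f a p + f (\<ominus>\<^bsub>A\<^esub> a) p = 0" using hf(2)[OF that, of "\<ominus>\<^bsub>A\<^esub> a"] that by (simp add: simps)
    then show ?thesis by (simp add: eq_neg_iff_add_eq_0 add.commute)
  qed
  have "\<exists>\<psi>. (\<forall>b\<in>carrier B. \<forall>b'\<in>carrier B. \<psi> (b \<oplus>\<^bsub>B\<^esub> b') = \<psi> b + \<psi> b') \<and>
      (\<forall>a\<in>carrier A. \<psi> (i a) = f a (\<one>\<^bsub>R\<^esub>, x))" for x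
  proof -
    let ?H = "{(i a, f a (\<one>\<^bsub>R\<^esub>, x)) | a. a \<in> carrier A}"
    have "partial_character B ?H"
      unfolding partial_character_def
    proof (intro conjI allI impI)
      show "?H \<subseteq> carrier B \<times> UNIV" using hi by auto
      show "(\<zero>\<^bsub>B\<^esub>, 0) \<in> ?H" using hi(5) hf(4) by (force simp: simps)
      show "q = 0" if q: "(\<zero>\<^bsub>B\<^esub>, q) \<in> ?H" for q
      proof -
        obtain a where a: "a \<in> carrier A" "i a = \<zero>\<^bsub>B\<^esub>" "q = f a (\<one>\<^bsub>R\<^esub>, x)" using q by auto
        then have "a = \<zero>\<^bsub>A\<^esub>" using inj_onD[OF iinj] hi(5) by (metis A.M.zero_closed)
        then show ?thesis using a hf(4) by (simp add: simps)
      qed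
      fix u p v q assume "(u, p) \<in> ?H" "(v, q) \<in> ?H"
      then obtain a a' where a: "a \<in> carrier A" "a' \<in> carrier A" "u = i a" "v = i a'"
        "p = f a (\<one>\<^bsub>R\<^esub>, x)" "q = f a' (\<one>\<^bsub>R\<^esub>, x)" by auto
      then have "u \<ominus>\<^bsub>B\<^esub> v = i (a \<oplus>\<^bsub>A\<^esub> \<ominus>\<^bsub>A\<^esub> a')"
        using hi by (simp add: a_minus_def)
      moreover have "p - q = f (a \<oplus>\<^bsub>A\<^esub> \<ominus>\<^bsub>A\<^esub> a') (\<one>\<^bsub>R\<^esub>, x)"
        using a hf(2) fneg by (simp add: simps)
      ultimately show "(u \<ominus>\<^bsub>B\<^esub> v, p - q) \<in> ?H" using a by blast
    qed
    from B.M.partial_character_extends[OF this] show ?thesis by blast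
  qed
  then obtain \<psi> where \<psi>: "\<And>x b b'. b \<in> carrier B \<Longrightarrow> b' \<in> carrier B \<Longrightarrow> \<psi> x (b \<oplus>\<^bsub>B\<^esub> b') = \<psi> x b + \<psi> x b'"
    and \<psi>i: "\<And>x a. a \<in> carrier A \<Longrightarrow> \<psi> x (i a) = f a (\<one>\<^bsub>R\<^esub>, x)" by metis
  define g where "g b = (\<lambda>(s, x). if s \<in> carrier R \<and> x \<in> carrier R then \<psi> x (s \<odot>\<^bsub>B\<^esub> b) else 0)" for b
  show ?thesis
  proof (intro bexI[of _ g] ballI)
    show "g \<in> mod_hom R B (coinduced R)"
      by (rule mod_homI) (auto simp: g_def simps fun_eq_iff \<psi> B.smult_l_distr B.smult_r_distr B.smult_assoc1)
    fix a assume a: "a \<in> carrier A"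
    show "g (i a) = f a"
    proof (rule ext, clarify)
      fix s x
      show "g (i a) (s, x) = f a (s, x)"
      proof (cases "s \<in> carrier R \<and> x \<in> carrier R")
        case True
        then have "g (i a) (s, x) = \<psi> x (i (s \<odot>\<^bsub>A\<^esub> a))" using a hi(4) by (simp add: g_def)
        also have "\<dots> = (s \<odot>\<^bsub>coinduced R\<^esub> f a) (\<one>\<^bsub>R\<^esub>, x)" using a True by (simp add: \<psi>i hf(3))
        also have "\<dots> = f a (s, x)" using True by (simp add: simps)
        finally show ?thesis .
      next
        case False
        then show ?thesis using hf(1)[OF a] by (auto simp: g_def simps)
      qed
    qed
  qed
qed

text \<open>
  In the \<open>x\<close>-th factor take a character of \<open>R/I\<close> that does not vanish at \<open>x\<close>, unless \<open>x \<in> I\<close>.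
\<close>

lemma coinduced_annihilator:
  assumes "cring R" "ideal I R"
  shows "\<exists>w\<in>carrier (coinduced R). annihilator R (coinduced R) w = I"
proof -
  interpret R: cring R by fact
  interpret I: ideal I R by fact
  note simps = coinduced_carrier coinduced_zero coinduced_add coinduced_smult
  have "\<exists>\<chi>. (\<forall>s\<in>carrier R. \<forall>t\<in>carrier R. \<chi> (s \<oplus>\<^bsub>R\<^esub> t) = \<chi> s + \<chi> t) \<and> (\<forall>s\<in>I. \<chi> s = (0::qz)) \<and>
      (x \<notin> I \<longrightarrow> \<chi> x \<noteq> 0)" if "x \<in> carrier R" for x
  proof (cases "x \<in> I")
    case True
    then show ?thesis by (intro exI[of _ "\<lambda>_. 0"]) auto
  next
    case False
    then show ?thesis using R.separating_character[OF I.a_subgroup[unfolded additive_subgroup_def] that] by auto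
  qed
  then obtain \<chi> where \<chi>: "\<And>x s t. x \<in> carrier R \<Longrightarrow> s \<in> carrier R \<Longrightarrow> t \<in> carrier R \<Longrightarrow> \<chi> x (s \<oplus>\<^bsub>R\<^esub> t) = \<chi> x s + \<chi> x t"
     "\<And>x s. x \<in> carrier R \<Longrightarrow> s \<in> I \<Longrightarrow> \<chi> x s = (0::qz)"
     "\<And>x. x \<in> carrier R \<Longrightarrow> x \<notin> I \<Longrightarrow> \<chi> x x \<noteq> 0"
    by metis
  define w where "w = (\<lambda>(s, x). if s \<in> carrier R \<and> x \<in> carrier R then \<chi> x s else 0)"
  have "w \<in> carrier (coinduced R)" by (auto simp: w_def simps \<chi>)
  moreover have "annihilator R (coinduced R) w = I"
  proof (intro equalityI subsetI)
    fix r assume r: "r \<in> annihilator R (coinduced R) w"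
    then have rR: "r \<in> carrier R" and "r \<odot>\<^bsub>coinduced R\<^esub> w = \<zero>\<^bsub>coinduced R\<^esub>"
      by (auto simp: annihilator_def)
    then have "(r \<odot>\<^bsub>coinduced R\<^esub> w) (\<one>\<^bsub>R\<^esub>, r) = 0" by (simp add: simps)
    then show "r \<in> I" using rR \<chi>(3)[OF rR] by (auto simp: simps w_def)
  next
    fix r assume r: "r \<in> I"
    then have "\<And>s. s \<in> carrier R \<Longrightarrow> s \<otimes>\<^bsub>R\<^esub> r \<in> I" by (rule I.I_l_closed)
    then show "r \<in> annihilator R (coinduced R) w"
      using r I.Icarr[OF r] by (auto simp: annihilator_def simps w_def fun_eq_iff \<chi>)
  qed
  ultimately show ?thesis by blast
qed

lemma coinduced_embeds:
  assumes "cring R" "large_universe R TYPE('m)"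
  shows "\<exists>j :: ('a \<times> 'a \<Rightarrow> qz) \<Rightarrow> 'm. inj_on j (carrier (coinduced (R :: ('a, 'r) ring_scheme)))"
proof -
  interpret R: cring R by fact
  obtain \<iota> :: "'a list set \<Rightarrow> 'm" where \<iota>: "inj_on \<iota> (Pow (lists (carrier R)))"
    using assms(2) by (auto simp: large_universe_def)
  obtain c :: "qz \<Rightarrow> nat" where c: "inj c" using qz_embeds_nat by blast
  \<comment> \<open>the graph of \<open>F\<close>, with a triple \<open>(s, x, n)\<close> written as the list \<open>s, x\<close> followed by \<open>n\<close> zeros\<close>
  define code where "code F = {s # x # replicate (c (F (s, x))) \<zero>\<^bsub>R\<^esub> | s x. s \<in> carrier R \<and> x \<in> carrier R}"
    for F :: "'a \<times> 'a \<Rightarrow> qz"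
  have sub: "code F \<in> Pow (lists (carrier R))" for F by (auto simp: code_def)
  have "inj_on (\<lambda>F. \<iota> (code F)) (carrier (coinduced R))"
  proof (rule inj_onI)
    fix F G assume FG: "F \<in> carrier (coinduced R)" "G \<in> carrier (coinduced R)" "\<iota> (code F) = \<iota> (code G)"
    then have eq: "code F = code G" using inj_onD[OF \<iota>] sub by blast
    show "F = G"
    proof (rule ext, clarify)
      fix s x
      show "F (s, x) = G (s, x)"
      proof (cases "s \<in> carrier R \<and> x \<in> carrier R")
        case True
        then have "s # x # replicate (c (F (s, x))) \<zero>\<^bsub>R\<^esub> \<in> code G" unfolding eq[symmetric] by (auto simp: code_def)
        then have "replicate (c (F (s, x))) \<zero>\<^bsub>R\<^esub> = replicate (c (G (s, x))) \<zero>\<^bsub>R\<^esub>" by (auto simp: code_def)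
        then have "c (F (s, x)) = c (G (s, x))" by (metis length_replicate)
        then show ?thesis using c by (simp add: inj_eq)
      next
        case False
        then show ?thesis using FG by (auto simp: coinduced_carrier)
      qed
    qed
  qed
  then show ?thesis by blast
qed

lemma ambient_injective:
  fixes R :: "('a, 'r) ring_scheme"
  assumes R: "cring R" and "large_universe R TYPE('m)"
  shows "\<exists>W :: ('a, 'm) module. injective_module R W \<and>
    (\<forall>I. ideal I R \<longrightarrow> (\<exists>w\<in>carrier W. annihilator R W w = I))"
proof -
  obtain j :: "('a \<times> 'a \<Rightarrow> qz) \<Rightarrow> 'm" where j: "inj_on j (carrier (coinduced R))"
    using coinduced_embeds[OF assms] by blast
  let ?C = "coinduced R" and ?W = "transport j (coinduced R)"
  note C = coinduced_module[OF R]
  note W = transport_module[OF C j]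
  note h = transport_hom[OF C j]
  have "injective_module R ?W"
    unfolding injective_module_def
  proof (intro conjI W allI impI ballI)
    fix A B :: "('a, 'm) module" and i f
    assume AB: "module R A" "module R B" "i \<in> mod_mono R A B" and f: "f \<in> mod_hom R A ?W"
    obtain g where g: "g \<in> mod_hom R B ?C" "\<forall>a\<in>carrier A. g (i a) = (inv_into (carrier ?C) j \<circ> f) a"
      using coinduced_injective[OF AB mod_hom_comp[OF f h(2)]] by blast
    show "\<exists>g\<in>mod_hom R B ?W. \<forall>x\<in>carrier A. g (i x) = f x"
    proof (intro bexI[of _ "j \<circ> g"] ballI)
      show "j \<circ> g \<in> mod_hom R B ?W" using mod_hom_comp[OF g(1) h(1)] .
      fix x assume x: "x \<in> carrier A"
      then have "f x \<in> j ` carrier ?C" using mod_hom_closed[OF f] by (simp add: transport_def)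
      then show "(j \<circ> g) (i x) = f x" using x g(2) by (simp add: f_inv_into_f)
    qed
  qed
  moreover have "\<exists>w\<in>carrier ?W. annihilator R ?W w = I" if I: "ideal I R" for I
  proof -
    obtain w where w: "w \<in> carrier ?C" "annihilator R ?C w = I" using coinduced_annihilator[OF R I] by blast
    interpret C: module R ?C by (rule C)
    have "(j (r \<odot>\<^bsub>?C\<^esub> w) = j \<zero>\<^bsub>?C\<^esub>) = (r \<odot>\<^bsub>?C\<^esub> w = \<zero>\<^bsub>?C\<^esub>)" if "r \<in> carrier R" for r
      using inj_on_eq_iff[OF j] that w by simp
    then have "annihilator R ?W (j w) = I"
      using w inv_into_f_f[OF j w(1)] by (auto simp: annihilator_def transport_def)
    then show ?thesis using w by (intro bexI[of _ "j w"]) (auto simp: transport_def)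
  qed
  ultimately show ?thesis by blast
qed


section \<open>Extension into injective modules and hulls of cyclic modules\<close>

lemma submodule_zero: "submodule H R M \<Longrightarrow> \<zero>\<^bsub>M\<^esub> \<in> H"
  using submodule.axioms(1) subgroup.one_closed by fastforce

lemma (in module) submoduleI':
  assumes "H \<subseteq> carrier M" "\<zero>\<^bsub>M\<^esub> \<in> H"
    and "\<And>a b. a \<in> H \<Longrightarrow> b \<in> H \<Longrightarrow> a \<oplus>\<^bsub>M\<^esub> b \<in> H"
    and "\<And>r x. r \<in> carrier R \<Longrightarrow> x \<in> H \<Longrightarrow> r \<odot>\<^bsub>M\<^esub> x \<in> H"
  shows "submodule H R M"
proof (rule submoduleI)
  fix a assume a: "a \<in> H"
  then have "\<ominus>\<^bsub>M\<^esub> a = (\<ominus> \<one>) \<odot>\<^bsub>M\<^esub> a" using assms(1) smult_l_minus[of \<one> a] by auto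
  then show "\<ominus>\<^bsub>M\<^esub> a \<in> H" using assms(4)[OF _ a] by simp
qed (use assms in auto)

lemma (in module) submodule_cyclic:
  assumes "x \<in> carrier M" shows "submodule {r \<odot>\<^bsub>M\<^esub> x | r. r \<in> carrier R} R M"
proof (rule submoduleI')
  show "\<zero>\<^bsub>M\<^esub> \<in> {r \<odot>\<^bsub>M\<^esub> x | r. r \<in> carrier R}" 
    using assms by (intro CollectI exI[of _ "\<zero>"]) simp
next
  fix a b assume "a \<in> {r \<odot>\<^bsub>M\<^esub> x | r. r \<in> carrier R}" "b \<in> {r \<odot>\<^bsub>M\<^esub> x | r. r \<in> carrier R}"
  then obtain r s where "r \<in> carrier R" "s \<in> carrier R" "a = r \<odot>\<^bsub>M\<^esub> x" "b = s \<odot>\<^bsub>M\<^esub> x" by blast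
  then show "a \<oplus>\<^bsub>M\<^esub> b \<in> {r \<odot>\<^bsub>M\<^esub> x | r. r \<in> carrier R}"
    using assms by (intro CollectI exI[of _ "r \<oplus> s"]) (simp add: smult_l_distr)
next
  fix t a assume t: "t \<in> carrier R" and "a \<in> {r \<odot>\<^bsub>M\<^esub> x | r. r \<in> carrier R}"
  then obtain r where "r \<in> carrier R" "a = r \<odot>\<^bsub>M\<^esub> x" by blast
  then show "t \<odot>\<^bsub>M\<^esub> a \<in> {r \<odot>\<^bsub>M\<^esub> x | r. r \<in> carrier R}"
    using assms t by (intro CollectI exI[of _ "t \<otimes> r"]) (simp add: smult_assoc1)
qed (use assms in auto)

lemma (in module) submodule_Union_chain:
  assumes C: "C \<noteq> {}" and sub: "\<And>H. H \<in> C \<Longrightarrow> submodule H R M"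
    and lin: "\<And>H K. H \<in> C \<Longrightarrow> K \<in> C \<Longrightarrow> H \<subseteq> K \<or> K \<subseteq> H"
  shows "submodule (\<Union>C) R M"
proof (rule submoduleI')
  show "\<Union>C \<subseteq> carrier M" using submoduleE(1)[OF sub] by blast
  show "\<zero>\<^bsub>M\<^esub> \<in> \<Union>C" using C submodule_zero[OF sub] by blast
  show "r \<odot>\<^bsub>M\<^esub> x \<in> \<Union>C" if "r \<in> carrier R" "x \<in> \<Union>C" for r x
    using that submoduleE(4)[OF sub] by blast
  fix a b assume "a \<in> \<Union>C" "b \<in> \<Union>C"
  then obtain H where "H \<in> C" "a \<in> H" "b \<in> H" using lin by blast
  then show "a \<oplus>\<^bsub>M\<^esub> b \<in> \<Union>C" using submoduleE(5)[OF sub] by blast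
qed

lemma injective_module_module: "injective_module R E \<Longrightarrow> module R E"
  by (simp add: injective_module_def)

lemma injective_moduleD:
  fixes E A B :: "('a, 'm) module"
  assumes "injective_module R E" "module R A" "module R B" "i \<in> mod_mono R A B" "f \<in> mod_hom R A E"
  shows "\<exists>g\<in>mod_hom R B E. \<forall>x\<in>carrier A. g (i x) = f x"
  using assms unfolding injective_module_def by blast

text \<open>
  Homomorphisms into an injective module extend from a submodule of \<open>B\<close>; the partial homomorphism is
  given by its graph \<open>G\<close>, a single-valued submodule of \<open>B \<times> E\<close>.
\<close>

lemma injective_extends_same_type:
  fixes E :: "('a, 'm) module" and B :: "('a, 'm) module"
  assumes E: "injective_module R E" and B: "module R B"
    and G: "G \<subseteq> carrier B \<times> carrier E" "(\<zero>\<^bsub>B\<^esub>, \<zero>\<^bsub>E\<^esub>) \<in> G"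
      "\<And>b e b' e'. (b, e) \<in> G \<Longrightarrow> (b', e') \<in> G \<Longrightarrow> (b \<oplus>\<^bsub>B\<^esub> b', e \<oplus>\<^bsub>E\<^esub> e') \<in> G"
      "\<And>r b e. r \<in> carrier R \<Longrightarrow> (b, e) \<in> G \<Longrightarrow> (r \<odot>\<^bsub>B\<^esub> b, r \<odot>\<^bsub>E\<^esub> e) \<in> G"
    and single: "\<And>e. (\<zero>\<^bsub>B\<^esub>, e) \<in> G \<Longrightarrow> e = \<zero>\<^bsub>E\<^esub>"
  shows "\<exists>g\<in>mod_hom R B E. \<forall>b e. (b, e) \<in> G \<longrightarrow> g b = e"
proof -
  interpret E: module R E using E by (rule injective_module_module)
  interpret B: module R B by (rule B)
  have neg: "(\<ominus>\<^bsub>B\<^esub> b, \<ominus>\<^bsub>E\<^esub> e) \<in> G" if "(b, e) \<in> G" for b e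
    using G(4)[of "\<ominus>\<^bsub>R\<^esub> \<one>\<^bsub>R\<^esub>", OF _ that] G(1) that
    by (auto simp: B.smult_l_minus E.smult_l_minus)
  have unique: "e = e'" if "(b, e) \<in> G" "(b, e') \<in> G" for b e e'
  proof -
    have c: "b \<in> carrier B" "e \<in> carrier E" "e' \<in> carrier E" using that G(1) by auto
    have "(b \<oplus>\<^bsub>B\<^esub> \<ominus>\<^bsub>B\<^esub> b, e \<oplus>\<^bsub>E\<^esub> \<ominus>\<^bsub>E\<^esub> e') \<in> G" using G(3)[OF that(1) neg[OF that(2)]] .
    then have "e \<oplus>\<^bsub>E\<^esub> \<ominus>\<^bsub>E\<^esub> e' = \<zero>\<^bsub>E\<^esub>" using single c by (simp add: B.M.r_neg)
    then show ?thesis using c by (metis E.M.minus_equality E.M.minus_minus E.M.a_inv_closed)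
  qed
  let ?D = "fst ` G"
  define f where "f b = (THE e. (b, e) \<in> G)" for b
  have f: "f b = e" if "(b, e) \<in> G" for b e using that unique unfolding f_def by blast
  have "submodule ?D R B"
  proof (rule B.submoduleI')
    show "?D \<subseteq> carrier B" using G(1) by auto
    show "\<zero>\<^bsub>B\<^esub> \<in> ?D" using imageI[OF G(2), of fst] by simp
  next
    fix x y assume "x \<in> ?D" "y \<in> ?D"
    then obtain c d where "(x, c) \<in> G" "(y, d) \<in> G" by auto
    from imageI[OF G(3)[OF this], of fst] show "x \<oplus>\<^bsub>B\<^esub> y \<in> ?D" by simp
  next
    fix r x assume r: "r \<in> carrier R" and "x \<in> ?D"
    then obtain c where "(x, c) \<in> G" by auto
    from imageI[OF G(4)[OF r this], of fst] show "r \<odot>\<^bsub>B\<^esub> x \<in> ?D" by simp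
  qed
  then have D: "module R (B\<lparr>carrier := ?D\<rparr>)" using submodule.submodule_is_module B by blast
  have "f \<in> mod_hom R (B\<lparr>carrier := ?D\<rparr>) E"
  proof (rule mod_homI)
    show "f x \<in> carrier E" if "x \<in> carrier (B\<lparr>carrier := ?D\<rparr>)" for x using that f G(1) by fastforce
    show "f (x \<oplus>\<^bsub>B\<lparr>carrier := ?D\<rparr>\<^esub> y) = f x \<oplus>\<^bsub>E\<^esub> f y"
      if "x \<in> carrier (B\<lparr>carrier := ?D\<rparr>)" "y \<in> carrier (B\<lparr>carrier := ?D\<rparr>)" for x y
      using that f G(3) by fastforce
    show "f (r \<odot>\<^bsub>B\<lparr>carrier := ?D\<rparr>\<^esub> x) = r \<odot>\<^bsub>E\<^esub> f x"
      if "r \<in> carrier R" "x \<in> carrier (B\<lparr>carrier := ?D\<rparr>)" for r x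
      using that f G(4) by fastforce
  qed
  moreover have "id \<in> mod_mono R (B\<lparr>carrier := ?D\<rparr>) B"
    using G(1) unfolding mod_mono_def mod_hom_def by auto
  ultimately have "\<exists>g\<in>mod_hom R B E. \<forall>x\<in>carrier (B\<lparr>carrier := ?D\<rparr>). g (id x) = f x"
    by (intro injective_moduleD[OF E D B])
  then obtain g where g: "g \<in> mod_hom R B E" "\<forall>x\<in>?D. g (id x) = f x" by auto
  have "g b = e" if "(b, e) \<in> G" for b e
  proof -
    have "b \<in> ?D" using that by force
    then show ?thesis using g(2) f[OF that] by auto
  qed
  then show ?thesis using g(1) by blast
qed

text \<open>
  The same for a module \<open>B\<close> of another type. The injection \<open>j\<close> is needed since the definition of
  injectivity only tests modules in \<open>'m\<close>.
\<close>

lemma injective_extends: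
  fixes E :: "('a, 'm) module" and B :: "('a, 'b) module" and j :: "'b \<Rightarrow> 'm"
  assumes E: "injective_module R E" and B: "module R B" and j: "inj_on j (carrier B)"
    and G: "G \<subseteq> carrier B \<times> carrier E" "(\<zero>\<^bsub>B\<^esub>, \<zero>\<^bsub>E\<^esub>) \<in> G"
      "\<And>b e b' e'. (b, e) \<in> G \<Longrightarrow> (b', e') \<in> G \<Longrightarrow> (b \<oplus>\<^bsub>B\<^esub> b', e \<oplus>\<^bsub>E\<^esub> e') \<in> G"
      "\<And>r b e. r \<in> carrier R \<Longrightarrow> (b, e) \<in> G \<Longrightarrow> (r \<odot>\<^bsub>B\<^esub> b, r \<odot>\<^bsub>E\<^esub> e) \<in> G"
    and single: "\<And>e. (\<zero>\<^bsub>B\<^esub>, e) \<in> G \<Longrightarrow> e = \<zero>\<^bsub>E\<^esub>"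
  shows "\<exists>g\<in>mod_hom R B E. \<forall>b e. (b, e) \<in> G \<longrightarrow> g b = e"
proof -
  interpret B: module R B by (rule B)
  let ?T = "transport j B" and ?G = "(\<lambda>(b, e). (j b, e)) ` G"
  note h = transport_hom[OF B j]
  have jj: "inv_into (carrier B) j (j b) = b" if "b \<in> carrier B" for b using j that by (rule inv_into_f_f)
  have GB: "b \<in> carrier B" if "(b, e) \<in> G" for b e using that G(1) by auto
  have "\<exists>g\<in>mod_hom R ?T E. \<forall>b e. (b, e) \<in> ?G \<longrightarrow> g b = e"
  proof (rule injective_extends_same_type[OF E transport_module[OF B j]])
    show "?G \<subseteq> carrier ?T \<times> carrier E" using G(1) by (auto simp: transport_def)
    show "(\<zero>\<^bsub>?T\<^esub>, \<zero>\<^bsub>E\<^esub>) \<in> ?G" using G(2) by (force simp: transport_def)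
    show "(b \<oplus>\<^bsub>?T\<^esub> b', e \<oplus>\<^bsub>E\<^esub> e') \<in> ?G" if be: "(b, e) \<in> ?G" "(b', e') \<in> ?G" for b e b' e'
    proof -
      obtain c c' where c: "(c, e) \<in> G" "b = j c" "(c', e') \<in> G" "b' = j c'" using be by auto
      have "b \<oplus>\<^bsub>?T\<^esub> b' = j (c \<oplus>\<^bsub>B\<^esub> c')"
        using mod_hom_add[OF h(1)] GB c by auto
      then show ?thesis using G(3)[OF c(1,3)] by force
    qed
    show "(r \<odot>\<^bsub>?T\<^esub> b, r \<odot>\<^bsub>E\<^esub> e) \<in> ?G" if r: "r \<in> carrier R" and be: "(b, e) \<in> ?G" for r b e
    proof -
      obtain c where c: "(c, e) \<in> G" "b = j c" using be by auto
      have "r \<odot>\<^bsub>?T\<^esub> b = j (r \<odot>\<^bsub>B\<^esub> c)"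
        using mod_hom_smult[OF h(1) r] GB c by auto
      then show ?thesis using G(4)[OF r c(1)] by force
    qed
    show "e = \<zero>\<^bsub>E\<^esub>" if e: "(\<zero>\<^bsub>?T\<^esub>, e) \<in> ?G" for e
    proof -
      obtain c where c: "(c, e) \<in> G" "j c = j \<zero>\<^bsub>B\<^esub>" using e by (auto simp: transport_def)
      then have "c = \<zero>\<^bsub>B\<^esub>" using inj_onD[OF j] GB by blast
      then show ?thesis using single c by simp
    qed
  qed
  then obtain g where g: "g \<in> mod_hom R ?T E" "\<And>b e. (b, e) \<in> ?G \<Longrightarrow> g b = e" by blast
  show ?thesis
  proof (intro bexI[of _ "g \<circ> j"] allI impI)
    show "g \<circ> j \<in> mod_hom R B E" using mod_hom_comp[OF h(1) g(1)] .
    show "(g \<circ> j) b = e" if "(b, e) \<in> G" for b e using g(2)[of "j b" e] that by force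
  qed
qed

lemma injective_extends_cyclic:
  fixes E :: "('a, 'm) module" and B :: "('a, 'm) module"
  assumes E: "injective_module R E" and B: "module R B"
    and b: "b \<in> carrier B" and e: "e \<in> carrier E" and ann: "annihilator R B b \<subseteq> annihilator R E e"
  shows "\<exists>g\<in>mod_hom R B E. g b = e"
proof -
  interpret E: module R E using E by (rule injective_module_module)
  interpret B: module R B by (rule B)
  let ?G = "{(r \<odot>\<^bsub>B\<^esub> b, r \<odot>\<^bsub>E\<^esub> e) | r. r \<in> carrier R}"
  have "\<exists>g\<in>mod_hom R B E. \<forall>x y. (x, y) \<in> ?G \<longrightarrow> g x = y"
  proof (rule injective_extends_same_type[OF E B])
    show "?G \<subseteq> carrier B \<times> carrier E" using b e by auto
    show "(\<zero>\<^bsub>B\<^esub>, \<zero>\<^bsub>E\<^esub>) \<in> ?G" using b e by (force intro: exI[of _ "\<zero>\<^bsub>R\<^esub>"])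
    show "(x \<oplus>\<^bsub>B\<^esub> x', y \<oplus>\<^bsub>E\<^esub> y') \<in> ?G" if "(x, y) \<in> ?G" "(x', y') \<in> ?G" for x y x' y'
    proof -
      obtain r r' where "r \<in> carrier R" "r' \<in> carrier R" "x = r \<odot>\<^bsub>B\<^esub> b" "y = r \<odot>\<^bsub>E\<^esub> e"
        "x' = r' \<odot>\<^bsub>B\<^esub> b" "y' = r' \<odot>\<^bsub>E\<^esub> e" using \<open>(x, y) \<in> ?G\<close> \<open>(x', y') \<in> ?G\<close> by auto
      then show ?thesis using b e by (auto intro!: exI[of _ "r \<oplus>\<^bsub>R\<^esub> r'"] simp: B.smult_l_distr E.smult_l_distr)
    qed
    show "(s \<odot>\<^bsub>B\<^esub> x, s \<odot>\<^bsub>E\<^esub> y) \<in> ?G" if "s \<in> carrier R" "(x, y) \<in> ?G" for s x y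
    proof -
      obtain r where "r \<in> carrier R" "x = r \<odot>\<^bsub>B\<^esub> b" "y = r \<odot>\<^bsub>E\<^esub> e" using \<open>(x, y) \<in> ?G\<close> by auto
      then show ?thesis using b e that
        by (auto intro!: exI[of _ "s \<otimes>\<^bsub>R\<^esub> r"] simp: B.smult_assoc1 E.smult_assoc1)
    qed
    show "y = \<zero>\<^bsub>E\<^esub>" if y: "(\<zero>\<^bsub>B\<^esub>, y) \<in> ?G" for y
    proof -
      obtain r where "r \<in> carrier R" "\<zero>\<^bsub>B\<^esub> = r \<odot>\<^bsub>B\<^esub> b" "y = r \<odot>\<^bsub>E\<^esub> e" using y by auto
      then show ?thesis using ann unfolding annihilator_def by auto
    qed
  qed
  then obtain g where g: "g \<in> mod_hom R B E" "\<And>x y. (x, y) \<in> ?G \<Longrightarrow> g x = y" by blast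
  have "(\<one>\<^bsub>R\<^esub> \<odot>\<^bsub>B\<^esub> b, \<one>\<^bsub>R\<^esub> \<odot>\<^bsub>E\<^esub> e) \<in> ?G" by blast
  then show ?thesis using g b e by (intro bexI[of _ g]) auto
qed

text \<open>
  The submodule \<open>R e\<close> is a copy of \<open>R/P\<close>, and \<open>E\<close> is an essential extension of it.
\<close>

definition essential_generator ::
  "('a, 'r) ring_scheme \<Rightarrow> 'a set \<Rightarrow> ('a, 'm) module \<Rightarrow> 'm \<Rightarrow> bool" where
  "essential_generator R P E e \<longleftrightarrow> e \<in> carrier E \<and> annihilator R E e = P \<and>
     (\<forall>y\<in>carrier E. y \<noteq> \<zero>\<^bsub>E\<^esub> \<longrightarrow>
        (\<exists>r\<in>carrier R. \<exists>s\<in>carrier R. r \<odot>\<^bsub>E\<^esub> y = s \<odot>\<^bsub>E\<^esub> e \<and> s \<odot>\<^bsub>E\<^esub> e \<noteq> \<zero>\<^bsub>E\<^esub>))"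

lemma quot_module_carrier: "carrier (quot_module R I) = (\<lambda>r. I +>\<^bsub>R\<^esub> r) ` carrier R"
  by (auto simp: quot_module_def FactRing_def A_RCOSETS_def')

lemma quot_module_add:
  assumes "ideal I R" "a \<in> carrier R" "b \<in> carrier R"
  shows "(I +>\<^bsub>R\<^esub> a) \<oplus>\<^bsub>quot_module R I\<^esub> (I +>\<^bsub>R\<^esub> b) = I +>\<^bsub>R\<^esub> (a \<oplus>\<^bsub>R\<^esub> b)"
  using ideal.a_rcos_sum[OF assms] by (simp add: quot_module_def FactRing_def)

lemma quot_module_smult:
  assumes "ideal I R" "a \<in> carrier R" "b \<in> carrier R"
  shows "a \<odot>\<^bsub>quot_module R I\<^esub> (I +>\<^bsub>R\<^esub> b) = I +>\<^bsub>R\<^esub> (a \<otimes>\<^bsub>R\<^esub> b)"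
  using ideal.rcoset_mult_add[OF assms] by (simp add: quot_module_def FactRing_def)

lemma quot_module_hom:
  assumes M: "module R M" and I: "ideal I R" and m: "m \<in> carrier M" and ann: "I \<subseteq> annihilator R M m"
  shows "\<exists>f\<in>mod_hom R (quot_module R I) M. \<forall>r\<in>carrier R. f (I +>\<^bsub>R\<^esub> r) = r \<odot>\<^bsub>M\<^esub> m"
proof -
  interpret M: module R M by fact
  interpret I: ideal I R by fact
  define f where "f X = (SOME r. r \<in> X) \<odot>\<^bsub>M\<^esub> m" for X
  have f: "f (I +>\<^bsub>R\<^esub> r) = r \<odot>\<^bsub>M\<^esub> m" if r: "r \<in> carrier R" for r
  proof -
    have "(SOME t. t \<in> I +>\<^bsub>R\<^esub> r) \<in> I +>\<^bsub>R\<^esub> r"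
      using I.a_rcos_self[OF r] by (rule someI)
    then obtain i where i: "i \<in> I" "(SOME t. t \<in> I +>\<^bsub>R\<^esub> r) = i \<oplus>\<^bsub>R\<^esub> r" by (auto simp: a_r_coset_def')
    then show ?thesis using ann r m unfolding f_def annihilator_def
      by (auto simp: M.smult_l_distr)
  qed
  have "f \<in> mod_hom R (quot_module R I) M"
    by (rule mod_homI) (use m in \<open>auto simp: quot_module_carrier quot_module_add[OF I] quot_module_smult[OF I] f
       M.smult_l_distr M.smult_assoc1\<close>)
  then show ?thesis using f by blast
qed

lemma injective_hull_iff:
  assumes R: "cring R" and P: "ideal P R"
  shows "injective_hull R (quot_module R P) E \<longleftrightarrow>
    injective_module R E \<and> (\<exists>e. essential_generator R P E e)"
proof (cases "injective_module R E")
  case False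
  then show ?thesis by (simp add: injective_hull_def)
next
  case True
  interpret P: ideal P R by fact
  interpret E: module R E using True by (rule injective_module_module)
  let ?Q = "quot_module R P"
  note qs = quot_module_carrier quot_module_add[OF P] quot_module_smult[OF P]
  have "essential_mono R ?Q E \<noteq> {} \<longleftrightarrow> (\<exists>e. essential_generator R P E e)"
  proof
    assume "essential_mono R ?Q E \<noteq> {}"
    then obtain f where f: "f \<in> mod_hom R ?Q E" and inj: "inj_on f (carrier ?Q)"
      and ess: "\<And>H. submodule H R E \<Longrightarrow> H \<inter> f ` carrier ?Q = {\<zero>\<^bsub>E\<^esub>} \<Longrightarrow> H = {\<zero>\<^bsub>E\<^esub>}"
      by (auto simp: essential_mono_def mod_mono_def)
    define e where "e = f (P +>\<^bsub>R\<^esub> \<one>\<^bsub>R\<^esub>)"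
    have e: "e \<in> carrier E" unfolding e_def by (rule mod_hom_closed[OF f]) (auto simp: qs)
    have fe: "f (P +>\<^bsub>R\<^esub> r) = r \<odot>\<^bsub>E\<^esub> e" if r: "r \<in> carrier R" for r
      using mod_hom_smult[OF f r, of "P +>\<^bsub>R\<^esub> \<one>\<^bsub>R\<^esub>"] r by (auto simp: qs e_def)
    have "essential_generator R P E e"
      unfolding essential_generator_def
    proof (intro conjI e ballI impI)
      have "(r \<odot>\<^bsub>E\<^esub> e = \<zero>\<^bsub>E\<^esub>) = (r \<in> P)" if r: "r \<in> carrier R" for r
      proof -
        have "\<zero>\<^bsub>E\<^esub> = f (P +>\<^bsub>R\<^esub> \<zero>\<^bsub>R\<^esub>)" using fe[of "\<zero>\<^bsub>R\<^esub>"] e by simp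
        then have "(r \<odot>\<^bsub>E\<^esub> e = \<zero>\<^bsub>E\<^esub>) = (P +>\<^bsub>R\<^esub> r = P +>\<^bsub>R\<^esub> \<zero>\<^bsub>R\<^esub>)"
          using fe[OF r] inj_on_eq_iff[OF inj] r by (auto simp: qs)
        also have "\<dots> = (r \<ominus>\<^bsub>R\<^esub> \<zero>\<^bsub>R\<^esub> \<in> P)"
          using P.quotient_eq_iff_same_a_r_cos[OF P r] by simp
        finally show ?thesis using r by (simp add: a_minus_def)
      qed
      then show "annihilator R E e = P" using P.a_subset by (auto simp: annihilator_def)
    next
      fix y assume y: "y \<in> carrier E" "y \<noteq> \<zero>\<^bsub>E\<^esub>"
      let ?H = "{r \<odot>\<^bsub>E\<^esub> y | r. r \<in> carrier R}"
      have sub: "submodule ?H R E" using E.submodule_cyclic[OF y(1)] .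
      have "\<one>\<^bsub>R\<^esub> \<odot>\<^bsub>E\<^esub> y \<in> ?H" by blast
      then have "?H \<noteq> {\<zero>\<^bsub>E\<^esub>}" using y by auto
      then have "?H \<inter> f ` carrier ?Q \<noteq> {\<zero>\<^bsub>E\<^esub>}" using ess[OF sub] by blast
      moreover have "\<zero>\<^bsub>E\<^esub> \<in> f ` carrier ?Q"
        using fe[of "\<zero>\<^bsub>R\<^esub>"] e by (force simp: qs)
      moreover note submodule_zero[OF sub]
      ultimately obtain z where z: "z \<in> ?H" "z \<in> f ` carrier ?Q" "z \<noteq> \<zero>\<^bsub>E\<^esub>" by blast
      obtain r where "r \<in> carrier R" "z = r \<odot>\<^bsub>E\<^esub> y" using z(1) by blast
      moreover obtain s where "s \<in> carrier R" "z = s \<odot>\<^bsub>E\<^esub> e" using z(2) fe by (auto simp: qs)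
      ultimately show "\<exists>r\<in>carrier R. \<exists>s\<in>carrier R. r \<odot>\<^bsub>E\<^esub> y = s \<odot>\<^bsub>E\<^esub> e \<and> s \<odot>\<^bsub>E\<^esub> e \<noteq> \<zero>\<^bsub>E\<^esub>"
        using z(3) by metis
    qed
    then show "\<exists>e. essential_generator R P E e" ..
  next
    assume "\<exists>e. essential_generator R P E e"
    then obtain e where e: "e \<in> carrier E" "annihilator R E e = P"
      and ess: "\<And>y. y \<in> carrier E \<Longrightarrow> y \<noteq> \<zero>\<^bsub>E\<^esub> \<Longrightarrow>
        \<exists>r\<in>carrier R. \<exists>s\<in>carrier R. r \<odot>\<^bsub>E\<^esub> y = s \<odot>\<^bsub>E\<^esub> e \<and> s \<odot>\<^bsub>E\<^esub> e \<noteq> \<zero>\<^bsub>E\<^esub>"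
      by (auto simp: essential_generator_def)
    obtain f where f: "f \<in> mod_hom R ?Q E" and fe: "\<And>r. r \<in> carrier R \<Longrightarrow> f (P +>\<^bsub>R\<^esub> r) = r \<odot>\<^bsub>E\<^esub> e"
      using quot_module_hom[OF E.module_axioms P e(1)] e(2) by blast
    have "inj_on f (carrier ?Q)"
    proof (rule inj_onI)
      fix X Y assume XY: "X \<in> carrier ?Q" "Y \<in> carrier ?Q" "f X = f Y"
      then obtain a b where ab: "a \<in> carrier R" "b \<in> carrier R" "X = P +>\<^bsub>R\<^esub> a" "Y = P +>\<^bsub>R\<^esub> b" by (auto simp: qs)
      then have "(a \<ominus>\<^bsub>R\<^esub> b) \<odot>\<^bsub>E\<^esub> e = \<zero>\<^bsub>E\<^esub>"
        using XY(3) fe e(1) by (simp add: a_minus_def E.smult_l_distr E.smult_l_minus E.M.r_neg)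
      then have "a \<ominus>\<^bsub>R\<^esub> b \<in> P" using ab e(2) unfolding annihilator_def by auto
      then show "X = Y" using P.quotient_eq_iff_same_a_r_cos[OF P ab(1,2)] ab by simp
    qed
    moreover have "H = {\<zero>\<^bsub>E\<^esub>}" if H: "submodule H R E" "H \<inter> f ` carrier ?Q = {\<zero>\<^bsub>E\<^esub>}" for H
    proof (rule ccontr)
      assume "H \<noteq> {\<zero>\<^bsub>E\<^esub>}"
      then obtain y where y: "y \<in> H" "y \<noteq> \<zero>\<^bsub>E\<^esub>" using submodule_zero[OF H(1)] by blast
      then obtain r s where rs: "r \<in> carrier R" "s \<in> carrier R" "r \<odot>\<^bsub>E\<^esub> y = s \<odot>\<^bsub>E\<^esub> e" "s \<odot>\<^bsub>E\<^esub> e \<noteq> \<zero>\<^bsub>E\<^esub>"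
        using ess E.submoduleE(1)[OF H(1)] by blast
      then have "s \<odot>\<^bsub>E\<^esub> e \<in> H" using E.submoduleE(4)[OF H(1)] y by metis
      moreover have "s \<odot>\<^bsub>E\<^esub> e \<in> f ` carrier ?Q" using fe rs by (force simp: qs)
      ultimately show False using H(2) rs by blast
    qed
    ultimately show "essential_mono R ?Q E \<noteq> {}" using f by (auto simp: essential_mono_def mod_mono_def)
  qed
  then show ?thesis using True by (simp add: injective_hull_def)
qed

text \<open>
  A homomorphism from an essential extension of \<open>R e\<close> is injective if it is so on \<open>R e\<close>.
\<close>

lemma essential_mono_injective:
  assumes "module R E" "module R N" and e: "essential_generator R P E e"
    and g: "g \<in> mod_hom R E N" and ann: "annihilator R N (g e) \<subseteq> P"
  shows "inj_on g (carrier E)"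
proof (rule mod_hom_inj_onI[OF assms(1,2) g])
  interpret E: module R E by fact
  interpret N: module R N by fact
  fix y assume y: "y \<in> carrier E" "g y = \<zero>\<^bsub>N\<^esub>"
  show "y = \<zero>\<^bsub>E\<^esub>"
  proof (rule ccontr)
    assume "y \<noteq> \<zero>\<^bsub>E\<^esub>"
    then obtain r s where rs: "r \<in> carrier R" "s \<in> carrier R" "r \<odot>\<^bsub>E\<^esub> y = s \<odot>\<^bsub>E\<^esub> e" "s \<odot>\<^bsub>E\<^esub> e \<noteq> \<zero>\<^bsub>E\<^esub>"
      using e y unfolding essential_generator_def by blast
    have "s \<odot>\<^bsub>N\<^esub> g e = g (r \<odot>\<^bsub>E\<^esub> y)"
      using rs mod_hom_smult[OF g] e by (simp add: essential_generator_def)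
    also have "\<dots> = \<zero>\<^bsub>N\<^esub>" using mod_hom_smult[OF g rs(1) y(1)] y rs by simp
    finally have "s \<in> P" using ann rs unfolding annihilator_def by auto
    then show False using e rs unfolding essential_generator_def annihilator_def by auto
  qed
qed

lemma injective_hull_unique:
  fixes E E' :: "('a, 'm) module"
  assumes E: "injective_module R E" "essential_generator R P E e"
    and E': "injective_module R E'" "essential_generator R P E' e'"
  shows "\<exists>g\<in>mod_hom R E E'. bij_betw g (carrier E) (carrier E')"
proof -
  note m = injective_module_module[OF E(1)] injective_module_module[OF E'(1)]
  have e: "e \<in> carrier E" "annihilator R E e = P" and e': "e' \<in> carrier E'" "annihilator R E' e' = P"
    using E E' by (auto simp: essential_generator_def)
  obtain g where g: "g \<in> mod_hom R E E'" "g e = e'"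
    using injective_extends_cyclic[OF E'(1) m(1) e(1) e'(1)] e e' by auto
  have ginj: "inj_on g (carrier E)"
    using essential_mono_injective[OF m E(2) g(1)] g(2) e' by simp
  obtain h where h: "h \<in> mod_hom R E' E" "\<And>x. x \<in> carrier E \<Longrightarrow> h (g x) = x"
  proof -
    have "g \<in> mod_mono R E E'" "id \<in> mod_hom R E E"
      using g ginj by (auto simp: mod_mono_def mod_hom_def)
    then have "\<exists>h\<in>mod_hom R E' E. \<forall>x\<in>carrier E. h (g x) = id x"
      by (intro injective_moduleD[OF E(1) m])
    then show thesis using that by auto
  qed
  \<comment> \<open>\<open>h\<close> is injective too, and \<open>h \<circ> g\<close> is the identity, so \<open>g\<close> is onto\<close>
  have hinj: "inj_on h (carrier E')"
    using essential_mono_injective[OF m(2,1) E'(2) h(1)] h(2)[OF e(1)] g(2) e by simp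
  have "g ` carrier E = carrier E'"
  proof (intro equalityI subsetI)
    fix z assume z: "z \<in> carrier E'"
    then have hz: "h z \<in> carrier E" using mod_hom_closed[OF h(1)] by blast
    then have "h (g (h z)) = h z" using h(2) by blast
    then have "g (h z) = z" using inj_onD[OF hinj] z mod_hom_closed[OF g(1) hz] by blast
    then show "z \<in> g ` carrier E" using hz by force
  qed (use mod_hom_closed[OF g(1)] in auto)
  then show ?thesis using g ginj by (auto simp: bij_betw_def)
qed

lemma mod_hom_inv_into:
  assumes "module R E" and f: "f \<in> mod_hom R E N" and bij: "bij_betw f (carrier E) (carrier N)"
  shows "inv_into (carrier E) f \<in> mod_hom R N E"
proof -
  interpret E: module R E by fact
  have inj: "inj_on f (carrier E)" and im: "carrier N = f ` carrier E" using bij by (auto simp: bij_betw_def)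
  show ?thesis
  proof (rule mod_homI)
    show "inv_into (carrier E) f x \<in> carrier E" if "x \<in> carrier N" for x
      using that im inv_into_into by metis
    show "inv_into (carrier E) f (x \<oplus>\<^bsub>N\<^esub> y) = inv_into (carrier E) f x \<oplus>\<^bsub>E\<^esub> inv_into (carrier E) f y"
      if xy: "x \<in> carrier N" "y \<in> carrier N" for x y
    proof -
      obtain u v where "u \<in> carrier E" "v \<in> carrier E" "x = f u" "y = f v" using xy im by auto
      then show ?thesis using mod_hom_add[OF f, of u v, symmetric] by (simp add: inv_into_f_f[OF inj])
    qed
    show "inv_into (carrier E) f (r \<odot>\<^bsub>N\<^esub> x) = r \<odot>\<^bsub>E\<^esub> inv_into (carrier E) f x"
      if rx: "r \<in> carrier R" "x \<in> carrier N" for r x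
    proof -
      obtain u where "u \<in> carrier E" "x = f u" using rx im by auto
      then show ?thesis using mod_hom_smult[OF f rx(1), of u, symmetric] rx by (simp add: inv_into_f_f[OF inj])
    qed
  qed
qed

lemma injective_hull_iso:
  fixes E N :: "('a, 'm) module"
  assumes E: "injective_module R E" "essential_generator R P E e"
    and N: "module R N" and f: "f \<in> mod_hom R E N" and bij: "bij_betw f (carrier E) (carrier N)"
  shows "injective_module R N" "essential_generator R P N (f e)"
proof -
  note m = injective_module_module[OF E(1)]
  interpret E: module R E by (rule m)
  interpret N: module R N by (rule N)
  have inj: "inj_on f (carrier E)" and im: "carrier N = f ` carrier E" using bij by (auto simp: bij_betw_def)
  let ?k = "inv_into (carrier E) f"
  have k: "?k \<in> mod_hom R N E" using mod_hom_inv_into[OF m f bij] .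
  show "injective_module R N"
    unfolding injective_module_def
  proof (intro conjI N allI impI ballI)
    fix A B :: "('a, 'm) module" and i h
    assume AB: "module R A" "module R B" "i \<in> mod_mono R A B" and h: "h \<in> mod_hom R A N"
    obtain g where g: "g \<in> mod_hom R B E" "\<forall>x\<in>carrier A. g (i x) = (?k \<circ> h) x"
      using injective_moduleD[OF E(1) AB mod_hom_comp[OF h k]] by blast
    show "\<exists>g\<in>mod_hom R B N. \<forall>x\<in>carrier A. g (i x) = h x"
    proof (intro bexI[of _ "f \<circ> g"] ballI)
      show "f \<circ> g \<in> mod_hom R B N" using mod_hom_comp[OF g(1) f] .
      fix x assume "x \<in> carrier A"
      then show "(f \<circ> g) (i x) = h x"
        using g(2) mod_hom_closed[OF h] im by (auto simp: f_inv_into_f)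
    qed
  qed
  have z: "(f x = \<zero>\<^bsub>N\<^esub>) = (x = \<zero>\<^bsub>E\<^esub>)" if "x \<in> carrier E" for x
    using inj_on_eq_iff[OF inj that E.M.zero_closed] mod_hom_zero[OF m N f] by simp
  have e: "e \<in> carrier E" using E(2) by (simp add: essential_generator_def)
  show "essential_generator R P N (f e)"
    unfolding essential_generator_def
  proof (intro conjI ballI impI)
    show "f e \<in> carrier N" using mod_hom_closed[OF f e] .
    have "(r \<odot>\<^bsub>N\<^esub> f e = \<zero>\<^bsub>N\<^esub>) = (r \<odot>\<^bsub>E\<^esub> e = \<zero>\<^bsub>E\<^esub>)" if "r \<in> carrier R" for r
      using z[of "r \<odot>\<^bsub>E\<^esub> e"] mod_hom_smult[OF f that e] that e by simp
    then show "annihilator R N (f e) = P" using E(2) by (auto simp: essential_generator_def annihilator_def)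
    fix y assume y: "y \<in> carrier N" "y \<noteq> \<zero>\<^bsub>N\<^esub>"
    then obtain x where x: "x \<in> carrier E" "y = f x" "x \<noteq> \<zero>\<^bsub>E\<^esub>" using im z by auto
    then obtain r s where rs: "r \<in> carrier R" "s \<in> carrier R" "r \<odot>\<^bsub>E\<^esub> x = s \<odot>\<^bsub>E\<^esub> e" "s \<odot>\<^bsub>E\<^esub> e \<noteq> \<zero>\<^bsub>E\<^esub>"
      using E(2) unfolding essential_generator_def by blast
    then have "r \<odot>\<^bsub>N\<^esub> y = s \<odot>\<^bsub>N\<^esub> f e" "s \<odot>\<^bsub>N\<^esub> f e \<noteq> \<zero>\<^bsub>N\<^esub>"
      using mod_hom_smult[OF f] x e z[of "s \<odot>\<^bsub>E\<^esub> e"] by (metis, metis E.smult_closed)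
    then show "\<exists>r\<in>carrier R. \<exists>s\<in>carrier R. r \<odot>\<^bsub>N\<^esub> y = s \<odot>\<^bsub>N\<^esub> f e \<and> s \<odot>\<^bsub>N\<^esub> f e \<noteq> \<zero>\<^bsub>N\<^esub>"
      using rs by blast
  qed
qed

lemma hull_type_eq_iso_type:
  fixes E :: "('a, 'm) module"
  assumes P: "ideal P R" and E: "injective_module R E" "essential_generator R P E e"
  shows "hull_type R P = iso_type R E"
proof -
  have R: "cring R" using injective_module_module[OF E(1)] by (rule module_cring)
  have "injective_hull R (quot_module R P) N \<longleftrightarrow>
     module R N \<and> (\<exists>f\<in>mod_hom R E N. bij_betw f (carrier E) (carrier N))" for N :: "('a, 'm) module"
    unfolding injective_hull_iff[OF R P]
    using injective_hull_unique[OF E] injective_hull_iso[OF E] injective_module_module by blast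
  then show ?thesis by (auto simp: hull_type_def iso_type_def)
qed


section \<open>Existence of hulls and hulls at prime ideals\<close>

lemma maximal_submodule_exists:
  assumes "module R M" and H0: "submodule H0 R M" "Q H0"
    and chain: "\<And>C. C \<noteq> {} \<Longrightarrow> (\<And>H. H \<in> C \<Longrightarrow> submodule H R M \<and> Q H) \<Longrightarrow> Q (\<Union>C)"
  shows "\<exists>H. submodule H R M \<and> Q H \<and> (\<forall>K. submodule K R M \<longrightarrow> Q K \<longrightarrow> H \<subseteq> K \<longrightarrow> K = H)"
proof -
  interpret M: module R M by fact
  let ?A = "{H. submodule H R M \<and> Q H}"
  have "\<exists>H\<in>?A. \<forall>K\<in>?A. H \<subseteq> K \<longrightarrow> K = H"
  proof (rule subset_Zorn_nonempty)
    show "?A \<noteq> {}" using H0 by blast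
    fix C assume C: "C \<noteq> {}" "subset.chain ?A C"
    then have CA: "\<And>H. H \<in> C \<Longrightarrow> submodule H R M \<and> Q H"
      and lin: "\<And>H K. H \<in> C \<Longrightarrow> K \<in> C \<Longrightarrow> H \<subseteq> K \<or> K \<subseteq> H"
      unfolding subset_chain_def by blast+
    have "submodule (\<Union>C) R M" using M.submodule_Union_chain[OF C(1)] CA lin by blast
    moreover have "Q (\<Union>C)" using chain[OF C(1)] CA by blast
    ultimately show "\<Union>C \<in> ?A" by blast
  qed
  then show ?thesis by blast
qed

text \<open>
  The set \<open>E\<close>, a submodule of \<open>W\<close> in all uses, is an essential extension of \<open>R w\<close>.
\<close>

definition essential_over :: "('a, 'r) ring_scheme \<Rightarrow> ('a, 'm) module \<Rightarrow> 'm set \<Rightarrow> 'm \<Rightarrow> bool" where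
  "essential_over R W E w \<longleftrightarrow> w \<in> E \<and> (\<forall>y\<in>E. y \<noteq> \<zero>\<^bsub>W\<^esub> \<longrightarrow>
     (\<exists>r\<in>carrier R. \<exists>s\<in>carrier R. r \<odot>\<^bsub>W\<^esub> y = s \<odot>\<^bsub>W\<^esub> w \<and> s \<odot>\<^bsub>W\<^esub> w \<noteq> \<zero>\<^bsub>W\<^esub>))"

text \<open>
  A maximal essential extension \<open>E\<close> inside an injective module is a direct summand. Let \<open>K\<close> be maximal
  with \<open>K \<inter> E = 0\<close> and extend the projection \<open>E + K \<rightarrow> E\<close> to an endomorphism \<open>g\<close>. Maximality of \<open>K\<close>
  makes the image of \<open>g\<close> essential over \<open>E\<close>, so this image is \<open>E\<close>.
\<close>

lemma maximal_essential_retract: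
  fixes W :: "('a, 'm) module"
  assumes W: "injective_module R W" and E: "submodule E R W" "essential_over R W E w"
    and max: "\<And>K. submodule K R W \<Longrightarrow> essential_over R W K w \<Longrightarrow> E \<subseteq> K \<Longrightarrow> K = E"
  shows "\<exists>g\<in>mod_hom R W W. g ` carrier W = E \<and> (\<forall>x\<in>E. g x = x)"
proof -
  note m = injective_module_module[OF W]
  interpret W: module R W by (rule m)
  note Ec = W.submoduleE(1)[OF E(1)]
  have "\<exists>K. submodule K R W \<and> K \<inter> E \<subseteq> {\<zero>\<^bsub>W\<^esub>} \<and>
      (\<forall>L. submodule L R W \<longrightarrow> L \<inter> E \<subseteq> {\<zero>\<^bsub>W\<^esub>} \<longrightarrow> K \<subseteq> L \<longrightarrow> L = K)"
  proof (rule maximal_submodule_exists[OF m])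
    show "submodule {\<zero>\<^bsub>W\<^esub>} R W" by (rule W.submoduleI') auto
  qed auto
  then obtain K where K: "submodule K R W" "K \<inter> E \<subseteq> {\<zero>\<^bsub>W\<^esub>}"
    and Kmax: "\<And>L. submodule L R W \<Longrightarrow> L \<inter> E \<subseteq> {\<zero>\<^bsub>W\<^esub>} \<Longrightarrow> K \<subseteq> L \<Longrightarrow> L = K" by blast
  note Kc = W.submoduleE(1)[OF K(1)]
  let ?G = "{(e \<oplus>\<^bsub>W\<^esub> k, e) | e k. e \<in> E \<and> k \<in> K}"
  have "\<exists>g\<in>mod_hom R W W. \<forall>b e. (b, e) \<in> ?G \<longrightarrow> g b = e"
  proof (rule injective_extends_same_type[OF W m])
    show "?G \<subseteq> carrier W \<times> carrier W" using Ec Kc by auto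
    show "(\<zero>\<^bsub>W\<^esub>, \<zero>\<^bsub>W\<^esub>) \<in> ?G"
      using submodule_zero[OF E(1)] submodule_zero[OF K(1)] by force
    show "(b \<oplus>\<^bsub>W\<^esub> b', e \<oplus>\<^bsub>W\<^esub> e') \<in> ?G" if be: "(b, e) \<in> ?G" "(b', e') \<in> ?G" for b e b' e'
    proof -
      obtain k k' where k: "b = e \<oplus>\<^bsub>W\<^esub> k" "b' = e' \<oplus>\<^bsub>W\<^esub> k'" "k \<in> K" "k' \<in> K" "e \<in> E" "e' \<in> E"
        using be by auto
      then have "e \<in> carrier W" "e' \<in> carrier W" "k \<in> carrier W" "k' \<in> carrier W" using Ec Kc by auto
      then have "b \<oplus>\<^bsub>W\<^esub> b' = (e \<oplus>\<^bsub>W\<^esub> e') \<oplus>\<^bsub>W\<^esub> (k \<oplus>\<^bsub>W\<^esub> k')" using k by (simp add: W.M.a_ac)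
      then show ?thesis using W.submoduleE(5)[OF E(1)] W.submoduleE(5)[OF K(1)] k by blast
    qed
    show "(r \<odot>\<^bsub>W\<^esub> b, r \<odot>\<^bsub>W\<^esub> e) \<in> ?G" if r: "r \<in> carrier R" and be: "(b, e) \<in> ?G" for r b e
    proof -
      obtain k where k: "b = e \<oplus>\<^bsub>W\<^esub> k" "k \<in> K" "e \<in> E" using be by auto
      then have "e \<in> carrier W" "k \<in> carrier W" using Ec Kc by auto
      then have "r \<odot>\<^bsub>W\<^esub> b = r \<odot>\<^bsub>W\<^esub> e \<oplus>\<^bsub>W\<^esub> r \<odot>\<^bsub>W\<^esub> k" using k r by (simp add: W.smult_r_distr)
      then show ?thesis using W.submoduleE(4)[OF E(1)] W.submoduleE(4)[OF K(1)] k r by blast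
    qed
    show "e = \<zero>\<^bsub>W\<^esub>" if be: "(\<zero>\<^bsub>W\<^esub>, e) \<in> ?G" for e
    proof -
      obtain k where k: "\<zero>\<^bsub>W\<^esub> = e \<oplus>\<^bsub>W\<^esub> k" "k \<in> K" "e \<in> E" using be by auto
      then have c: "e \<in> carrier W" "k \<in> carrier W" using Ec Kc by auto
      then have "e = \<ominus>\<^bsub>W\<^esub> k" using k W.M.minus_equality[of e k] by simp
      then have "e \<in> K" using W.submoduleE(3)[OF K(1)] k by simp
      then show ?thesis using K(2) k by blast
    qed
  qed
  then obtain g where g: "g \<in> mod_hom R W W" and gG: "\<And>b e. (b, e) \<in> ?G \<Longrightarrow> g b = e" by blast
  note gc = mod_hom_closed[OF g] and ga = mod_hom_add[OF g] and gs = mod_hom_smult[OF g]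
  have gE: "g x = x" if "x \<in> E" for x
  proof -
    have "(x \<oplus>\<^bsub>W\<^esub> \<zero>\<^bsub>W\<^esub>, x) \<in> ?G" using submodule_zero[OF K(1)] that by blast
    then show ?thesis using gG[of "x \<oplus>\<^bsub>W\<^esub> \<zero>\<^bsub>W\<^esub>" x] that Ec by auto
  qed
  have gK: "g x = \<zero>\<^bsub>W\<^esub>" if "x \<in> K" for x
  proof -
    have "(\<zero>\<^bsub>W\<^esub> \<oplus>\<^bsub>W\<^esub> x, \<zero>\<^bsub>W\<^esub>) \<in> ?G" using submodule_zero[OF E(1)] that by blast
    then show ?thesis using gG[of "\<zero>\<^bsub>W\<^esub> \<oplus>\<^bsub>W\<^esub> x" "\<zero>\<^bsub>W\<^esub>"] that Kc by auto
  qed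
  have trivial: "H \<subseteq> {\<zero>\<^bsub>W\<^esub>}" if H: "submodule H R W" "H \<subseteq> g ` carrier W" "H \<inter> E \<subseteq> {\<zero>\<^bsub>W\<^esub>}" for H
  proof -
    let ?L = "{y \<in> carrier W. g y \<in> H}"
    have "submodule ?L R W"
      by (rule W.submoduleI') (use W.submoduleE[OF H(1)] submodule_zero[OF H(1)] mod_hom_zero[OF m m g]
          in \<open>auto simp: ga gs\<close>)
    moreover have "?L \<inter> E \<subseteq> {\<zero>\<^bsub>W\<^esub>}" using H(3) gE by auto
    moreover have "K \<subseteq> ?L" using gK Kc submodule_zero[OF H(1)] by auto
    ultimately have "?L = K" using Kmax by blast
    then show ?thesis using H(2) gK by blast
  qed
  let ?E' = "g ` carrier W"
  have sub: "submodule ?E' R W"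
  proof (rule W.submoduleI')
    show "\<zero>\<^bsub>W\<^esub> \<in> ?E'" using mod_hom_zero[OF m m g] by (metis W.M.zero_closed imageI)
    show "a \<oplus>\<^bsub>W\<^esub> b \<in> ?E'" if "a \<in> ?E'" "b \<in> ?E'" for a b
      using that by (auto simp flip: ga)
    show "r \<odot>\<^bsub>W\<^esub> a \<in> ?E'" if "r \<in> carrier R" "a \<in> ?E'" for r a
      using that by (auto simp flip: gs)
  qed (use gc in auto)
  have EE': "E \<subseteq> ?E'" using gE Ec by force
  have "essential_over R W ?E' w"
    unfolding essential_over_def
  proof (intro conjI ballI impI)
    show "w \<in> ?E'" using E(2) EE' by (auto simp: essential_over_def)
    fix y assume y: "y \<in> ?E'" "y \<noteq> \<zero>\<^bsub>W\<^esub>"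
    then have yc: "y \<in> carrier W" using W.submoduleE(1)[OF sub] by blast
    let ?H = "{r \<odot>\<^bsub>W\<^esub> y | r. r \<in> carrier R}"
    have "\<one>\<^bsub>R\<^esub> \<odot>\<^bsub>W\<^esub> y \<in> ?H" by blast
    then have "\<not> ?H \<subseteq> {\<zero>\<^bsub>W\<^esub>}" using y yc by auto
    moreover have "?H \<subseteq> ?E'" using W.submoduleE(4)[OF sub] y by blast
    ultimately have "\<not> ?H \<inter> E \<subseteq> {\<zero>\<^bsub>W\<^esub>}" using trivial[OF W.submodule_cyclic[OF yc]] by blast
    then obtain r where r: "r \<in> carrier R" "r \<odot>\<^bsub>W\<^esub> y \<in> E" "r \<odot>\<^bsub>W\<^esub> y \<noteq> \<zero>\<^bsub>W\<^esub>" by blast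
    then obtain t s where ts: "t \<in> carrier R" "s \<in> carrier R" "t \<odot>\<^bsub>W\<^esub> (r \<odot>\<^bsub>W\<^esub> y) = s \<odot>\<^bsub>W\<^esub> w" "s \<odot>\<^bsub>W\<^esub> w \<noteq> \<zero>\<^bsub>W\<^esub>"
      using E(2) unfolding essential_over_def by blast
    then have "(t \<otimes>\<^bsub>R\<^esub> r) \<odot>\<^bsub>W\<^esub> y = s \<odot>\<^bsub>W\<^esub> w" using r yc by (simp add: W.smult_assoc1)
    then show "\<exists>r\<in>carrier R. \<exists>s\<in>carrier R. r \<odot>\<^bsub>W\<^esub> y = s \<odot>\<^bsub>W\<^esub> w \<and> s \<odot>\<^bsub>W\<^esub> w \<noteq> \<zero>\<^bsub>W\<^esub>"
      using ts r W.R.m_closed by blast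
  qed
  then have "?E' = E" using max sub EE' by blast
  then show ?thesis using g gE by blast
qed

lemma injective_hull_exists:
  fixes R :: "('a, 'r) ring_scheme"
  assumes R: "cring R" "large_universe R TYPE('m)" and P: "ideal P R"
  shows "\<exists>(E :: ('a, 'm) module) e. injective_module R E \<and> essential_generator R P E e"
proof -
  obtain W :: "('a, 'm) module" and w where W: "injective_module R W"
    and w: "w \<in> carrier W" "annihilator R W w = P"
    using ambient_injective[OF R] P by blast
  note m = injective_module_module[OF W]
  interpret W: module R W by (rule m)
  let ?N = "{r \<odot>\<^bsub>W\<^esub> w | r. r \<in> carrier R}"
  have "\<exists>E. submodule E R W \<and> essential_over R W E w \<and>
     (\<forall>K. submodule K R W \<longrightarrow> essential_over R W K w \<longrightarrow> E \<subseteq> K \<longrightarrow> K = E)"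
  proof (rule maximal_submodule_exists[OF m])
    show "submodule ?N R W" using W.submodule_cyclic[OF w(1)] .
    show "essential_over R W ?N w"
      unfolding essential_over_def
    proof (intro conjI ballI impI)
      show "w \<in> ?N" using w(1) by (intro CollectI exI[of _ "\<one>\<^bsub>R\<^esub>"]) simp
      fix y assume y: "y \<in> ?N" "y \<noteq> \<zero>\<^bsub>W\<^esub>"
      then obtain s where "s \<in> carrier R" "y = s \<odot>\<^bsub>W\<^esub> w" by blast
      then show "\<exists>r\<in>carrier R. \<exists>s\<in>carrier R. r \<odot>\<^bsub>W\<^esub> y = s \<odot>\<^bsub>W\<^esub> w \<and> s \<odot>\<^bsub>W\<^esub> w \<noteq> \<zero>\<^bsub>W\<^esub>"
        using y w by (intro bexI[of _ "\<one>\<^bsub>R\<^esub>"] bexI[of _ s]) auto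
    qed
    show "essential_over R W (\<Union>C) w"
      if "C \<noteq> {}" "\<And>H. H \<in> C \<Longrightarrow> submodule H R W \<and> essential_over R W H w" for C
      using that unfolding essential_over_def by blast
  qed
  then obtain E where E: "submodule E R W" "essential_over R W E w"
    and max: "\<And>K. submodule K R W \<Longrightarrow> essential_over R W K w \<Longrightarrow> E \<subseteq> K \<Longrightarrow> K = E" by blast
  obtain g where g: "g \<in> mod_hom R W W" "g ` carrier W = E" "\<And>x. x \<in> E \<Longrightarrow> g x = x"
    using maximal_essential_retract[OF W E max] by blast
  let ?E = "W\<lparr>carrier := E\<rparr>"
  have mE: "module R ?E" using submodule.submodule_is_module[OF E(1) m] .
  have Ec: "E \<subseteq> carrier W" using W.submoduleE(1)[OF E(1)] .
  have gE: "g \<in> mod_hom R W ?E"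
    using g(2) by (intro mod_homI) (auto simp: mod_hom_add[OF g(1)] mod_hom_smult[OF g(1)])
  have "injective_module R ?E"
    unfolding injective_module_def
  proof (intro conjI mE allI impI ballI)
    fix A B :: "('a, 'm) module" and i f
    assume AB: "module R A" "module R B" "i \<in> mod_mono R A B" and f: "f \<in> mod_hom R A ?E"
    have "f \<in> mod_hom R A W"
      using mod_hom_closed[OF f] mod_hom_add[OF f] mod_hom_smult[OF f] Ec by (intro mod_homI) auto
    then obtain h where h: "h \<in> mod_hom R B W" "\<forall>x\<in>carrier A. h (i x) = f x"
      using injective_moduleD[OF W AB] by blast
    show "\<exists>g\<in>mod_hom R B ?E. \<forall>x\<in>carrier A. g (i x) = f x"
      using h(2) g(3) mod_hom_closed[OF f]
      by (intro bexI[of _ "g \<circ> h"] mod_hom_comp[OF h(1) gE]) auto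
  qed
  moreover have "essential_generator R P ?E w"
    using E(2) w by (auto simp: essential_generator_def essential_over_def annihilator_def)
  ultimately show ?thesis by blast
qed

text \<open>
  For \<open>s \<notin> P\<close> the annihilator of \<open>s e\<close> is \<open>(P : s) = P\<close>.
\<close>

lemma essential_generator_prime:
  assumes E: "module R E" "essential_generator R P E e" and P: "primeideal P R"
    and y: "y \<in> carrier E" "y \<noteq> \<zero>\<^bsub>E\<^esub>"
  shows "\<exists>r\<in>carrier R. \<exists>s\<in>carrier R. s \<notin> P \<and> r \<odot>\<^bsub>E\<^esub> y = s \<odot>\<^bsub>E\<^esub> e \<and> annihilator R E (r \<odot>\<^bsub>E\<^esub> y) = P"
proof -
  interpret E: module R E by fact
  interpret P: primeideal P R by fact
  have e: "e \<in> carrier E" "annihilator R E e = P" using E(2) by (auto simp: essential_generator_def)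
  obtain r s where rs: "r \<in> carrier R" "s \<in> carrier R" "r \<odot>\<^bsub>E\<^esub> y = s \<odot>\<^bsub>E\<^esub> e" "s \<odot>\<^bsub>E\<^esub> e \<noteq> \<zero>\<^bsub>E\<^esub>"
    using E(2) y unfolding essential_generator_def by blast
  have ann: "(t \<odot>\<^bsub>E\<^esub> e = \<zero>\<^bsub>E\<^esub>) = (t \<in> P)" if "t \<in> carrier R" for t
    using e that by (auto simp: annihilator_def)
  have s: "s \<notin> P" using ann rs by blast
  have "(t \<odot>\<^bsub>E\<^esub> (s \<odot>\<^bsub>E\<^esub> e) = \<zero>\<^bsub>E\<^esub>) = (t \<in> P)" if t: "t \<in> carrier R" for t
  proof -
    have "(t \<odot>\<^bsub>E\<^esub> (s \<odot>\<^bsub>E\<^esub> e) = \<zero>\<^bsub>E\<^esub>) = (t \<otimes>\<^bsub>R\<^esub> s \<in> P)"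
      using ann[of "t \<otimes>\<^bsub>R\<^esub> s"] t rs e by (simp add: E.smult_assoc1)
    also have "\<dots> = (t \<in> P)" using P.I_prime[OF t rs(2)] s P.I_r_closed[OF _ rs(2)] by blast
    finally show ?thesis .
  qed
  then have "annihilator R E (s \<odot>\<^bsub>E\<^esub> e) = P" using P.a_subset by (auto simp: annihilator_def)
  then show ?thesis using rs s by metis
qed

lemma annihilator_subset_prime:
  assumes E: "module R E" "essential_generator R P E e" and P: "primeideal P R"
    and y: "y \<in> carrier E" "y \<noteq> \<zero>\<^bsub>E\<^esub>"
  shows "annihilator R E y \<subseteq> P"
proof -
  interpret E: module R E by fact
  obtain r where r: "r \<in> carrier R" "annihilator R E (r \<odot>\<^bsub>E\<^esub> y) = P"
    using essential_generator_prime[OF assms] by blast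
  have "t \<in> annihilator R E (r \<odot>\<^bsub>E\<^esub> y)" if "t \<in> annihilator R E y" for t
  proof -
    have t: "t \<in> carrier R" "t \<odot>\<^bsub>E\<^esub> y = \<zero>\<^bsub>E\<^esub>" using that by (auto simp: annihilator_def)
    have "t \<odot>\<^bsub>E\<^esub> (r \<odot>\<^bsub>E\<^esub> y) = r \<odot>\<^bsub>E\<^esub> (t \<odot>\<^bsub>E\<^esub> y)"
      using t(1) r y by (simp flip: E.smult_assoc1 add: E.R.m_comm)
    then show ?thesis using t r(1) by (simp add: annihilator_def)
  qed
  then show ?thesis using r by blast
qed

lemma essential_generator_nonzero:
  assumes E: "module R E" "essential_generator R P E e" and P: "primeideal P R"
  shows "e \<noteq> \<zero>\<^bsub>E\<^esub>"
proof
  interpret E: module R E by fact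
  interpret P: primeideal P R by fact
  assume "e = \<zero>\<^bsub>E\<^esub>"
  then have "\<one>\<^bsub>R\<^esub> \<in> annihilator R E e" by (simp add: annihilator_def)
  then have "\<one>\<^bsub>R\<^esub> \<in> P" using E(2) by (simp add: essential_generator_def)
  then show False using P.one_imp_carrier P.I_notcarr by auto
qed

lemma essential_generator_unique_prime:
  assumes E: "module R E" "essential_generator R P E e" "essential_generator R Q E e'"
    and P: "primeideal P R" and Q: "primeideal Q R"
  shows "P = Q"
proof -
  have e: "e \<in> carrier E" "annihilator R E e = P" and e': "e' \<in> carrier E" "annihilator R E e' = Q"
    using E by (auto simp: essential_generator_def)
  have "e \<noteq> \<zero>\<^bsub>E\<^esub>" "e' \<noteq> \<zero>\<^bsub>E\<^esub>"
    using essential_generator_nonzero[OF E(1,2) P] essential_generator_nonzero[OF E(1,3) Q] by auto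
  then show ?thesis
    using annihilator_subset_prime[OF E(1,2) P e'(1)] annihilator_subset_prime[OF E(1,3) Q e(1)] e e' by blast
qed

lemma indecomposable_hull:
  assumes E: "module R E" "essential_generator R P E e" and P: "primeideal P R"
  shows "indecomposable_module R E"
  unfolding indecomposable_module_def
proof (intro conjI allI impI E(1))
  interpret E: module R E by fact
  interpret P: primeideal P R by fact
  have e: "e \<in> carrier E" "annihilator R E e = P" using E(2) by (auto simp: essential_generator_def)
  show "carrier E \<noteq> {\<zero>\<^bsub>E\<^esub>}" 
    using e(1) essential_generator_nonzero[OF E P] by blast
  fix A B assume A: "submodule A R E" and B: "submodule B R E" and AB: "A \<inter> B = {\<zero>\<^bsub>E\<^esub>}"
  show "A = {\<zero>\<^bsub>E\<^esub>} \<or> B = {\<zero>\<^bsub>E\<^esub>}"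
  proof (rule ccontr)
    assume "\<not> (A = {\<zero>\<^bsub>E\<^esub>} \<or> B = {\<zero>\<^bsub>E\<^esub>})"
    then obtain a b where ab: "a \<in> A" "a \<noteq> \<zero>\<^bsub>E\<^esub>" "b \<in> B" "b \<noteq> \<zero>\<^bsub>E\<^esub>"
      using submodule_zero[OF A] submodule_zero[OF B] by blast
    then have c: "a \<in> carrier E" "b \<in> carrier E" using E.submoduleE(1)[OF A] E.submoduleE(1)[OF B] by auto
    obtain r s where rs: "r \<in> carrier R" "s \<in> carrier R" "s \<notin> P" "r \<odot>\<^bsub>E\<^esub> a = s \<odot>\<^bsub>E\<^esub> e"
      using essential_generator_prime[OF E P c(1) ab(2)] by blast
    obtain r' s' where rs': "r' \<in> carrier R" "s' \<in> carrier R" "s' \<notin> P" "r' \<odot>\<^bsub>E\<^esub> b = s' \<odot>\<^bsub>E\<^esub> e"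
      using essential_generator_prime[OF E P c(2) ab(4)] by blast
    \<comment> \<open>a common nonzero multiple of \<open>a\<close> and \<open>b\<close>, as \<open>s s'\<close> is outside the prime ideal\<close>
    let ?z = "(s \<otimes>\<^bsub>R\<^esub> s') \<odot>\<^bsub>E\<^esub> e"
    have "?z = s' \<odot>\<^bsub>E\<^esub> (r \<odot>\<^bsub>E\<^esub> a)"
      using rs(1,2,4) rs'(2) e(1) by (simp flip: E.smult_assoc1 add: E.R.m_comm)
    then have "?z \<in> A"
      using E.submoduleE(4)[OF A rs'(2) E.submoduleE(4)[OF A rs(1) ab(1)]] by simp
    moreover have "?z = s \<odot>\<^bsub>E\<^esub> (r' \<odot>\<^bsub>E\<^esub> b)"
      using rs rs' e by (simp flip: E.smult_assoc1)
    then have "?z \<in> B"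
      using E.submoduleE(4)[OF B rs(2) E.submoduleE(4)[OF B rs'(1) ab(3)]] by simp
    ultimately have "?z = \<zero>\<^bsub>E\<^esub>" using AB by blast
    then have "s \<otimes>\<^bsub>R\<^esub> s' \<in> P" using e rs rs' by (auto simp: annihilator_def)
    then show False using P.I_prime[OF rs(2) rs'(2)] rs rs' by blast
  qed
qed

lemma SpecD: "P \<in> Spec R \<Longrightarrow> primeideal P R" "P \<in> Spec R \<Longrightarrow> ideal P R"
  by (auto simp: Spec_def primeideal.axioms(1))

lemma hull_typeD:
  assumes "cring R" "P \<in> Spec R" "E \<in> hull_type R P"
  shows "injective_module R E" "\<exists>e. essential_generator R P E e"
  using assms injective_hull_iff[OF assms(1) SpecD(2)[OF assms(2)], of E] by (auto simp: hull_type_def)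

lemma hull_type_nonempty:
  fixes R :: "('a, 'r) ring_scheme"
  assumes "cring R" "large_universe R TYPE('m)" "P \<in> Spec R"
  shows "\<exists>E :: ('a, 'm) module. E \<in> hull_type R P"
  using injective_hull_exists[OF assms(1,2) SpecD(2)[OF assms(3)]]
    injective_hull_iff[OF assms(1) SpecD(2)[OF assms(3)]] by (auto simp: hull_type_def)

lemma hull_type_inj_types:
  fixes R :: "('a, 'r) ring_scheme"
  assumes R: "cring R" "large_universe R TYPE('m)" and P: "P \<in> Spec R"
  shows "(hull_type R P :: ('a, 'm) module set) \<in> inj_types R"
proof -
  obtain E :: "('a, 'm) module" where E: "E \<in> hull_type R P" using hull_type_nonempty[OF R P] by blast
  note h = hull_typeD[OF R(1) P E]
  then obtain e where e: "essential_generator R P E e" by blast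
  have "hull_type R P = iso_type R E" using hull_type_eq_iso_type[OF SpecD(2)[OF P] h(1) e] .
  moreover have "indecomposable_module R E"
    using indecomposable_hull[OF injective_module_module[OF h(1)] e SpecD(1)[OF P]] .
  ultimately show ?thesis using h(1) unfolding inj_types_def by blast
qed

lemma hull_type_inj_on:
  fixes R :: "('a, 'r) ring_scheme"
  assumes R: "cring R" "large_universe R TYPE('m)"
  shows "inj_on (hull_type R :: 'a set \<Rightarrow> ('a, 'm) module set) (Spec R)"
proof (rule inj_onI)
  fix P Q assume PQ: "P \<in> Spec R" "Q \<in> Spec R" and eq: "(hull_type R P :: ('a, 'm) module set) = hull_type R Q"
  obtain E :: "('a, 'm) module" where E: "E \<in> hull_type R P" using hull_type_nonempty[OF R PQ(1)] by blast
  then have E': "E \<in> hull_type R Q" using eq by simp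
  obtain e e' where "essential_generator R P E e" "essential_generator R Q E e'"
    using hull_typeD[OF R(1) PQ(1) E] hull_typeD[OF R(1) PQ(2) E'] by blast
  then show "P = Q"
    using essential_generator_unique_prime[OF injective_module_module[OF hull_typeD(1)[OF R(1) PQ(1) E]]]
      SpecD PQ by blast
qed

lemma inj_types_subset_pinj_types: "inj_types R \<subseteq> pinj_types R"
proof -
  have "pure_injective_module R E" if "injective_module R E" for E
    using that unfolding injective_module_def pure_injective_module_def pure_mono_def by blast
  then show ?thesis unfolding inj_types_def pinj_types_def by blast
qed


section \<open>Linear combinations and pp formulas in matrix form\<close>

text \<open>
  The linear combination of \<open>x 0, \<dots>, x (n - 1)\<close> with coefficients \<open>f\<close>. Vectors are functions on
  \<open>nat\<close> of which only the first entries matter.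
\<close>

primrec lc :: "('a, 'm, 'z) module_scheme \<Rightarrow> nat \<Rightarrow> (nat \<Rightarrow> 'a) \<Rightarrow> (nat \<Rightarrow> 'm) \<Rightarrow> 'm" where
  "lc M 0 f x = \<zero>\<^bsub>M\<^esub>"
| "lc M (Suc n) f x = lc M n f x \<oplus>\<^bsub>M\<^esub> f n \<odot>\<^bsub>M\<^esub> x n"

lemma lc_cong:
  assumes "\<And>i. i < n \<Longrightarrow> f i = g i" "\<And>i. i < n \<Longrightarrow> x i = y i"
  shows "lc M n f x = lc M n g y"
  using assms by (induction n) auto

lemma ring_module_simps [simp]:
  "carrier (ring_module R) = carrier R" "\<zero>\<^bsub>ring_module R\<^esub> = \<zero>\<^bsub>R\<^esub>"
  "x \<oplus>\<^bsub>ring_module R\<^esub> y = x \<oplus>\<^bsub>R\<^esub> y" "x \<odot>\<^bsub>ring_module R\<^esub> y = x \<otimes>\<^bsub>R\<^esub> y"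
  by (simp_all add: ring_module_def)

lemma module_ring_module:
  assumes "cring R" shows "module R (ring_module R)"
proof -
  interpret R: cring R by fact
  show ?thesis
  proof (rule moduleI)
    show "abelian_group (ring_module R)"
    proof (rule abelian_groupI)
      show "\<exists>y\<in>carrier (ring_module R). y \<oplus>\<^bsub>ring_module R\<^esub> x = \<zero>\<^bsub>ring_module R\<^esub>"
        if "x \<in> carrier (ring_module R)" for x
        using that by (intro bexI[of _ "\<ominus>\<^bsub>R\<^esub> x"]) (auto simp: R.l_neg)
    qed (auto simp: R.a_ac)
  qed (use assms in \<open>auto simp: R.l_distr R.r_distr R.m_assoc\<close>)
qed

context module
begin

abbreviation (input) coeffs where "coeffs n f \<equiv> \<forall>i<n::nat. f i \<in> carrier R"
abbreviation (input) elems where "elems n x \<equiv> \<forall>i<n::nat. x i \<in> carrier M"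

lemma lc_closed: "coeffs n f \<Longrightarrow> elems n x \<Longrightarrow> lc M n f x \<in> carrier M"
  by (induction n) auto

lemma lc_add_left:
  "coeffs n f \<Longrightarrow> coeffs n g \<Longrightarrow> elems n x \<Longrightarrow>
    lc M n (\<lambda>i. f i \<oplus> g i) x = lc M n f x \<oplus>\<^bsub>M\<^esub> lc M n g x"
  by (induction n) (auto simp: smult_l_distr lc_closed M.a_ac)

lemma lc_smult_left:
  "r \<in> carrier R \<Longrightarrow> coeffs n f \<Longrightarrow> elems n x \<Longrightarrow> lc M n (\<lambda>i. r \<otimes> f i) x = r \<odot>\<^bsub>M\<^esub> lc M n f x"
  by (induction n) (auto simp: smult_r_distr smult_assoc1 lc_closed)

lemma lc_add_right:
  "coeffs n f \<Longrightarrow> elems n x \<Longrightarrow> elems n y \<Longrightarrow>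
    lc M n f (\<lambda>i. x i \<oplus>\<^bsub>M\<^esub> y i) = lc M n f x \<oplus>\<^bsub>M\<^esub> lc M n f y"
  by (induction n) (auto simp: smult_r_distr lc_closed M.a_ac)

lemma lc_smult_right:
  assumes "r \<in> carrier R" shows "coeffs n f \<Longrightarrow> elems n x \<Longrightarrow>
    lc M n f (\<lambda>i. r \<odot>\<^bsub>M\<^esub> x i) = r \<odot>\<^bsub>M\<^esub> lc M n f x"
proof (induction n)
  case (Suc n)
  then have "f n \<odot>\<^bsub>M\<^esub> (r \<odot>\<^bsub>M\<^esub> x n) = r \<odot>\<^bsub>M\<^esub> (f n \<odot>\<^bsub>M\<^esub> x n)"
    using assms by (simp add: R.m_comm flip: smult_assoc1)
  then show ?case using Suc assms by (simp add: smult_r_distr lc_closed)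
qed (use assms in simp)

lemma lc_zero_left: "\<forall>i<n. f i = \<zero> \<Longrightarrow> elems n x \<Longrightarrow> lc M n f x = \<zero>\<^bsub>M\<^esub>"
  by (induction n) auto

lemma lc_zero_right: "coeffs n f \<Longrightarrow> \<forall>i<n. x i = \<zero>\<^bsub>M\<^esub> \<Longrightarrow> lc M n f x = \<zero>\<^bsub>M\<^esub>"
  by (induction n) auto

lemma lc_append:
  "coeffs (n + k) f \<Longrightarrow> elems (n + k) x \<Longrightarrow>
    lc M (n + k) f x = lc M n f x \<oplus>\<^bsub>M\<^esub> lc M k (\<lambda>i. f (n + i)) (\<lambda>i. x (n + i))"
  by (induction k) (auto simp: lc_closed M.a_assoc)

lemma lc_single:
  "i < n \<Longrightarrow> elems n x \<Longrightarrow> lc M n (\<lambda>j. if j = i then \<one> else \<zero>) x = x i"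
proof (induction n)
  case (Suc n)
  show ?case
  proof (cases "i = n")
    case True
    then have "lc M n (\<lambda>j. if j = i then \<one> else \<zero>) x = \<zero>\<^bsub>M\<^esub>"
      using Suc.prems by (intro lc_zero_left) auto
    then show ?thesis using True Suc.prems by simp
  next
    case False
    then show ?thesis using Suc by simp
  qed
qed simp

text \<open>
  Associativity of the product of a row, a matrix and a column.
\<close>

lemma lc_swap:
  assumes "\<forall>i<k. coeffs n (B i)" "elems n y"
  shows "coeffs k c \<Longrightarrow> lc M k c (\<lambda>i. lc M n (B i) y) = lc M n (\<lambda>j. lc (ring_module R) k c (\<lambda>i. B i j)) y"
  using assms(1)
proof (induction k)
  case 0
  then show ?case using assms(2) by (simp add: lc_zero_left)
next
  case (Suc k)
  interpret RM: module R "ring_module R" by (intro module_ring_module R.cring_axioms)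
  have "coeffs n (\<lambda>j. lc (ring_module R) k c (\<lambda>i. B i j))"
    using Suc.prems RM.lc_closed[of k c] by auto
  moreover have "coeffs n (\<lambda>j. c k \<otimes> B k j)" using Suc.prems by auto
  ultimately have "lc M n (\<lambda>j. lc (ring_module R) (Suc k) c (\<lambda>i. B i j)) y =
      lc M n (\<lambda>j. lc (ring_module R) k c (\<lambda>i. B i j)) y \<oplus>\<^bsub>M\<^esub> lc M n (\<lambda>j. c k \<otimes> B k j) y"
    using lc_add_left[OF _ _ assms(2)] by simp
  also have "lc M n (\<lambda>j. c k \<otimes> B k j) y = c k \<odot>\<^bsub>M\<^esub> lc M n (B k) y"
    using Suc.prems assms(2) by (intro lc_smult_left) auto
  finally show ?case using Suc by simp
qed

end

lemma lc_hom:
  assumes "module R M" "module R N" "g \<in> mod_hom R M N"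
    and "\<forall>i<n. f i \<in> carrier R" "\<forall>i<n. x i \<in> carrier M"
  shows "g (lc M n f x) = lc N n f (\<lambda>i. g (x i))"
  using assms(4,5)
proof (induction n)
  case 0
  then show ?case using mod_hom_zero[OF assms(1-3)] by simp
next
  case (Suc n)
  then show ?case using mod_hom_add[OF assms(3)] mod_hom_smult[OF assms(3)]
      module.lc_closed[OF assms(1)] module.smult_closed[OF assms(1)] by simp
qed

lemma lin_form_eq_lc:
  assumes "module R M" and "length x = n" "set x \<subseteq> carrier M" "\<forall>i<n. r ! i \<in> carrier R"
  shows "lin_form M r x = lc M n ((!) r) ((!) x)"
proof -
  interpret module R M by fact
  have x: "\<forall>i<n. x ! i \<in> carrier M" using assms by auto
  have "(\<Oplus>\<^bsub>M\<^esub> i\<in>{..<k}. (r ! i) \<odot>\<^bsub>M\<^esub> (x ! i)) = lc M k ((!) r) ((!) x)" if "k \<le> n" for k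
    using that
  proof (induction k)
    case (Suc k)
    have "(\<Oplus>\<^bsub>M\<^esub> i\<in>insert k {..<k}. (r ! i) \<odot>\<^bsub>M\<^esub> (x ! i)) =
        (r ! k) \<odot>\<^bsub>M\<^esub> (x ! k) \<oplus>\<^bsub>M\<^esub> (\<Oplus>\<^bsub>M\<^esub> i\<in>{..<k}. (r ! i) \<odot>\<^bsub>M\<^esub> (x ! i))"
      using Suc.prems assms(4) x by (intro M.finsum_insert) auto
    then show ?case using Suc assms(4) x by (simp add: lessThan_Suc M.a_comm lc_closed)
  qed simp
  then show ?thesis using assms(2) by (simp add: lin_form_def)
qed

lemma (in cring) lc_ring_comm:
  "\<forall>i<n. f i \<in> carrier R \<Longrightarrow> \<forall>i<n. x i \<in> carrier R \<Longrightarrow>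
    lc (ring_module R) n f x = lc (ring_module R) n x f"
  by (induction n) (auto simp: m_comm)

lemma (in cring) lc_single_right:
  assumes "i < n" "\<forall>i<n. f i \<in> carrier R"
  shows "lc (ring_module R) n f (\<lambda>j. if j = i then \<one> else \<zero>) = f i"
proof -
  interpret RM: module R "ring_module R" by (intro module_ring_module cring_axioms)
  have "lc (ring_module R) n f (\<lambda>j. if j = i then \<one> else \<zero>) = lc (ring_module R) n (\<lambda>j. if j = i then \<one> else \<zero>) f"
    using assms by (intro lc_ring_comm) auto
  then show ?thesis using RM.lc_single[of i n f] assms by simp
qed

text \<open>
  The two coefficient matrices of a pp formula; \<open>k\<close> numbers the equations.
\<close>

definition free_coeff :: "'a pp_formula \<Rightarrow> nat \<Rightarrow> nat \<Rightarrow> 'a" where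
  "free_coeff \<phi> k i = fst (equations \<phi> ! k) ! i"

definition bound_coeff :: "'a pp_formula \<Rightarrow> nat \<Rightarrow> nat \<Rightarrow> 'a" where
  "bound_coeff \<phi> k j = snd (equations \<phi> ! k) ! j"

lemma pp_over_coeffs:
  assumes "pp_over R \<phi>" "k < length (equations \<phi>)"
  shows "i < free_vars \<phi> \<Longrightarrow> free_coeff \<phi> k i \<in> carrier R"
    and "j < bound_vars \<phi> \<Longrightarrow> bound_coeff \<phi> k j \<in> carrier R"
proof -
  have "equations \<phi> ! k \<in> set (equations \<phi>)" using assms(2) by simp
  then have *: "length (fst (equations \<phi> ! k)) = free_vars \<phi> \<and> set (fst (equations \<phi> ! k)) \<subseteq> carrier R \<and>
      length (snd (equations \<phi> ! k)) = bound_vars \<phi> \<and> set (snd (equations \<phi> ! k)) \<subseteq> carrier R"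
    using assms(1) unfolding pp_over_def by fastforce
  show "i < free_vars \<phi> \<Longrightarrow> free_coeff \<phi> k i \<in> carrier R"
    using * by (auto simp: free_coeff_def subset_iff)
  show "j < bound_vars \<phi> \<Longrightarrow> bound_coeff \<phi> k j \<in> carrier R"
    using * by (auto simp: bound_coeff_def subset_iff)
qed

text \<open>
  Solvability in \<open>M\<close> of the \<open>K\<close> equations \<open>u k + \<Sum>\<^sub>j B k j \<cdot> y j = 0\<close> in \<open>m\<close> unknowns.
\<close>

definition solvable :: "('a, 'm, 'z) module_scheme \<Rightarrow> nat \<Rightarrow> nat \<Rightarrow> (nat \<Rightarrow> nat \<Rightarrow> 'a) \<Rightarrow> (nat \<Rightarrow> 'm) \<Rightarrow> bool" where
  "solvable M m K B u \<longleftrightarrow>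
     (\<exists>y. (\<forall>j<m. y j \<in> carrier M) \<and> (\<forall>k<K. u k \<oplus>\<^bsub>M\<^esub> lc M m (B k) y = \<zero>\<^bsub>M\<^esub>))"

lemma pp_sol_iff_solvable:
  assumes M: "module R M" and "pp_over R \<phi>"
  shows "x \<in> pp_sol M \<phi> \<longleftrightarrow> length x = free_vars \<phi> \<and> set x \<subseteq> carrier M \<and>
    solvable M (bound_vars \<phi>) (length (equations \<phi>)) (bound_coeff \<phi>)
      (\<lambda>k. lc M (free_vars \<phi>) (free_coeff \<phi> k) ((!) x))"
proof -
  let ?n = "free_vars \<phi>" and ?m = "bound_vars \<phi>" and ?K = "length (equations \<phi>)"
  note co = pp_over_coeffs[OF assms(2)]
  have lin: "lin_form M (fst (equations \<phi> ! k)) x = lc M ?n (free_coeff \<phi> k) ((!) x)"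
    if "k < ?K" "length x = ?n" "set x \<subseteq> carrier M" for k x
    using lin_form_eq_lc[OF M that(2,3), of "fst (equations \<phi> ! k)"] co(1)[OF that(1)]
    by (simp add: free_coeff_def[abs_def])
  have lin': "lin_form M (snd (equations \<phi> ! k)) y = lc M ?m (bound_coeff \<phi> k) ((!) y)"
    if "k < ?K" "length y = ?m" "set y \<subseteq> carrier M" for k y
    using lin_form_eq_lc[OF M that(2,3), of "snd (equations \<phi> ! k)"] co(2)[OF that(1)]
    by (simp add: bound_coeff_def[abs_def])
  have "(\<exists>y. length y = ?m \<and> set y \<subseteq> carrier M \<and>
        (\<forall>(r, s)\<in>set (equations \<phi>). lin_form M r x \<oplus>\<^bsub>M\<^esub> lin_form M s y = \<zero>\<^bsub>M\<^esub>)) \<longleftrightarrow>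
      solvable M ?m ?K (bound_coeff \<phi>) (\<lambda>k. lc M ?n (free_coeff \<phi> k) ((!) x))" (is "?L \<longleftrightarrow> ?S")
    if x: "length x = ?n" "set x \<subseteq> carrier M"
  proof
    assume ?L
    then obtain y where y: "length y = ?m" "set y \<subseteq> carrier M"
      and eq: "\<And>k. k < ?K \<Longrightarrow> lin_form M (fst (equations \<phi> ! k)) x \<oplus>\<^bsub>M\<^esub> lin_form M (snd (equations \<phi> ! k)) y = \<zero>\<^bsub>M\<^esub>"
      by (fastforce simp: split_beta all_set_conv_all_nth)
    show ?S unfolding solvable_def
      using y eq lin[OF _ x] lin'[OF _ y] by (intro exI[of _ "(!) y"]) auto
  next
    assume ?S
    then obtain y where y: "\<And>j. j < ?m \<Longrightarrow> y j \<in> carrier M"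
      and eq: "\<And>k. k < ?K \<Longrightarrow> lc M ?n (free_coeff \<phi> k) ((!) x) \<oplus>\<^bsub>M\<^esub> lc M ?m (bound_coeff \<phi> k) y = \<zero>\<^bsub>M\<^esub>"
      unfolding solvable_def by blast
    let ?y = "map y [0..<?m]"
    have y': "length ?y = ?m" "set ?y \<subseteq> carrier M" using y by auto
    have "lc M ?m (bound_coeff \<phi> k) ((!) ?y) = lc M ?m (bound_coeff \<phi> k) y" for k
      by (rule lc_cong) auto
    then have "lin_form M (fst (equations \<phi> ! k)) x \<oplus>\<^bsub>M\<^esub> lin_form M (snd (equations \<phi> ! k)) ?y = \<zero>\<^bsub>M\<^esub>"
      if "k < ?K" for k using lin[OF that x] lin'[OF that y'] eq[OF that] by simp
    then show ?L using y' by (intro exI[of _ ?y]) (auto simp: split_beta all_set_conv_all_nth)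
  qed
  then show ?thesis unfolding pp_sol_def by blast
qed

text \<open>
  The pp formula with prescribed coefficient matrices.
\<close>

definition matrix_formula ::
  "nat \<Rightarrow> nat \<Rightarrow> nat \<Rightarrow> (nat \<Rightarrow> nat \<Rightarrow> 'a) \<Rightarrow> (nat \<Rightarrow> nat \<Rightarrow> 'a) \<Rightarrow> 'a pp_formula" where
  "matrix_formula n m K A B = \<lparr>free_vars = n, bound_vars = m,
     equations = map (\<lambda>k. (map (A k) [0..<n], map (B k) [0..<m])) [0..<K]\<rparr>"

lemma matrix_formula_simps [simp]:
  "free_vars (matrix_formula n m K A B) = n" "bound_vars (matrix_formula n m K A B) = m"
  "length (equations (matrix_formula n m K A B)) = K"
  "k < K \<Longrightarrow> i < n \<Longrightarrow> free_coeff (matrix_formula n m K A B) k i = A k i"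
  "k < K \<Longrightarrow> j < m \<Longrightarrow> bound_coeff (matrix_formula n m K A B) k j = B k j"
  by (simp_all add: matrix_formula_def free_coeff_def bound_coeff_def)

lemma pp_over_matrix_formula:
  assumes "\<forall>k<K. \<forall>i<n. A k i \<in> carrier R" "\<forall>k<K. \<forall>j<m. B k j \<in> carrier R"
  shows "pp_over R (matrix_formula n m K A B)"
  using assms by (auto simp: pp_over_def matrix_formula_def)

lemma solvable_cong:
  assumes "\<And>k. k < K \<Longrightarrow> u k = u' k" "\<And>k j. k < K \<Longrightarrow> j < m \<Longrightarrow> B k j = B' k j"
  shows "solvable M m K B u \<longleftrightarrow> solvable M m K B' u'"
proof -
  have "lc M m (B k) y = lc M m (B' k) y" if "k < K" for k y
    using assms(2)[OF that] by (intro lc_cong) auto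
  then show ?thesis using assms(1) unfolding solvable_def by simp
qed

lemma pp_sol_matrix_formula:
  assumes M: "module R M" and "\<forall>k<K. \<forall>i<n. A k i \<in> carrier R" "\<forall>k<K. \<forall>j<m. B k j \<in> carrier R"
  shows "x \<in> pp_sol M (matrix_formula n m K A B) \<longleftrightarrow> length x = n \<and> set x \<subseteq> carrier M \<and>
    solvable M m K B (\<lambda>k. lc M n (A k) ((!) x))"
proof -
  have "solvable M m K (bound_coeff (matrix_formula n m K A B))
      (\<lambda>k. lc M n (free_coeff (matrix_formula n m K A B) k) ((!) x)) \<longleftrightarrow>
    solvable M m K B (\<lambda>k. lc M n (A k) ((!) x))"
    by (intro solvable_cong lc_cong) auto
  then show ?thesis using pp_sol_iff_solvable[OF M pp_over_matrix_formula[OF assms(2,3)]] by simp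
qed


section \<open>pp formulas in injective modules\<close>

text \<open>
  The free module \<open>R\<^sup>n\<close> of functions that vanish from \<open>n\<close> on.
\<close>

definition coord_module :: "('a, 'r) ring_scheme \<Rightarrow> nat \<Rightarrow> ('a, nat \<Rightarrow> 'a) module" where
  "coord_module R n = \<lparr>carrier = {f. (\<forall>i<n. f i \<in> carrier R) \<and> (\<forall>i\<ge>n. f i = \<zero>\<^bsub>R\<^esub>)},
     monoid.mult = undefined, one = undefined, ring.zero = (\<lambda>_. \<zero>\<^bsub>R\<^esub>),
     add = (\<lambda>f g i. f i \<oplus>\<^bsub>R\<^esub> g i), smult = (\<lambda>r f i. r \<otimes>\<^bsub>R\<^esub> f i)\<rparr>"

lemma coord_module_simps:
  "f \<in> carrier (coord_module R n) \<longleftrightarrow> (\<forall>i<n. f i \<in> carrier R) \<and> (\<forall>i\<ge>n. f i = \<zero>\<^bsub>R\<^esub>)"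
  "\<zero>\<^bsub>coord_module R n\<^esub> = (\<lambda>_. \<zero>\<^bsub>R\<^esub>)"
  "f \<oplus>\<^bsub>coord_module R n\<^esub> g = (\<lambda>i. f i \<oplus>\<^bsub>R\<^esub> g i)"
  "r \<odot>\<^bsub>coord_module R n\<^esub> f = (\<lambda>i. r \<otimes>\<^bsub>R\<^esub> f i)"
  by (simp_all add: coord_module_def)

lemma coord_module_module:
  assumes "cring R" shows "module R (coord_module R n)"
proof -
  interpret R: cring R by fact
  have c: "f i \<in> carrier R" if "f \<in> carrier (coord_module R n)" for f i
    using that by (cases "i < n") (auto simp: coord_module_simps)
  show ?thesis
  proof (rule moduleI)
    show "abelian_group (coord_module R n)"
    proof (rule abelian_groupI)
      show "\<exists>g\<in>carrier (coord_module R n). g \<oplus>\<^bsub>coord_module R n\<^esub> f = \<zero>\<^bsub>coord_module R n\<^esub>"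
        if "f \<in> carrier (coord_module R n)" for f
        using c[OF that] that
        by (intro bexI[of _ "\<lambda>i. \<ominus>\<^bsub>R\<^esub> f i"]) (auto simp: coord_module_simps R.l_neg)
      show "f \<oplus>\<^bsub>coord_module R n\<^esub> g \<oplus>\<^bsub>coord_module R n\<^esub> h = f \<oplus>\<^bsub>coord_module R n\<^esub> (g \<oplus>\<^bsub>coord_module R n\<^esub> h)"
        if "f \<in> carrier (coord_module R n)" "g \<in> carrier (coord_module R n)" "h \<in> carrier (coord_module R n)" for f g h
        using that[THEN c] by (auto simp: coord_module_simps R.a_ac)
      show "f \<oplus>\<^bsub>coord_module R n\<^esub> g = g \<oplus>\<^bsub>coord_module R n\<^esub> f"
        if "f \<in> carrier (coord_module R n)" "g \<in> carrier (coord_module R n)" for f g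
        using that[THEN c] by (auto simp: coord_module_simps R.a_ac)
      show "\<zero>\<^bsub>coord_module R n\<^esub> \<oplus>\<^bsub>coord_module R n\<^esub> f = f" if "f \<in> carrier (coord_module R n)" for f
        using c[OF that] by (auto simp: coord_module_simps)
    qed (auto simp: coord_module_simps)
    fix a b f g
    assume ab: "a \<in> carrier R" "b \<in> carrier R" and f: "f \<in> carrier (coord_module R n)"
    show "(a \<oplus>\<^bsub>R\<^esub> b) \<odot>\<^bsub>coord_module R n\<^esub> f = a \<odot>\<^bsub>coord_module R n\<^esub> f \<oplus>\<^bsub>coord_module R n\<^esub> b \<odot>\<^bsub>coord_module R n\<^esub> f"
      using c[OF f] ab by (simp add: coord_module_simps R.l_distr)
    show "(a \<otimes>\<^bsub>R\<^esub> b) \<odot>\<^bsub>coord_module R n\<^esub> f = a \<odot>\<^bsub>coord_module R n\<^esub> (b \<odot>\<^bsub>coord_module R n\<^esub> f)"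
      using c[OF f] ab by (simp add: coord_module_simps R.m_assoc)
  next
    fix a f g assume a: "a \<in> carrier R" and f: "f \<in> carrier (coord_module R n)" and g: "g \<in> carrier (coord_module R n)"
    show "a \<odot>\<^bsub>coord_module R n\<^esub> (f \<oplus>\<^bsub>coord_module R n\<^esub> g) =
        a \<odot>\<^bsub>coord_module R n\<^esub> f \<oplus>\<^bsub>coord_module R n\<^esub> a \<odot>\<^bsub>coord_module R n\<^esub> g"
      using c[OF f] c[OF g] a by (simp add: coord_module_simps R.r_distr)
  next
    fix f assume f: "f \<in> carrier (coord_module R n)"
    show "\<one>\<^bsub>R\<^esub> \<odot>\<^bsub>coord_module R n\<^esub> f = f" using c[OF f] by (simp add: coord_module_simps)
  qed (use assms in \<open>auto simp: coord_module_simps\<close>)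
qed

text \<open>
  The \<open>i\<close>-th standard basis vector.
\<close>

definition unit_vector :: "('a, 'r) ring_scheme \<Rightarrow> nat \<Rightarrow> nat \<Rightarrow> 'a" where
  "unit_vector R i = (\<lambda>j. if j = i then \<one>\<^bsub>R\<^esub> else \<zero>\<^bsub>R\<^esub>)"

lemma coord_module_hom:
  assumes E: "module R E" and g: "g \<in> mod_hom R (coord_module R n) E" and f: "f \<in> carrier (coord_module R n)"
  shows "g f = lc E n f (\<lambda>i. g (unit_vector R i))"
proof -
  interpret E: module R E by fact
  note C = coord_module_module[OF E.R.cring_axioms, of n]
  interpret C: module R "coord_module R n" by (rule C)
  have fc: "f i \<in> carrier R" if "i < n" for i using f that by (simp add: coord_module_simps)
  have uc: "unit_vector R i \<in> carrier (coord_module R n)" if "i < n" for i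
    using that by (auto simp: coord_module_simps unit_vector_def)
  have "lc (coord_module R n) k f (unit_vector R) = (\<lambda>i. if i < k then f i else \<zero>\<^bsub>R\<^esub>)" if "k \<le> n" for k
    using that
  proof (induction k)
    case 0 then show ?case by (simp add: coord_module_simps)
  next
    case (Suc k)
    then show ?case using fc
      by (auto simp: coord_module_simps unit_vector_def fun_eq_iff less_Suc_eq)
  qed
  from this[of n] have "lc (coord_module R n) n f (unit_vector R) = f"
    using f by (auto simp: coord_module_simps fun_eq_iff)
  then show ?thesis using lc_hom[OF C E g, of n f "unit_vector R"] fc uc by simp
qed

lemma coord_module_embeds:
  fixes R :: "('a, 'r) ring_scheme"
  assumes "large_universe R TYPE('m)"
  shows "\<exists>j :: (nat \<Rightarrow> 'a) \<Rightarrow> 'm. inj_on j (carrier (coord_module R n))"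
proof -
  obtain \<iota> :: "'a list set \<Rightarrow> 'm" where \<iota>: "inj_on \<iota> (Pow (lists (carrier R)))"
    using assms by (auto simp: large_universe_def)
  have "inj_on (\<lambda>f. \<iota> {map f [0..<n]}) (carrier (coord_module R n))"
  proof (rule inj_onI)
    fix f g assume fg: "f \<in> carrier (coord_module R n)" "g \<in> carrier (coord_module R n)"
      and eq: "\<iota> {map f [0..<n]} = \<iota> {map g [0..<n]}"
    have "{map f [0..<n]} \<in> Pow (lists (carrier R))" "{map g [0..<n]} \<in> Pow (lists (carrier R))"
      using fg by (auto simp: coord_module_simps)
    then have "map f [0..<n] = map g [0..<n]" using inj_onD[OF \<iota> eq] by blast
    then have "f i = g i" if "i < n" for i using that by simp
    then show "f = g" using fg by (intro ext) (metis coord_module_simps(1) not_less)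
  qed
  then show ?thesis by blast
qed

text \<open>
  A linear system over an injective module is solvable iff it is consistent, that is, iff every linear
  relation \<open>c\<close> between the rows of \<open>B\<close> kills \<open>u\<close>. For the converse, consistency means that sending the
  \<open>k\<close>-th row to \<open>-u k\<close> is well defined on the row space; a solution consists of the values of an
  extension at the unit vectors.
\<close>

lemma solvable_in_injective:
  fixes R :: "('a, 'r) ring_scheme" and E :: "('a, 'm) module"
  assumes E: "injective_module R E" and univ: "large_universe R TYPE('m)"
    and B: "\<forall>k<K. \<forall>j<m. B k j \<in> carrier R" and u: "\<forall>k<K. u k \<in> carrier E"
  shows "solvable E m K B u \<longleftrightarrow> (\<forall>c. (\<forall>k<K. c k \<in> carrier R) \<longrightarrow>
    (\<forall>j<m. lc (ring_module R) K c (\<lambda>k. B k j) = \<zero>\<^bsub>R\<^esub>) \<longrightarrow> lc E K c u = \<zero>\<^bsub>E\<^esub>)"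
proof -
  note mE = injective_module_module[OF E]
  interpret E: module R E by (rule mE)
  interpret RM: module R "ring_module R" by (intro module_ring_module E.R.cring_axioms)
  note C = coord_module_module[OF E.R.cring_axioms, of m]
  have B': "\<forall>k<K. c k \<in> carrier R \<Longrightarrow> lc (ring_module R) K c (\<lambda>k. B k j) \<in> carrier R" if "j < m" for j c
    using RM.lc_closed[of K c "\<lambda>k. B k j"] B that by simp
  show ?thesis
  proof (intro iffI allI impI)
    fix c assume "solvable E m K B u" and c: "\<forall>k<K. c k \<in> carrier R"
      and rel: "\<forall>j<m. lc (ring_module R) K c (\<lambda>k. B k j) = \<zero>\<^bsub>R\<^esub>"
    then obtain y where y: "\<forall>j<m. y j \<in> carrier E" "\<forall>k<K. u k \<oplus>\<^bsub>E\<^esub> lc E m (B k) y = \<zero>\<^bsub>E\<^esub>"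
      by (auto simp: solvable_def)
    have By: "\<forall>k<K. lc E m (B k) y \<in> carrier E" using E.lc_closed B y by auto
    have "lc E K c (\<lambda>k. lc E m (B k) y) = lc E m (\<lambda>j. lc (ring_module R) K c (\<lambda>k. B k j)) y"
      by (rule E.lc_swap[OF B y(1) c])
    also have "\<dots> = \<zero>\<^bsub>E\<^esub>" using E.lc_zero_left[OF rel y(1)] .
    finally have "lc E K c (\<lambda>k. u k \<oplus>\<^bsub>E\<^esub> lc E m (B k) y) = lc E K c u"
      using E.lc_add_right[OF c u By] E.lc_closed[OF c u] by simp
    then show "lc E K c u = \<zero>\<^bsub>E\<^esub>" using E.lc_zero_right[OF c] y(2) by simp
  next
    assume cons: "\<forall>c. (\<forall>k<K. c k \<in> carrier R) \<longrightarrow>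
      (\<forall>j<m. lc (ring_module R) K c (\<lambda>k. B k j) = \<zero>\<^bsub>R\<^esub>) \<longrightarrow> lc E K c u = \<zero>\<^bsub>E\<^esub>"
    obtain \<iota> :: "(nat \<Rightarrow> 'a) \<Rightarrow> 'm" where \<iota>: "inj_on \<iota> (carrier (coord_module R m))"
      using coord_module_embeds[OF univ] by blast
    define row where "row c = (\<lambda>j. if j < m then lc (ring_module R) K c (\<lambda>k. B k j) else \<zero>\<^bsub>R\<^esub>)" for c
    let ?G = "{(row c, \<ominus>\<^bsub>E\<^esub> lc E K c u) | c. \<forall>k<K. c k \<in> carrier R}"
    have "\<exists>g\<in>mod_hom R (coord_module R m) E. \<forall>b e. (b, e) \<in> ?G \<longrightarrow> g b = e"
    proof (rule injective_extends[OF E C \<iota>])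
      show "?G \<subseteq> carrier (coord_module R m) \<times> carrier E"
        using B' E.lc_closed u by (auto simp: row_def coord_module_simps)
      show "(\<zero>\<^bsub>coord_module R m\<^esub>, \<zero>\<^bsub>E\<^esub>) \<in> ?G"
      proof -
        let ?c = "\<lambda>_::nat. \<zero>\<^bsub>R\<^esub>"
        have "row ?c = \<zero>\<^bsub>coord_module R m\<^esub>"
          using RM.lc_zero_left[of K ?c] B by (auto simp: row_def coord_module_simps fun_eq_iff)
        moreover have "\<ominus>\<^bsub>E\<^esub> lc E K ?c u = \<zero>\<^bsub>E\<^esub>" using E.lc_zero_left[of K ?c u] u by simp
        ultimately show ?thesis by (intro CollectI exI[of _ ?c]) simp
      qed
      show "(b \<oplus>\<^bsub>coord_module R m\<^esub> b', e \<oplus>\<^bsub>E\<^esub> e') \<in> ?G" if be: "(b, e) \<in> ?G" "(b', e') \<in> ?G" for b e b' e'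
      proof -
        obtain c c' where c: "\<forall>k<K. c k \<in> carrier R" "\<forall>k<K. c' k \<in> carrier R" "b = row c" "b' = row c'"
          "e = \<ominus>\<^bsub>E\<^esub> lc E K c u" "e' = \<ominus>\<^bsub>E\<^esub> lc E K c' u" using be by blast
        let ?c = "\<lambda>k. c k \<oplus>\<^bsub>R\<^esub> c' k"
        have "row ?c = b \<oplus>\<^bsub>coord_module R m\<^esub> b'"
          using RM.lc_add_left[of K c c'] c B by (auto simp: row_def coord_module_simps fun_eq_iff)
        moreover have "\<ominus>\<^bsub>E\<^esub> lc E K ?c u = e \<oplus>\<^bsub>E\<^esub> e'"
          using E.lc_add_left[OF c(1,2) u] E.lc_closed[OF c(1) u] E.lc_closed[OF c(2) u] c
          by (simp add: E.M.minus_add)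
        ultimately show ?thesis using c by (intro CollectI exI[of _ ?c]) auto
      qed
      show "(r \<odot>\<^bsub>coord_module R m\<^esub> b, r \<odot>\<^bsub>E\<^esub> e) \<in> ?G" if r: "r \<in> carrier R" and be: "(b, e) \<in> ?G" for r b e
      proof -
        obtain c where c: "\<forall>k<K. c k \<in> carrier R" "b = row c" "e = \<ominus>\<^bsub>E\<^esub> lc E K c u" using be by blast
        let ?c = "\<lambda>k. r \<otimes>\<^bsub>R\<^esub> c k"
        have "row ?c = r \<odot>\<^bsub>coord_module R m\<^esub> b"
          using RM.lc_smult_left[of r K c] c B r by (auto simp: row_def coord_module_simps fun_eq_iff)
        moreover have "\<ominus>\<^bsub>E\<^esub> lc E K ?c u = r \<odot>\<^bsub>E\<^esub> e"
          using E.lc_smult_left[OF r c(1) u] E.lc_closed[OF c(1) u] c r by (simp add: E.smult_r_minus)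
        ultimately show ?thesis using c r by (intro CollectI exI[of _ ?c]) auto
      qed
      show "e = \<zero>\<^bsub>E\<^esub>" if e: "(\<zero>\<^bsub>coord_module R m\<^esub>, e) \<in> ?G" for e
      proof -
        obtain c where c: "\<forall>k<K. c k \<in> carrier R" "row c = (\<lambda>_. \<zero>\<^bsub>R\<^esub>)" "e = \<ominus>\<^bsub>E\<^esub> lc E K c u"
          using e by (auto simp: coord_module_simps)
        have "\<forall>j<m. lc (ring_module R) K c (\<lambda>k. B k j) = \<zero>\<^bsub>R\<^esub>"
          using fun_cong[OF c(2)] unfolding row_def by metis
        then have "lc E K c u = \<zero>\<^bsub>E\<^esub>" using cons c(1) by blast
        then show ?thesis using c by simp
      qed
    qed
    then obtain g where g: "g \<in> mod_hom R (coord_module R m) E" and gG: "\<And>b e. (b, e) \<in> ?G \<Longrightarrow> g b = e"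
      by blast
    define y where "y j = g (unit_vector R j)" for j
    show "solvable E m K B u"
      unfolding solvable_def
    proof (intro exI[of _ y] conjI allI impI)
      show "y j \<in> carrier E" if "j < m" for j
        unfolding y_def using that by (intro mod_hom_closed[OF g]) (auto simp: coord_module_simps unit_vector_def)
      fix k assume k: "k < K"
      have uk: "\<forall>k<K. unit_vector R i k \<in> carrier R" for i by (auto simp: unit_vector_def)
      have row: "row (unit_vector R k) j = B k j" if "j < m" for j
        using that RM.lc_single[OF k, of "\<lambda>k. B k j"] B by (simp add: row_def unit_vector_def)
      have rc: "row (unit_vector R k) \<in> carrier (coord_module R m)"
        using row B k by (auto simp: coord_module_simps) (auto simp: row_def)
      have "lc E m (B k) y = lc E m (row (unit_vector R k)) y" by (rule lc_cong) (simp_all add: row)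
      also have "\<dots> = g (row (unit_vector R k))"
        using coord_module_hom[OF mE g rc] by (simp add: y_def[abs_def])
      also have "\<dots> = \<ominus>\<^bsub>E\<^esub> lc E K (unit_vector R k) u" by (rule gG) (use uk in blast)
      also have "lc E K (unit_vector R k) u = u k"
        unfolding unit_vector_def by (rule E.lc_single[OF k u])
      finally show "u k \<oplus>\<^bsub>E\<^esub> lc E m (B k) y = \<zero>\<^bsub>E\<^esub>" using u k by (simp add: E.M.r_neg)
    qed
  qed
qed

text \<open>
  The submodule \<open>D\<^sub>\<phi>\<close> of \<open>R\<^sup>n\<close>: the vectors \<open>c A\<close>, where \<open>A\<close> and \<open>B\<close> are the coefficient matrices of
  the free and of the bound variables and \<open>c B = 0\<close>. Entries of \<open>d\<close> beyond the number of free variables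
  are unconstrained.
\<close>

definition dual_vectors :: "('a, 'r) ring_scheme \<Rightarrow> 'a pp_formula \<Rightarrow> (nat \<Rightarrow> 'a) set" where
  "dual_vectors R \<phi> = {d. \<exists>c. (\<forall>k<length (equations \<phi>). c k \<in> carrier R) \<and>
     (\<forall>j<bound_vars \<phi>. lc (ring_module R) (length (equations \<phi>)) c (\<lambda>k. bound_coeff \<phi> k j) = \<zero>\<^bsub>R\<^esub>) \<and>
     (\<forall>i<free_vars \<phi>. d i = lc (ring_module R) (length (equations \<phi>)) c (\<lambda>k. free_coeff \<phi> k i))}"

lemma dual_vectors_closed:
  assumes "cring R" "pp_over R \<phi>" "d \<in> dual_vectors R \<phi>" "i < free_vars \<phi>"
  shows "d i \<in> carrier R"
proof -
  interpret RM: module R "ring_module R" by (intro module_ring_module assms)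
  obtain c where "\<forall>k<length (equations \<phi>). c k \<in> carrier R"
    "d i = lc (ring_module R) (length (equations \<phi>)) c (\<lambda>k. free_coeff \<phi> k i)"
    using assms(3,4) by (auto simp: dual_vectors_def)
  then show ?thesis using RM.lc_closed[of "length (equations \<phi>)" c "\<lambda>k. free_coeff \<phi> k i"]
      pp_over_coeffs(1)[OF assms(2) _ assms(4)] by simp
qed

lemma dual_vectors_zero:
  assumes "cring R" "pp_over R \<phi>" shows "(\<lambda>_. \<zero>\<^bsub>R\<^esub>) \<in> dual_vectors R \<phi>"
proof -
  interpret RM: module R "ring_module R" by (intro module_ring_module assms)
  have "lc (ring_module R) (length (equations \<phi>)) (\<lambda>_. \<zero>\<^bsub>R\<^esub>) (\<lambda>k. bound_coeff \<phi> k j) = \<zero>\<^bsub>R\<^esub>" if "j < bound_vars \<phi>" for j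
    using RM.lc_zero_left[of "length (equations \<phi>)" "\<lambda>_. \<zero>\<^bsub>R\<^esub>"] pp_over_coeffs(2)[OF assms(2) _ that] by simp
  moreover have "lc (ring_module R) (length (equations \<phi>)) (\<lambda>_. \<zero>\<^bsub>R\<^esub>) (\<lambda>k. free_coeff \<phi> k i) = \<zero>\<^bsub>R\<^esub>" if "i < free_vars \<phi>" for i
    using RM.lc_zero_left[of "length (equations \<phi>)" "\<lambda>_. \<zero>\<^bsub>R\<^esub>"] pp_over_coeffs(1)[OF assms(2) _ that] by simp
  ultimately show ?thesis unfolding dual_vectors_def by (intro CollectI exI[of _ "\<lambda>_. \<zero>\<^bsub>R\<^esub>"]) auto
qed

lemma dual_vectors_add:
  assumes R: "cring R" "pp_over R \<phi>" and d: "d \<in> dual_vectors R \<phi>" "d' \<in> dual_vectors R \<phi>"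
  shows "(\<lambda>i. d i \<oplus>\<^bsub>R\<^esub> d' i) \<in> dual_vectors R \<phi>"
proof -
  interpret RM: module R "ring_module R" by (intro module_ring_module R)
  let ?K = "length (equations \<phi>)"
  obtain c c' where c: "\<forall>k<?K. c k \<in> carrier R" "\<forall>k<?K. c' k \<in> carrier R"
    and B: "\<forall>j<bound_vars \<phi>. lc (ring_module R) ?K c (\<lambda>k. bound_coeff \<phi> k j) = \<zero>\<^bsub>R\<^esub>"
      "\<forall>j<bound_vars \<phi>. lc (ring_module R) ?K c' (\<lambda>k. bound_coeff \<phi> k j) = \<zero>\<^bsub>R\<^esub>"
    and A: "\<forall>i<free_vars \<phi>. d i = lc (ring_module R) ?K c (\<lambda>k. free_coeff \<phi> k i)"
      "\<forall>i<free_vars \<phi>. d' i = lc (ring_module R) ?K c' (\<lambda>k. free_coeff \<phi> k i)"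
    using d unfolding dual_vectors_def by blast
  have add: "lc (ring_module R) ?K (\<lambda>k. c k \<oplus>\<^bsub>R\<^esub> c' k) x = lc (ring_module R) ?K c x \<oplus>\<^bsub>R\<^esub> lc (ring_module R) ?K c' x"
    if "\<forall>k<?K. x k \<in> carrier R" for x
    using RM.lc_add_left[OF c] that by simp
  show ?thesis unfolding dual_vectors_def
    using c A B pp_over_coeffs[OF R(2)]
    by (intro CollectI exI[of _ "\<lambda>k. c k \<oplus>\<^bsub>R\<^esub> c' k"]) (auto simp: add)
qed

lemma dual_vectors_smult:
  assumes R: "cring R" "pp_over R \<phi>" and d: "d \<in> dual_vectors R \<phi>" and r: "r \<in> carrier R"
  shows "(\<lambda>i. r \<otimes>\<^bsub>R\<^esub> d i) \<in> dual_vectors R \<phi>"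
proof -
  interpret RM: module R "ring_module R" by (intro module_ring_module R)
  let ?K = "length (equations \<phi>)"
  obtain c where c: "\<forall>k<?K. c k \<in> carrier R"
    and B: "\<forall>j<bound_vars \<phi>. lc (ring_module R) ?K c (\<lambda>k. bound_coeff \<phi> k j) = \<zero>\<^bsub>R\<^esub>"
    and A: "\<forall>i<free_vars \<phi>. d i = lc (ring_module R) ?K c (\<lambda>k. free_coeff \<phi> k i)"
    using d unfolding dual_vectors_def by blast
  have smult: "lc (ring_module R) ?K (\<lambda>k. r \<otimes>\<^bsub>R\<^esub> c k) x = r \<otimes>\<^bsub>R\<^esub> lc (ring_module R) ?K c x"
    if "\<forall>k<?K. x k \<in> carrier R" for x
    using RM.lc_smult_left[OF r c] that by simp
  show ?thesis unfolding dual_vectors_def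
    using c A B r pp_over_coeffs[OF R(2)]
    by (intro CollectI exI[of _ "\<lambda>k. r \<otimes>\<^bsub>R\<^esub> c k"]) (auto simp: smult)
qed

lemma dual_vectors_cong:
  assumes "d \<in> dual_vectors R \<phi>" "\<And>i. i < free_vars \<phi> \<Longrightarrow> d' i = d i"
  shows "d' \<in> dual_vectors R \<phi>"
  using assms unfolding dual_vectors_def by auto

lemma pp_sol_injective_iff:
  fixes R :: "('a, 'r) ring_scheme" and E :: "('a, 'm) module"
  assumes E: "injective_module R E" and univ: "large_universe R TYPE('m)" and \<phi>: "pp_over R \<phi>"
    and x: "length x = free_vars \<phi>" "set x \<subseteq> carrier E"
  shows "x \<in> pp_sol E \<phi> \<longleftrightarrow> (\<forall>d\<in>dual_vectors R \<phi>. lc E (free_vars \<phi>) d ((!) x) = \<zero>\<^bsub>E\<^esub>)"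
proof -
  note mE = injective_module_module[OF E]
  interpret E: module R E by (rule mE)
  let ?n = "free_vars \<phi>" and ?m = "bound_vars \<phi>" and ?K = "length (equations \<phi>)"
  note co = pp_over_coeffs[OF \<phi>]
  have xi: "\<forall>i<?n. x ! i \<in> carrier E" using x by auto
  let ?u = "\<lambda>k. lc E ?n (free_coeff \<phi> k) ((!) x)"
  have u: "\<forall>k<?K. ?u k \<in> carrier E" using E.lc_closed xi co(1) by blast
  have sw: "lc E ?K c ?u = lc E ?n (\<lambda>i. lc (ring_module R) ?K c (\<lambda>k. free_coeff \<phi> k i)) ((!) x)"
    if "\<forall>k<?K. c k \<in> carrier R" for c
    using E.lc_swap[of ?K ?n "free_coeff \<phi>" "(!) x" c] co(1) xi that by blast
  have "x \<in> pp_sol E \<phi> \<longleftrightarrow> solvable E ?m ?K (bound_coeff \<phi>) ?u"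
    using pp_sol_iff_solvable[OF mE \<phi>] x by blast
  also have "\<dots> \<longleftrightarrow> (\<forall>c. (\<forall>k<?K. c k \<in> carrier R) \<longrightarrow>
      (\<forall>j<?m. lc (ring_module R) ?K c (\<lambda>k. bound_coeff \<phi> k j) = \<zero>\<^bsub>R\<^esub>) \<longrightarrow> lc E ?K c ?u = \<zero>\<^bsub>E\<^esub>)"
    using solvable_in_injective[OF E univ _ u] co(2) by blast
  also have "\<dots> \<longleftrightarrow> (\<forall>d\<in>dual_vectors R \<phi>. lc E ?n d ((!) x) = \<zero>\<^bsub>E\<^esub>)"
  proof (intro iffI ballI allI impI)
    fix d assume L: "\<forall>c. (\<forall>k<?K. c k \<in> carrier R) \<longrightarrow>
      (\<forall>j<?m. lc (ring_module R) ?K c (\<lambda>k. bound_coeff \<phi> k j) = \<zero>\<^bsub>R\<^esub>) \<longrightarrow> lc E ?K c ?u = \<zero>\<^bsub>E\<^esub>"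
      and d: "d \<in> dual_vectors R \<phi>"
    obtain c where c: "\<forall>k<?K. c k \<in> carrier R"
      "\<forall>j<?m. lc (ring_module R) ?K c (\<lambda>k. bound_coeff \<phi> k j) = \<zero>\<^bsub>R\<^esub>"
      "\<forall>i<?n. d i = lc (ring_module R) ?K c (\<lambda>k. free_coeff \<phi> k i)"
      using d unfolding dual_vectors_def by blast
    have "lc E ?n d ((!) x) = lc E ?K c ?u"
      unfolding sw[OF c(1)] by (rule lc_cong) (use c(3) in auto)
    then show "lc E ?n d ((!) x) = \<zero>\<^bsub>E\<^esub>" using L c by simp
  next
    fix c assume L: "\<forall>d\<in>dual_vectors R \<phi>. lc E ?n d ((!) x) = \<zero>\<^bsub>E\<^esub>"
      and c: "\<forall>k<?K. c k \<in> carrier R" "\<forall>j<?m. lc (ring_module R) ?K c (\<lambda>k. bound_coeff \<phi> k j) = \<zero>\<^bsub>R\<^esub>"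
    have "(\<lambda>i. lc (ring_module R) ?K c (\<lambda>k. free_coeff \<phi> k i)) \<in> dual_vectors R \<phi>"
      using c unfolding dual_vectors_def by blast
    then show "lc E ?K c ?u = \<zero>\<^bsub>E\<^esub>" using L sw[OF c(1)] by simp
  qed
  finally show ?thesis .
qed

text \<open>
  The ideal \<open>(D\<^sub>\<phi> : d)\<close>.
\<close>

definition residual :: "('a, 'r) ring_scheme \<Rightarrow> 'a pp_formula \<Rightarrow> (nat \<Rightarrow> 'a) \<Rightarrow> 'a set" where
  "residual R \<phi> d = {a \<in> carrier R. (\<lambda>i. a \<otimes>\<^bsub>R\<^esub> d i) \<in> dual_vectors R \<phi>}"

text \<open>
  If \<open>x\<close> is in \<open>\<phi>(E)\<close> but not in \<open>\<psi>(E)\<close>, some \<open>d \<in> D\<^sub>\<psi>\<close> has \<open>d \<cdot> x \<noteq> 0\<close>, and \<open>(D\<^sub>\<phi> : d)\<close> annihilates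
  \<open>d \<cdot> x\<close>. Conversely, if \<open>(D\<^sub>\<phi> : d) \<subseteq> P\<close>, then \<open>r d + u \<mapsto> r e\<close> is well defined on \<open>R d + D\<^sub>\<phi>\<close>; an
  extension to \<open>R\<^sup>n\<close> is the pairing with a tuple \<open>x\<close> killed by \<open>D\<^sub>\<phi>\<close> and with \<open>d \<cdot> x = e\<close>.
\<close>

lemma pp_pair_open_iff:
  fixes R :: "('a, 'r) ring_scheme" and E :: "('a, 'm) module"
  assumes univ: "large_universe R TYPE('m)"
    and E: "injective_module R E" "essential_generator R P E e" and P: "primeideal P R"
    and \<phi>: "pp_over R \<phi>" and \<psi>: "pp_over R \<psi>" and le: "pp_le TYPE('m) R \<psi> \<phi>"
  shows "pp_sol E \<phi> \<noteq> pp_sol E \<psi> \<longleftrightarrow> (\<exists>d\<in>dual_vectors R \<psi>. residual R \<phi> d \<subseteq> P)"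
proof
  note mE = injective_module_module[OF E(1)]
  interpret E: module R E by (rule mE)
  let ?n = "free_vars \<phi>"
  have n: "free_vars \<psi> = ?n" and sub: "pp_sol E \<psi> \<subseteq> pp_sol E \<phi>"
    using le mE by (auto simp: pp_le_def)
  {
    assume "pp_sol E \<phi> \<noteq> pp_sol E \<psi>"
    then obtain x where x: "x \<in> pp_sol E \<phi>" "x \<notin> pp_sol E \<psi>" using sub by blast
    then have lx: "length x = ?n" "set x \<subseteq> carrier E" by (auto simp: pp_sol_def)
    then obtain d where d: "d \<in> dual_vectors R \<psi>" "lc E ?n d ((!) x) \<noteq> \<zero>\<^bsub>E\<^esub>"
      using pp_sol_injective_iff[OF E(1) univ \<psi>, of x] x n by auto
    have dc: "\<forall>i<?n. d i \<in> carrier R"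
      using dual_vectors_closed[OF E.R.cring_axioms \<psi> d(1)] n by simp
    have xc: "\<forall>i<?n. x ! i \<in> carrier E" using lx by auto
    let ?z = "lc E ?n d ((!) x)"
    have "residual R \<phi> d \<subseteq> annihilator R E ?z"
    proof
      fix a assume a: "a \<in> residual R \<phi> d"
      then have "lc E ?n (\<lambda>i. a \<otimes>\<^bsub>R\<^esub> d i) ((!) x) = \<zero>\<^bsub>E\<^esub>"
        using pp_sol_injective_iff[OF E(1) univ \<phi> lx] x(1) by (auto simp: residual_def)
      then show "a \<in> annihilator R E ?z"
        using a E.lc_smult_left[OF _ dc xc] by (auto simp: residual_def annihilator_def)
    qed
    also have "\<dots> \<subseteq> P"
      using annihilator_subset_prime[OF mE E(2) P E.lc_closed[OF dc xc] d(2)] .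
    finally show "\<exists>d\<in>dual_vectors R \<psi>. residual R \<phi> d \<subseteq> P" using d(1) by blast
  next
    assume "\<exists>d\<in>dual_vectors R \<psi>. residual R \<phi> d \<subseteq> P"
    then obtain d where d: "d \<in> dual_vectors R \<psi>" "residual R \<phi> d \<subseteq> P" by blast
    have dc: "\<forall>i<?n. d i \<in> carrier R"
      using dual_vectors_closed[OF E.R.cring_axioms \<psi> d(1)] n by simp
    have e: "e \<in> carrier E" "annihilator R E e = P" using E(2) by (auto simp: essential_generator_def)
    have e0: "e \<noteq> \<zero>\<^bsub>E\<^esub>" using essential_generator_nonzero[OF mE E(2) P] .
    note C = coord_module_module[OF E.R.cring_axioms, of ?n]
    interpret C: module R "coord_module R ?n" by (rule C)
    note dv = dual_vectors_zero[OF E.R.cring_axioms \<phi>] dual_vectors_add[OF E.R.cring_axioms \<phi>]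
      dual_vectors_smult[OF E.R.cring_axioms \<phi>] dual_vectors_closed[OF E.R.cring_axioms \<phi>]
    obtain \<iota> :: "(nat \<Rightarrow> 'a) \<Rightarrow> 'm" where \<iota>: "inj_on \<iota> (carrier (coord_module R ?n))"
      using coord_module_embeds[OF univ] by blast
    define vec where "vec r u = (\<lambda>i. if i < ?n then r \<otimes>\<^bsub>R\<^esub> d i \<oplus>\<^bsub>R\<^esub> u i else \<zero>\<^bsub>R\<^esub>)" for r u
    let ?G = "{(vec r u, r \<odot>\<^bsub>E\<^esub> e) | r u. r \<in> carrier R \<and> u \<in> dual_vectors R \<phi>}"
    have "\<exists>g\<in>mod_hom R (coord_module R ?n) E. \<forall>b f. (b, f) \<in> ?G \<longrightarrow> g b = f"
    proof (rule injective_extends[OF E(1) C \<iota>])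
      show "?G \<subseteq> carrier (coord_module R ?n) \<times> carrier E"
        using e dc dv(4) by (auto simp: vec_def coord_module_simps)
      show "(\<zero>\<^bsub>coord_module R ?n\<^esub>, \<zero>\<^bsub>E\<^esub>) \<in> ?G"
        using dv(1) e dc by (intro CollectI exI[of _ "\<zero>\<^bsub>R\<^esub>"] exI[of _ "\<lambda>_. \<zero>\<^bsub>R\<^esub>"])
          (auto simp: vec_def coord_module_simps)
      show "(b \<oplus>\<^bsub>coord_module R ?n\<^esub> b', f \<oplus>\<^bsub>E\<^esub> f') \<in> ?G" if bf: "(b, f) \<in> ?G" "(b', f') \<in> ?G" for b f b' f'
      proof -
        obtain r u r' u' where h: "r \<in> carrier R" "u \<in> dual_vectors R \<phi>" "b = vec r u" "f = r \<odot>\<^bsub>E\<^esub> e"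
          "r' \<in> carrier R" "u' \<in> dual_vectors R \<phi>" "b' = vec r' u'" "f' = r' \<odot>\<^bsub>E\<^esub> e" using bf by blast
        have "b \<oplus>\<^bsub>coord_module R ?n\<^esub> b' = vec (r \<oplus>\<^bsub>R\<^esub> r') (\<lambda>i. u i \<oplus>\<^bsub>R\<^esub> u' i)"
          using h dc dv(4)[OF h(2)] dv(4)[OF h(6)]
          by (auto simp: vec_def coord_module_simps fun_eq_iff E.R.l_distr E.R.a_ac)
        moreover have "f \<oplus>\<^bsub>E\<^esub> f' = (r \<oplus>\<^bsub>R\<^esub> r') \<odot>\<^bsub>E\<^esub> e" using h e by (simp add: E.smult_l_distr)
        ultimately show ?thesis using dv(2)[OF h(2,6)] h(1,5) by blast
      qed
      show "(s \<odot>\<^bsub>coord_module R ?n\<^esub> b, s \<odot>\<^bsub>E\<^esub> f) \<in> ?G" if s: "s \<in> carrier R" and bf: "(b, f) \<in> ?G" for s b f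
      proof -
        obtain r u where h: "r \<in> carrier R" "u \<in> dual_vectors R \<phi>" "b = vec r u" "f = r \<odot>\<^bsub>E\<^esub> e" using bf by blast
        have "s \<odot>\<^bsub>coord_module R ?n\<^esub> b = vec (s \<otimes>\<^bsub>R\<^esub> r) (\<lambda>i. s \<otimes>\<^bsub>R\<^esub> u i)"
          using h dc dv(4)[OF h(2)] s
          by (auto simp: vec_def coord_module_simps fun_eq_iff E.R.r_distr E.R.m_assoc)
        moreover have "s \<odot>\<^bsub>E\<^esub> f = (s \<otimes>\<^bsub>R\<^esub> r) \<odot>\<^bsub>E\<^esub> e" using h e s by (simp add: E.smult_assoc1)
        ultimately show ?thesis using dv(3)[OF h(2) s] h(1) s E.R.m_closed by blast
      qed
      show "f = \<zero>\<^bsub>E\<^esub>" if f: "(\<zero>\<^bsub>coord_module R ?n\<^esub>, f) \<in> ?G" for f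
      proof -
        obtain r u where h: "r \<in> carrier R" "u \<in> dual_vectors R \<phi>" "vec r u = (\<lambda>_. \<zero>\<^bsub>R\<^esub>)" "f = r \<odot>\<^bsub>E\<^esub> e"
          using f by (auto simp: coord_module_simps)
        have "r \<otimes>\<^bsub>R\<^esub> d i = (\<ominus>\<^bsub>R\<^esub> \<one>\<^bsub>R\<^esub>) \<otimes>\<^bsub>R\<^esub> u i" if i: "i < ?n" for i
        proof -
          have "r \<otimes>\<^bsub>R\<^esub> d i \<oplus>\<^bsub>R\<^esub> u i = \<zero>\<^bsub>R\<^esub>" using fun_cong[OF h(3), of i] i by (simp add: vec_def)
          then have "\<ominus>\<^bsub>R\<^esub> u i = r \<otimes>\<^bsub>R\<^esub> d i"
            using h(1) dc i dv(4)[OF h(2) i] by (intro E.R.minus_equality) auto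
          then show ?thesis using dv(4)[OF h(2) i] by (simp add: E.R.l_minus)
        qed
        then have "(\<lambda>i. r \<otimes>\<^bsub>R\<^esub> d i) \<in> dual_vectors R \<phi>"
          using dual_vectors_cong[OF dv(3)[OF h(2), of "\<ominus>\<^bsub>R\<^esub> \<one>\<^bsub>R\<^esub>"]] by simp
        then have "r \<in> P" using d(2) h(1) by (auto simp: residual_def)
        then show ?thesis using e(2) h(4) unfolding annihilator_def by blast
      qed
    qed
    then obtain g where g: "g \<in> mod_hom R (coord_module R ?n) E" and gG: "\<And>b f. (b, f) \<in> ?G \<Longrightarrow> g b = f"
      by blast
    define x where "x = map (\<lambda>i. g (unit_vector R i)) [0..<?n]"
    have lx: "length x = ?n" "set x \<subseteq> carrier E"
      using mod_hom_closed[OF g] by (auto simp: x_def coord_module_simps unit_vector_def)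
    have val: "lc E ?n v ((!) x) = r \<odot>\<^bsub>E\<^esub> e"
      if "r \<in> carrier R" "u \<in> dual_vectors R \<phi>" "\<And>i. i < ?n \<Longrightarrow> v i = r \<otimes>\<^bsub>R\<^esub> d i \<oplus>\<^bsub>R\<^esub> u i" for r u v
    proof -
      have "lc E ?n v ((!) x) = lc E ?n (vec r u) (\<lambda>i. g (unit_vector R i))"
        by (rule lc_cong) (auto simp: vec_def that x_def)
      also have "\<dots> = g (vec r u)"
        using that dc dv(4)[OF that(2)]
        by (intro coord_module_hom[OF mE g, symmetric]) (auto simp: vec_def coord_module_simps)
      also have "\<dots> = r \<odot>\<^bsub>E\<^esub> e" using that by (intro gG) blast
      finally show ?thesis .
    qed
    have "x \<in> pp_sol E \<phi>"
      unfolding pp_sol_injective_iff[OF E(1) univ \<phi> lx]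
    proof
      fix u assume u: "u \<in> dual_vectors R \<phi>"
      then have "lc E ?n u ((!) x) = \<zero>\<^bsub>R\<^esub> \<odot>\<^bsub>E\<^esub> e"
        using dc dv(4)[OF u] by (intro val[OF _ u]) auto
      then show "lc E ?n u ((!) x) = \<zero>\<^bsub>E\<^esub>" using e by simp
    qed
    moreover have "lc E ?n d ((!) x) = \<one>\<^bsub>R\<^esub> \<odot>\<^bsub>E\<^esub> e"
      using dc by (intro val[OF _ dv(1)]) auto
    then have "x \<notin> pp_sol E \<psi>"
      using pp_sol_injective_iff[OF E(1) univ \<psi>, of x] lx n d(1) e e0 by auto
    ultimately show "pp_sol E \<phi> \<noteq> pp_sol E \<psi>" by blast
  }
qed


section \<open>pp-definable and finitely generated ideals\<close>

text \<open>
  The solution set in \<open>R\<close> of a pp formula in one free variable: those \<open>x\<close> for which the equations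
  \<open>a k \<cdot> x + \<Sum>\<^sub>j B k j \<cdot> y j = 0\<close> have a common solution \<open>y\<close>.
\<close>

definition solution_ideal ::
  "('a, 'r) ring_scheme \<Rightarrow> nat \<Rightarrow> nat \<Rightarrow> (nat \<Rightarrow> 'a) \<Rightarrow> (nat \<Rightarrow> nat \<Rightarrow> 'a) \<Rightarrow> 'a set" where
  "solution_ideal R m K a B =
     {x \<in> carrier R. solvable (ring_module R) m K B (\<lambda>k. a k \<otimes>\<^bsub>R\<^esub> x)}"

lemma (in cring) idealI':
  assumes "I \<subseteq> carrier R" "\<zero> \<in> I" "\<And>x y. x \<in> I \<Longrightarrow> y \<in> I \<Longrightarrow> x \<oplus> y \<in> I"
    and "\<And>r x. r \<in> carrier R \<Longrightarrow> x \<in> I \<Longrightarrow> r \<otimes> x \<in> I"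
  shows "ideal I R"
proof (rule idealI)
  show "ring R" by (rule ring_axioms)
  show "subgroup I (add_monoid R)"
  proof (rule add.subgroupI)
    show "\<ominus> x \<in> I" if "x \<in> I" for x
    proof -
      have "\<ominus> x = (\<ominus> \<one>) \<otimes> x" using that assms(1) by (auto simp: l_minus)
      then show ?thesis using assms(4)[of "\<ominus> \<one>" x] that by simp
    qed
  qed (use assms in auto)
  show "x \<otimes> a \<in> I" "a \<otimes> x \<in> I" if "a \<in> I" "x \<in> carrier R" for a x
    using that assms(1) assms(4)[OF that(2,1)] m_comm[of a x] by auto
qed

lemma (in cring) solution_ideal_ideal:
  assumes a: "\<forall>k<K. a k \<in> carrier R" and B: "\<forall>k<K. \<forall>j<m. B k j \<in> carrier R"
  shows "ideal (solution_ideal R m K a B) R"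
proof -
  interpret RM: module R "ring_module R" by (intro module_ring_module cring_axioms)
  have cl: "lc (ring_module R) m (B k) y \<in> carrier R" if "k < K" "\<forall>j<m. y j \<in> carrier R" for k y
    using RM.lc_closed[of m "B k" y] B that by simp
  show ?thesis
  proof (rule idealI')
    show "solution_ideal R m K a B \<subseteq> carrier R" by (auto simp: solution_ideal_def)
    have "lc (ring_module R) m (B k) (\<lambda>_. \<zero>) = \<zero>" if "k < K" for k
      using RM.lc_zero_right[of m "B k" "\<lambda>_. \<zero>"] B that by simp
    then show "\<zero> \<in> solution_ideal R m K a B"
      using a unfolding solution_ideal_def solvable_def
      by (intro CollectI conjI exI[of _ "\<lambda>_. \<zero>"]) auto
  next
    fix x x' assume "x \<in> solution_ideal R m K a B" "x' \<in> solution_ideal R m K a B"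
    then obtain y y' where x: "x \<in> carrier R" "x' \<in> carrier R"
      and y: "\<forall>j<m. y j \<in> carrier R" "\<forall>j<m. y' j \<in> carrier R"
      and eq: "\<forall>k<K. a k \<otimes> x \<oplus> lc (ring_module R) m (B k) y = \<zero>"
         "\<forall>k<K. a k \<otimes> x' \<oplus> lc (ring_module R) m (B k) y' = \<zero>"
      by (auto simp: solution_ideal_def solvable_def)
    have "a k \<otimes> (x \<oplus> x') \<oplus> lc (ring_module R) m (B k) (\<lambda>j. y j \<oplus> y' j) = \<zero>" if k: "k < K" for k
    proof -
      have "a k \<otimes> (x \<oplus> x') \<oplus> lc (ring_module R) m (B k) (\<lambda>j. y j \<oplus> y' j) =
         (a k \<otimes> x \<oplus> lc (ring_module R) m (B k) y) \<oplus> (a k \<otimes> x' \<oplus> lc (ring_module R) m (B k) y')"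
        using RM.lc_add_right[of m "B k" y y'] B a k x y cl[OF k]
        by (simp add: r_distr a_ac)
      then show ?thesis using eq k by simp
    qed
    then show "x \<oplus> x' \<in> solution_ideal R m K a B"
      using x y unfolding solution_ideal_def solvable_def
      by (intro CollectI conjI exI[of _ "\<lambda>j. y j \<oplus> y' j"]) auto
  next
    fix r x assume r: "r \<in> carrier R" and "x \<in> solution_ideal R m K a B"
    then obtain y where x: "x \<in> carrier R" and y: "\<forall>j<m. y j \<in> carrier R"
      and eq: "\<forall>k<K. a k \<otimes> x \<oplus> lc (ring_module R) m (B k) y = \<zero>"
      by (auto simp: solution_ideal_def solvable_def)
    have "a k \<otimes> (r \<otimes> x) \<oplus> lc (ring_module R) m (B k) (\<lambda>j. r \<otimes> y j) = \<zero>" if k: "k < K" for k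
    proof -
      have "a k \<otimes> (r \<otimes> x) \<oplus> lc (ring_module R) m (B k) (\<lambda>j. r \<otimes> y j) =
         r \<otimes> (a k \<otimes> x \<oplus> lc (ring_module R) m (B k) y)"
        using RM.lc_smult_right[OF r, of m "B k" y] B a k x y r cl[OF k y]
        by (simp add: r_distr m_lcomm)
      then show ?thesis using eq k r by simp
    qed
    then show "r \<otimes> x \<in> solution_ideal R m K a B"
      using x y r unfolding solution_ideal_def solvable_def
      by (intro CollectI conjI exI[of _ "\<lambda>j. r \<otimes> y j"]) auto
  qed
qed

lemma pp_definable_ideal_iff:
  assumes R: "cring R"
  shows "pp_definable_ideal R I \<longleftrightarrow>
    (\<exists>m K a B. (\<forall>k<K. a k \<in> carrier R) \<and> (\<forall>k<K. \<forall>j<m. B k j \<in> carrier R) \<and> I = solution_ideal R m K a B)"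
proof
  interpret R: cring R by fact
  note RM = module_ring_module[OF R]
  {
    assume "pp_definable_ideal R I"
    then obtain \<phi> where \<phi>: "pp_over R \<phi>" "free_vars \<phi> = 1" and I: "I = {a. [a] \<in> pp_sol (ring_module R) \<phi>}"
      by (auto simp: pp_definable_ideal_def)
    note co = pp_over_coeffs[OF \<phi>(1)]
    have "solvable (ring_module R) (bound_vars \<phi>) (length (equations \<phi>)) (bound_coeff \<phi>)
        (\<lambda>k. lc (ring_module R) (free_vars \<phi>) (free_coeff \<phi> k) ((!) [x])) \<longleftrightarrow>
      solvable (ring_module R) (bound_vars \<phi>) (length (equations \<phi>)) (bound_coeff \<phi>)
        (\<lambda>k. free_coeff \<phi> k 0 \<otimes>\<^bsub>R\<^esub> x)" if "x \<in> carrier R" for x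
      using that co(1)[of _ 0] \<phi>(2) by (intro solvable_cong) simp_all
    then have "I = solution_ideal R (bound_vars \<phi>) (length (equations \<phi>)) (\<lambda>k. free_coeff \<phi> k 0) (bound_coeff \<phi>)"
      unfolding I solution_ideal_def using pp_sol_iff_solvable[OF RM \<phi>(1)] \<phi>(2) by auto
    then show "\<exists>m K a B. (\<forall>k<K. a k \<in> carrier R) \<and> (\<forall>k<K. \<forall>j<m. B k j \<in> carrier R) \<and> I = solution_ideal R m K a B"
      using co \<phi>(2) by (intro exI[of _ "bound_vars \<phi>"] exI[of _ "length (equations \<phi>)"]
        exI[of _ "\<lambda>k. free_coeff \<phi> k 0"] exI[of _ "bound_coeff \<phi>"]) auto
  next
    assume "\<exists>m K a B. (\<forall>k<K. a k \<in> carrier R) \<and> (\<forall>k<K. \<forall>j<m. B k j \<in> carrier R) \<and> I = solution_ideal R m K a B"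
    then obtain m K a B where a: "\<forall>k<K. a k \<in> carrier R" and B: "\<forall>k<K. \<forall>j<m. B k j \<in> carrier R"
      and I: "I = solution_ideal R m K a B" by blast
    let ?\<phi> = "matrix_formula 1 m K (\<lambda>k i. a k) B"
    have A: "\<forall>k<K. \<forall>i<1::nat. a k \<in> carrier R" using a by simp
    have "solvable (ring_module R) m K B (\<lambda>k. lc (ring_module R) 1 (\<lambda>i. a k) ((!) [x])) \<longleftrightarrow>
      solvable (ring_module R) m K B (\<lambda>k. a k \<otimes>\<^bsub>R\<^esub> x)" if "x \<in> carrier R" for x
      using that a by (intro solvable_cong) simp_all
    then have "I = {a. [a] \<in> pp_sol (ring_module R) ?\<phi>}"
      unfolding I solution_ideal_def pp_sol_matrix_formula[OF RM A B] by auto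
    then show "pp_definable_ideal R I"
      unfolding pp_definable_ideal_def
      using R.solution_ideal_ideal[OF a B] pp_over_matrix_formula[OF A B] I
      by (intro conjI exI[of _ ?\<phi>]) auto
  }
qed

lemma all_less_add: "(\<forall>k<(m + n :: nat). Q k) \<longleftrightarrow> (\<forall>j<m. Q j) \<and> (\<forall>i<n. Q (m + i))"
proof (intro iffI conjI allI impI)
  fix k assume Q: "(\<forall>j<m. Q j) \<and> (\<forall>i<n. Q (m + i))" and k: "k < m + n"
  show "Q k"
  proof (cases "k < m")
    case False
    then have "k = m + (k - m)" "k - m < n" using k by auto
    then show ?thesis using Q by metis
  qed (use Q in blast)
qed auto

text \<open>
  The condition \<open>x d = c A\<close>, \<open>c B = 0\<close> with unknowns \<open>c\<close> is a linear system in \<open>x\<close> and \<open>c\<close>. Its first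
  equations are the columns of \<open>c B = 0\<close>, the others those of \<open>c A - x d = 0\<close>.
\<close>

lemma pp_definable_residual:
  assumes R: "cring R" and \<phi>: "pp_over R \<phi>" and d: "\<forall>i<free_vars \<phi>. d i \<in> carrier R"
  shows "pp_definable_ideal R (residual R \<phi> d)"
proof -
  interpret R: cring R by fact
  interpret RM: module R "ring_module R" by (intro module_ring_module R)
  let ?n = "free_vars \<phi>" and ?m = "bound_vars \<phi>" and ?K = "length (equations \<phi>)"
  note co = pp_over_coeffs[OF \<phi>]
  define a where "a k = (if k < ?m then \<zero>\<^bsub>R\<^esub> else \<ominus>\<^bsub>R\<^esub> d (k - ?m))" for k
  define B where "B k j = (if k < ?m then bound_coeff \<phi> j k else free_coeff \<phi> j (k - ?m))" for k j
  have ac: "\<forall>k<?m + ?n. a k \<in> carrier R" using d by (auto simp: a_def)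
  have Bc: "\<forall>k<?m + ?n. \<forall>j<?K. B k j \<in> carrier R" using co by (auto simp: B_def)
  have lcc: "lc (ring_module R) ?K (B k) y = lc (ring_module R) ?K y (B k)"
    if "k < ?m + ?n" "\<forall>j<?K. y j \<in> carrier R" for k y
    using that Bc by (intro R.lc_ring_comm) auto
  have "solvable (ring_module R) ?K (?m + ?n) B (\<lambda>k. a k \<otimes>\<^bsub>R\<^esub> x) \<longleftrightarrow>
      (\<lambda>i. x \<otimes>\<^bsub>R\<^esub> d i) \<in> dual_vectors R \<phi>" if x: "x \<in> carrier R" for x
  proof -
    have "(\<forall>k<?m + ?n. a k \<otimes>\<^bsub>R\<^esub> x \<oplus>\<^bsub>R\<^esub> lc (ring_module R) ?K (B k) y = \<zero>\<^bsub>R\<^esub>) \<longleftrightarrow>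
      (\<forall>j<?m. lc (ring_module R) ?K y (\<lambda>k. bound_coeff \<phi> k j) = \<zero>\<^bsub>R\<^esub>) \<and>
      (\<forall>i<?n. x \<otimes>\<^bsub>R\<^esub> d i = lc (ring_module R) ?K y (\<lambda>k. free_coeff \<phi> k i))" (is "?L \<longleftrightarrow> ?M \<and> ?N")
      if y: "\<forall>j<?K. y j \<in> carrier R" for y
    proof -
      have c1: "lc (ring_module R) ?K y (\<lambda>k. bound_coeff \<phi> k j) \<in> carrier R" if "j < ?m" for j
        using RM.lc_closed[of ?K y] y co(2)[OF _ that] by simp
      have c2: "lc (ring_module R) ?K y (\<lambda>k. free_coeff \<phi> k i) \<in> carrier R" if "i < ?n" for i
        using RM.lc_closed[of ?K y] y co(1)[OF _ that] by simp
      have 1: "a j \<otimes>\<^bsub>R\<^esub> x \<oplus>\<^bsub>R\<^esub> lc (ring_module R) ?K (B j) y = lc (ring_module R) ?K y (\<lambda>k. bound_coeff \<phi> k j)"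
        if "j < ?m" for j
        using that lcc[OF _ y, of j] c1[OF that] x by (simp add: a_def B_def[abs_def])
      have 2: "a (?m + i) \<otimes>\<^bsub>R\<^esub> x \<oplus>\<^bsub>R\<^esub> lc (ring_module R) ?K (B (?m + i)) y = \<zero>\<^bsub>R\<^esub> \<longleftrightarrow>
          x \<otimes>\<^bsub>R\<^esub> d i = lc (ring_module R) ?K y (\<lambda>k. free_coeff \<phi> k i)" if i: "i < ?n" for i
      proof -
        have di: "d i \<in> carrier R" using d i by simp
        have "a (?m + i) \<otimes>\<^bsub>R\<^esub> x = \<ominus>\<^bsub>R\<^esub> (x \<otimes>\<^bsub>R\<^esub> d i)" using di x by (simp add: a_def R.l_minus R.r_minus R.m_comm)
        moreover have "lc (ring_module R) ?K (B (?m + i)) y = lc (ring_module R) ?K y (\<lambda>k. free_coeff \<phi> k i)"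
          using lcc[OF _ y, of "?m + i"] i by (simp add: B_def[abs_def])
        ultimately show ?thesis using c2[OF i] di x
          by (metis R.a_inv_closed R.l_neg R.m_closed R.minus_equality R.minus_minus)
      qed
      have "?L \<longleftrightarrow> (\<forall>j<?m. a j \<otimes>\<^bsub>R\<^esub> x \<oplus>\<^bsub>R\<^esub> lc (ring_module R) ?K (B j) y = \<zero>\<^bsub>R\<^esub>) \<and>
          (\<forall>i<?n. a (?m + i) \<otimes>\<^bsub>R\<^esub> x \<oplus>\<^bsub>R\<^esub> lc (ring_module R) ?K (B (?m + i)) y = \<zero>\<^bsub>R\<^esub>)"
        by (rule all_less_add)
      then show ?thesis using 1 2 by simp
    qed
    then show ?thesis unfolding solvable_def dual_vectors_def mem_Collect_eq ring_module_simps by blast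
  qed
  then have "residual R \<phi> d = solution_ideal R ?K (?m + ?n) a B"
    unfolding residual_def solution_ideal_def by blast
  then show ?thesis unfolding pp_definable_ideal_iff[OF R] using ac Bc by blast
qed

text \<open>
  An element \<open>x\<close> is in \<open>I + J\<close> iff \<open>z \<in> I\<close> and \<open>x - z \<in> J\<close> for some \<open>z\<close>. The unknowns of the combined
  system are those for \<open>I\<close>, those for \<open>J\<close>, and \<open>z\<close> in the last position \<open>m + m'\<close>.
\<close>

lemma pp_definable_sum:
  assumes R: "cring R" and I: "pp_definable_ideal R I" "pp_definable_ideal R J"
  shows "pp_definable_ideal R (I <+>\<^bsub>R\<^esub> J)"
proof -
  interpret R: cring R by fact
  interpret RM: module R "ring_module R" by (intro module_ring_module R)
  obtain m K a B where a: "\<forall>k<K. a k \<in> carrier R" and B: "\<forall>k<K. \<forall>j<m. B k j \<in> carrier R"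
    and I: "I = solution_ideal R m K a B" using I(1) unfolding pp_definable_ideal_iff[OF R] by blast
  obtain m' K' a' B' where a': "\<forall>k<K'. a' k \<in> carrier R" and B': "\<forall>k<K'. \<forall>j<m'. B' k j \<in> carrier R"
    and J: "J = solution_ideal R m' K' a' B'" using assms(3) unfolding pp_definable_ideal_iff[OF R] by blast
  define c where "c k = (if k < K then \<zero>\<^bsub>R\<^esub> else a' (k - K))" for k
  define C where "C k j = (if k < K then (if j < m then B k j else if j < m + m' then \<zero>\<^bsub>R\<^esub> else a k)
      else (if j < m then \<zero>\<^bsub>R\<^esub> else if j < m + m' then B' (k - K) (j - m) else \<ominus>\<^bsub>R\<^esub> a' (k - K)))" for k j
  have cc: "\<forall>k<K + K'. c k \<in> carrier R" using a' by (auto simp: c_def)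
  have Cc: "\<forall>k<K + K'. \<forall>j<Suc (m + m'). C k j \<in> carrier R" using a B a' B' by (auto simp: C_def)
  have C1: "lc (ring_module R) (Suc (m + m')) (C k) y = lc (ring_module R) m (B k) y \<oplus>\<^bsub>R\<^esub> a k \<otimes>\<^bsub>R\<^esub> y (m + m')"
    if k: "k < K" and y: "\<forall>j<Suc (m + m'). y j \<in> carrier R" for k y
  proof -
    have "lc (ring_module R) m (C k) y = lc (ring_module R) m (B k) y"
      using k by (intro lc_cong) (auto simp: C_def)
    moreover have "lc (ring_module R) m' (\<lambda>i. C k (m + i)) (\<lambda>i. y (m + i)) = \<zero>\<^bsub>R\<^esub>"
      using RM.lc_zero_left[of m' "\<lambda>i. C k (m + i)"] k y by (simp add: C_def)
    moreover have "lc (ring_module R) m (B k) y \<in> carrier R" using RM.lc_closed[of m "B k" y] B k y by simp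
    moreover have "lc (ring_module R) (m + m') (C k) y = lc (ring_module R) m (C k) y \<oplus>\<^bsub>R\<^esub>
        lc (ring_module R) m' (\<lambda>i. C k (m + i)) (\<lambda>i. y (m + i))"
      using RM.lc_append[of m m' "C k" y] Cc k y by simp
    moreover have "C k (m + m') = a k" using k by (simp add: C_def)
    ultimately show ?thesis by simp
  qed
  have C2: "lc (ring_module R) (Suc (m + m')) (C (K + k)) y =
      lc (ring_module R) m' (B' k) (\<lambda>i. y (m + i)) \<oplus>\<^bsub>R\<^esub> (\<ominus>\<^bsub>R\<^esub> a' k) \<otimes>\<^bsub>R\<^esub> y (m + m')"
    if k: "k < K'" and y: "\<forall>j<Suc (m + m'). y j \<in> carrier R" for k y
  proof -
    have "lc (ring_module R) m (C (K + k)) y = \<zero>\<^bsub>R\<^esub>"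
      using RM.lc_zero_left[of m "C (K + k)"] y by (simp add: C_def)
    moreover have "lc (ring_module R) m' (\<lambda>i. C (K + k) (m + i)) (\<lambda>i. y (m + i)) =
        lc (ring_module R) m' (B' k) (\<lambda>i. y (m + i))"
      by (intro lc_cong) (auto simp: C_def)
    moreover have "lc (ring_module R) m' (B' k) (\<lambda>i. y (m + i)) \<in> carrier R"
      using RM.lc_closed[of m' "B' k" "\<lambda>i. y (m + i)"] B' k y by simp
    moreover have "lc (ring_module R) (m + m') (C (K + k)) y = lc (ring_module R) m (C (K + k)) y \<oplus>\<^bsub>R\<^esub>
        lc (ring_module R) m' (\<lambda>i. C (K + k) (m + i)) (\<lambda>i. y (m + i))"
      using RM.lc_append[of m m' "C (K + k)" y] Cc k y by simp
    moreover have "C (K + k) (m + m') = \<ominus>\<^bsub>R\<^esub> a' k" by (simp add: C_def)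
    ultimately show ?thesis by simp
  qed
  have mem: "x \<in> solution_ideal R (Suc (m + m')) (K + K') c C \<longleftrightarrow>
    (\<exists>u v. u \<in> I \<and> v \<in> J \<and> x = u \<oplus>\<^bsub>R\<^esub> v)" if x: "x \<in> carrier R" for x
  proof
    assume "x \<in> solution_ideal R (Suc (m + m')) (K + K') c C"
    then obtain y where y: "\<forall>j<Suc (m + m'). y j \<in> carrier R"
      and eq: "\<And>k. k < K + K' \<Longrightarrow> c k \<otimes>\<^bsub>R\<^esub> x \<oplus>\<^bsub>R\<^esub> lc (ring_module R) (Suc (m + m')) (C k) y = \<zero>\<^bsub>R\<^esub>"
      unfolding solution_ideal_def solvable_def by auto
    let ?z = "y (m + m')"
    have z: "?z \<in> carrier R" using y by simp
    have "a k \<otimes>\<^bsub>R\<^esub> ?z \<oplus>\<^bsub>R\<^esub> lc (ring_module R) m (B k) y = \<zero>\<^bsub>R\<^esub>" if k: "k < K" for k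
    proof -
      have "lc (ring_module R) m (B k) y \<in> carrier R" using RM.lc_closed[of m "B k" y] B k y by simp
      then show ?thesis using eq[of k] C1[OF k y] a k z x by (simp add: c_def R.a_comm)
    qed
    then have "?z \<in> I" unfolding I solution_ideal_def solvable_def
      using y z by (intro CollectI conjI exI[of _ y]) auto
    moreover have "a' k \<otimes>\<^bsub>R\<^esub> (x \<ominus>\<^bsub>R\<^esub> ?z) \<oplus>\<^bsub>R\<^esub> lc (ring_module R) m' (B' k) (\<lambda>i. y (m + i)) = \<zero>\<^bsub>R\<^esub>" if k: "k < K'" for k
    proof -
      have l: "lc (ring_module R) m' (B' k) (\<lambda>i. y (m + i)) \<in> carrier R"
        using RM.lc_closed[of m' "B' k" "\<lambda>i. y (m + i)"] B' k y by simp
      have ak: "a' k \<in> carrier R" using a' k by simp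
      have "a' k \<otimes>\<^bsub>R\<^esub> (x \<ominus>\<^bsub>R\<^esub> ?z) \<oplus>\<^bsub>R\<^esub> lc (ring_module R) m' (B' k) (\<lambda>i. y (m + i)) =
         a' k \<otimes>\<^bsub>R\<^esub> x \<oplus>\<^bsub>R\<^esub> (lc (ring_module R) m' (B' k) (\<lambda>i. y (m + i)) \<oplus>\<^bsub>R\<^esub> (\<ominus>\<^bsub>R\<^esub> a' k) \<otimes>\<^bsub>R\<^esub> ?z)"
        using l ak x z by (simp add: a_minus_def R.r_distr R.r_minus R.l_minus R.a_ac)
      then show ?thesis using eq[of "K + k"] C2[OF k y] k by (simp add: c_def)
    qed
    then have "x \<ominus>\<^bsub>R\<^esub> ?z \<in> J" unfolding J solution_ideal_def solvable_def
      using y z x by (intro CollectI conjI exI[of _ "\<lambda>i. y (m + i)"]) auto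
    moreover have "x = ?z \<oplus>\<^bsub>R\<^esub> (x \<ominus>\<^bsub>R\<^esub> ?z)"
      using x z by (simp add: a_minus_def R.a_lcomm R.r_neg)
    ultimately show "\<exists>u v. u \<in> I \<and> v \<in> J \<and> x = u \<oplus>\<^bsub>R\<^esub> v" by blast
  next
    assume "\<exists>u v. u \<in> I \<and> v \<in> J \<and> x = u \<oplus>\<^bsub>R\<^esub> v"
    then obtain u v where uv: "u \<in> I" "v \<in> J" "x = u \<oplus>\<^bsub>R\<^esub> v" by blast
    obtain y where u: "u \<in> carrier R" and y: "\<forall>j<m. y j \<in> carrier R"
      and e1: "\<And>k. k < K \<Longrightarrow> a k \<otimes>\<^bsub>R\<^esub> u \<oplus>\<^bsub>R\<^esub> lc (ring_module R) m (B k) y = \<zero>\<^bsub>R\<^esub>"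
      using uv(1) unfolding I solution_ideal_def solvable_def by auto
    obtain y' where v: "v \<in> carrier R" and y': "\<forall>j<m'. y' j \<in> carrier R"
      and e2: "\<And>k. k < K' \<Longrightarrow> a' k \<otimes>\<^bsub>R\<^esub> v \<oplus>\<^bsub>R\<^esub> lc (ring_module R) m' (B' k) y' = \<zero>\<^bsub>R\<^esub>"
      using uv(2) unfolding J solution_ideal_def solvable_def by auto
    define w where "w j = (if j < m then y j else if j < m + m' then y' (j - m) else u)" for j
    have w: "\<forall>j<Suc (m + m'). w j \<in> carrier R" using y y' u by (auto simp: w_def)
    have wu: "w (m + m') = u" by (simp add: w_def)
    have "c k \<otimes>\<^bsub>R\<^esub> x \<oplus>\<^bsub>R\<^esub> lc (ring_module R) (Suc (m + m')) (C k) w = \<zero>\<^bsub>R\<^esub>" if kK: "k < K + K'" for k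
    proof (cases "k < K")
      case True
      have "lc (ring_module R) m (B k) w = lc (ring_module R) m (B k) y"
        by (intro lc_cong) (auto simp: w_def)
      moreover have "lc (ring_module R) m (B k) y \<in> carrier R" using RM.lc_closed[of m "B k" y] B True y by simp
      ultimately show ?thesis using C1[OF True w] e1[OF True] x u a True
        by (simp add: c_def wu R.a_comm)
    next
      case False
      then obtain i where i: "k = K + i" "i < K'" using kK by (intro that[of "k - K"]) auto
      have "lc (ring_module R) m' (B' i) (\<lambda>l. w (m + l)) = lc (ring_module R) m' (B' i) y'"
        by (intro lc_cong) (auto simp: w_def)
      moreover have l: "lc (ring_module R) m' (B' i) y' \<in> carrier R" using RM.lc_closed[of m' "B' i" y'] B' i y' by simp
      moreover have ai: "a' i \<in> carrier R" using a' i by simp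
      moreover have "a' i \<otimes>\<^bsub>R\<^esub> x \<oplus>\<^bsub>R\<^esub> (lc (ring_module R) m' (B' i) y' \<oplus>\<^bsub>R\<^esub> (\<ominus>\<^bsub>R\<^esub> a' i) \<otimes>\<^bsub>R\<^esub> u) =
          (a' i \<otimes>\<^bsub>R\<^esub> v \<oplus>\<^bsub>R\<^esub> lc (ring_module R) m' (B' i) y') \<oplus>\<^bsub>R\<^esub> (a' i \<otimes>\<^bsub>R\<^esub> u \<oplus>\<^bsub>R\<^esub> \<ominus>\<^bsub>R\<^esub> (a' i \<otimes>\<^bsub>R\<^esub> u))"
        using l ai u v uv(3) by (simp add: R.r_distr R.l_minus R.a_ac)
      ultimately show ?thesis using C2[OF i(2) w] e2[OF i(2)] u i by (simp add: c_def wu R.r_neg)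
    qed
    then show "x \<in> solution_ideal R (Suc (m + m')) (K + K') c C"
      unfolding solution_ideal_def solvable_def using x w by (intro CollectI conjI exI[of _ w]) auto
  qed
  have IJ: "I \<subseteq> carrier R" "J \<subseteq> carrier R" by (auto simp: I J solution_ideal_def)
  have S: "solution_ideal R (Suc (m + m')) (K + K') c C \<subseteq> carrier R" by (auto simp: solution_ideal_def)
  have "I <+>\<^bsub>R\<^esub> J = solution_ideal R (Suc (m + m')) (K + K') c C"
  proof (intro equalityI subsetI)
    fix x assume "x \<in> I <+>\<^bsub>R\<^esub> J"
    then obtain u v where uv: "u \<in> I" "v \<in> J" "x = u \<oplus>\<^bsub>R\<^esub> v" by (auto simp: set_add_def')
    then have "x \<in> carrier R" using IJ by auto
    then show "x \<in> solution_ideal R (Suc (m + m')) (K + K') c C" using mem uv by blast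
  next
    fix x assume x: "x \<in> solution_ideal R (Suc (m + m')) (K + K') c C"
    then obtain u v where "u \<in> I" "v \<in> J" "x = u \<oplus>\<^bsub>R\<^esub> v" using mem S by blast
    then show "x \<in> I <+>\<^bsub>R\<^esub> J" by (auto simp: set_add_def')
  qed
  then show ?thesis unfolding pp_definable_ideal_iff[OF R] using cc Cc by blast
qed

lemma (in cring) genideal_eq_combinations:
  assumes s: "\<forall>j<m. s j \<in> carrier R"
  shows "Idl (s ` {..<m::nat}) = {lc (ring_module R) m y s | y. \<forall>j<m. y j \<in> carrier R}" (is "_ = ?C")
proof
  interpret RM: module R "ring_module R" by (intro module_ring_module cring_axioms)
  have s': "s ` {..<m} \<subseteq> carrier R" using s by auto
  note cl = RM.lc_closed[of m _ s, simplified]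
  have "ideal ?C R"
  proof (rule idealI')
    show "?C \<subseteq> carrier R" using cl s by auto
    have "lc (ring_module R) m (\<lambda>_. \<zero>) s = \<zero>" using RM.lc_zero_left[of m "\<lambda>_. \<zero>" s] s by simp
    then show "\<zero> \<in> ?C" by (intro CollectI exI[of _ "\<lambda>_. \<zero>"]) auto
  next
    fix x y assume "x \<in> ?C" "y \<in> ?C"
    then obtain u v where uv: "\<forall>j<m. u j \<in> carrier R" "\<forall>j<m. v j \<in> carrier R"
      "x = lc (ring_module R) m u s" "y = lc (ring_module R) m v s" by blast
    then show "x \<oplus> y \<in> ?C" using RM.lc_add_left[of m u v s] s
      by (intro CollectI exI[of _ "\<lambda>j. u j \<oplus> v j"]) auto
  next
    fix r x assume r: "r \<in> carrier R" and "x \<in> ?C"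
    then obtain u where u: "\<forall>j<m. u j \<in> carrier R" "x = lc (ring_module R) m u s" by blast
    then show "r \<otimes> x \<in> ?C" using RM.lc_smult_left[OF r, of m u s] s r
      by (intro CollectI exI[of _ "\<lambda>j. r \<otimes> u j"]) auto
  qed
  moreover have "s ` {..<m} \<subseteq> ?C"
  proof
    fix x assume "x \<in> s ` {..<m}"
    then obtain i where i: "i < m" "x = s i" by blast
    have "lc (ring_module R) m (\<lambda>j. if j = i then \<one> else \<zero>) s = s i"
      using RM.lc_single[OF i(1), of s] s by simp
    then show "x \<in> ?C" using i(2) by (intro CollectI exI[of _ "\<lambda>j. if j = i then \<one> else \<zero>"]) auto
  qed
  ultimately show "Idl (s ` {..<m}) \<subseteq> ?C" by (rule genideal_minimal)
  interpret I: ideal "Idl (s ` {..<m})" R by (rule genideal_ideal[OF s'])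
  show "?C \<subseteq> Idl (s ` {..<m})"
  proof clarify
    fix y assume y: "\<forall>j<m. y j \<in> carrier R"
    have "lc (ring_module R) k y s \<in> Idl (s ` {..<m})" if "k \<le> m" for k
      using that
    proof (induction k)
      case 0 then show ?case by simp
    next
      case (Suc k)
      then have "s k \<in> Idl (s ` {..<m})" using genideal_self[OF s'] by auto
      then have "y k \<otimes> s k \<in> Idl (s ` {..<m})" using I.I_l_closed y Suc.prems by simp
      then show ?case using Suc by simp
    qed
    then show "lc (ring_module R) m y s \<in> Idl (s ` {..<m})" by simp
  qed
qed

lemma (in cring) fg_ideal_iff:
  "fg_ideal R I \<longleftrightarrow> (\<exists>m s. (\<forall>j<m. s j \<in> carrier R) \<and>
     I = {lc (ring_module R) m y s | y. \<forall>j<m. y j \<in> carrier R})"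
proof
  assume "fg_ideal R I"
  then obtain A where A: "A \<subseteq> carrier R" "finite A" "I = Idl A" by (auto simp: fg_ideal_def)
  obtain m s where "A = s ` {i::nat. i < m}" using finite_imp_nat_seg_image_inj_on[OF A(2)] by blast
  then have s: "A = s ` {..<m}" by (simp add: lessThan_def)
  then have sc: "\<forall>j<m. s j \<in> carrier R" using A(1) by auto
  then show "\<exists>m s. (\<forall>j<m. s j \<in> carrier R) \<and> I = {lc (ring_module R) m y s | y. \<forall>j<m. y j \<in> carrier R}"
    using genideal_eq_combinations[OF sc] A(3) s by blast
next
  assume "\<exists>m s. (\<forall>j<m. s j \<in> carrier R) \<and> I = {lc (ring_module R) m y s | y. \<forall>j<m. y j \<in> carrier R}"
  then obtain m s where s: "\<forall>j<m. s j \<in> carrier R" "I = {lc (ring_module R) m y s | y. \<forall>j<m. y j \<in> carrier R}"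
    by blast
  then show "fg_ideal R I" using genideal_eq_combinations[OF s(1)]
    by (auto simp: fg_ideal_def intro!: exI[of _ "s ` {..<m}"])
qed

lemma fg_ideal_pp_definable:
  assumes R: "cring R" and I: "fg_ideal R I"
  shows "pp_definable_ideal R I"
proof -
  interpret R: cring R by fact
  interpret RM: module R "ring_module R" by (intro module_ring_module R)
  obtain m s where s: "\<forall>j<m. s j \<in> carrier R" "I = {lc (ring_module R) m y s | y. \<forall>j<m. y j \<in> carrier R}"
    using I unfolding R.fg_ideal_iff by blast
  \<comment> \<open>the equation \<open>-x + \<Sum>\<^sub>j s j \<cdot> y j = 0\<close>\<close>
  have "I = solution_ideal R m 1 (\<lambda>_. \<ominus>\<^bsub>R\<^esub> \<one>\<^bsub>R\<^esub>) (\<lambda>_. s)"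
  proof -
    have "((\<ominus>\<^bsub>R\<^esub> \<one>\<^bsub>R\<^esub>) \<otimes>\<^bsub>R\<^esub> x \<oplus>\<^bsub>R\<^esub> lc (ring_module R) m s y = \<zero>\<^bsub>R\<^esub>) = (x = lc (ring_module R) m y s)"
      if xy: "x \<in> carrier R" "\<forall>j<m. y j \<in> carrier R" for x y
    proof -
      have L: "lc (ring_module R) m y s \<in> carrier R" using RM.lc_closed[of m y s] xy s by simp
      have "lc (ring_module R) m s y = lc (ring_module R) m y s"
        using xy s by (intro R.lc_ring_comm) auto
      moreover have "x = l" if "\<ominus>\<^bsub>R\<^esub> x \<oplus>\<^bsub>R\<^esub> l = \<zero>\<^bsub>R\<^esub>" "l \<in> carrier R" for l
        using R.minus_equality[OF that(1)] that(2) xy(1) by (metis R.a_inv_closed R.minus_minus)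
      ultimately show ?thesis using xy L by (auto simp: R.l_minus R.l_neg)
    qed
    then have "solution_ideal R m 1 (\<lambda>_. \<ominus>\<^bsub>R\<^esub> \<one>\<^bsub>R\<^esub>) (\<lambda>_. s) =
        {x \<in> carrier R. \<exists>y. (\<forall>j<m. y j \<in> carrier R) \<and> x = lc (ring_module R) m y s}"
      unfolding solution_ideal_def solvable_def by auto
    moreover have "lc (ring_module R) m y s \<in> carrier R" if "\<forall>j<m. y j \<in> carrier R" for y
      using RM.lc_closed[of m y s] that s by simp
    ultimately show ?thesis unfolding s(2) by auto
  qed
  then show ?thesis unfolding pp_definable_ideal_iff[OF R] using s(1)
    by (intro exI[of _ m] exI[of _ 1] exI[of _ "\<lambda>_. \<ominus>\<^bsub>R\<^esub> \<one>\<^bsub>R\<^esub>"] exI[of _ "\<lambda>_. s"]) auto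
qed


section \<open>pp-definable ideals of coherent rings\<close>

text \<open>
  Finite generation of the submodule of \<open>R\<^sup>n\<close> that consists of the first \<open>n\<close> entries of the vectors in
  \<open>S\<close>, which is the solution set of a homogeneous linear system in all uses. The generators are
  \<open>U 0, \<dots>, U (p - 1)\<close>.
\<close>

definition fg_vectors :: "('a, 'r) ring_scheme \<Rightarrow> nat \<Rightarrow> (nat \<Rightarrow> 'a) set \<Rightarrow> bool" where
  "fg_vectors R n S \<longleftrightarrow> (\<exists>p U. (\<forall>q<p. (\<forall>i<n. U q i \<in> carrier R) \<and> U q \<in> S) \<and>
     (\<forall>x\<in>S. (\<forall>i<n. x i \<in> carrier R) \<longrightarrow>
        (\<exists>z. (\<forall>q<p. z q \<in> carrier R) \<and> (\<forall>i<n. x i = lc (ring_module R) p z (\<lambda>q. U q i)))))"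

lemma fg_vectorsE:
  assumes "fg_vectors R n S"
  obtains p U where "\<forall>q<p. \<forall>i<n. U q i \<in> carrier R" "\<forall>q<p. U q \<in> S"
    and "\<And>x. x \<in> S \<Longrightarrow> \<forall>i<n. x i \<in> carrier R \<Longrightarrow>
      \<exists>z. (\<forall>q<p. z q \<in> carrier R) \<and> (\<forall>i<n. x i = lc (ring_module R) p z (\<lambda>q. U q i))"
proof -
  obtain p U where *: "(\<forall>q<p. (\<forall>i<n. U q i \<in> carrier R) \<and> U q \<in> S) \<and>
     (\<forall>x\<in>S. (\<forall>i<n. x i \<in> carrier R) \<longrightarrow>
        (\<exists>z. (\<forall>q<p. z q \<in> carrier R) \<and> (\<forall>i<n. x i = lc (ring_module R) p z (\<lambda>q. U q i))))"
    using assms unfolding fg_vectors_def by (elim exE)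
  show thesis by (rule that[of p U]) (use * in blast)+
qed

text \<open>
  Two finite families \<open>a\<close> and \<open>b\<close> generate the same ideal, with \<open>a = u b\<close> and \<open>b = v a\<close>. If the
  relations of \<open>b\<close> are generated by the \<open>Y q\<close>, those of \<open>a\<close> are generated by the \<open>(Y q) v\<close> and the
  rows of \<open>1 - u v\<close>: a relation \<open>x\<close> of \<open>a\<close> is the sum of \<open>x (1 - u v)\<close> and \<open>(x u) v\<close>, where \<open>x u\<close>
  is a relation of \<open>b\<close>.
\<close>

lemma fg_relations_change_generators:
  assumes R: "cring R"
    and a: "\<forall>i<n. a i \<in> carrier R" and b: "\<forall>j<m. b j \<in> carrier R"
    and u: "\<forall>i<n. \<forall>j<m. u i j \<in> carrier R" "\<forall>i<n. a i = lc (ring_module R) m (u i) b"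
    and v: "\<forall>j<m. \<forall>i<n. v j i \<in> carrier R" "\<forall>j<m. b j = lc (ring_module R) n (v j) a"
    and fg: "fg_vectors R m {y. lc (ring_module R) m y b = \<zero>\<^bsub>R\<^esub>}"
  shows "fg_vectors R n {x. lc (ring_module R) n x a = \<zero>\<^bsub>R\<^esub>}"
proof -
  interpret R: cring R by fact
  interpret RM: module R "ring_module R" by (intro module_ring_module R)
  let ?lc = "lc (ring_module R)"
  note cl = RM.lc_closed[simplified]
  obtain p Y where Y: "\<forall>q<p. \<forall>j<m. Y q j \<in> carrier R"
    and Y0: "\<forall>q<p. Y q \<in> {y. ?lc m y b = \<zero>\<^bsub>R\<^esub>}"
    and gen: "\<And>y. y \<in> {y. ?lc m y b = \<zero>\<^bsub>R\<^esub>} \<Longrightarrow> \<forall>j<m. y j \<in> carrier R \<Longrightarrow>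
      \<exists>z. (\<forall>q<p. z q \<in> carrier R) \<and> (\<forall>j<m. y j = ?lc p z (\<lambda>q. Y q j))"
    by (rule fg_vectorsE[OF fg]) (rule that; assumption)
  note Y = Y Y0[unfolded mem_Collect_eq]
  define W where "W w l = ?lc m w (\<lambda>j. v j l)" for w l
  have Wc: "W w l \<in> carrier R" if "\<forall>j<m. w j \<in> carrier R" "l < n" for w l
    unfolding W_def using that v by (intro cl) auto
  have Wa: "?lc n (W w) a = ?lc m w b" if w: "\<forall>j<m. w j \<in> carrier R" for w
  proof -
    have "?lc m w (\<lambda>j. ?lc n (v j) a) = ?lc n (\<lambda>l. ?lc m w (\<lambda>j. v j l)) a"
      using RM.lc_swap[of m n v a w] v(1) a w by simp
    moreover have "?lc m w (\<lambda>j. ?lc n (v j) a) = ?lc m w b" by (rule lc_cong) (use v(2) in auto)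
    ultimately show ?thesis by (simp add: W_def[abs_def])
  qed
  define N where "N i l = unit_vector R i l \<oplus>\<^bsub>R\<^esub> (\<ominus>\<^bsub>R\<^esub> \<one>\<^bsub>R\<^esub>) \<otimes>\<^bsub>R\<^esub> W (u i) l" for i l
  have uv: "unit_vector R i l \<in> carrier R" for i l by (simp add: unit_vector_def)
  have Nc: "N i l \<in> carrier R" if "i < n" "l < n" for i l
    unfolding N_def using uv Wc[of "u i" l] u(1) that by auto
  have Na: "?lc n (N i) a = \<zero>\<^bsub>R\<^esub>" if i: "i < n" for i
  proof -
    have w: "\<forall>l<n. W (u i) l \<in> carrier R" using Wc u(1) i by blast
    have "?lc n (N i) a = ?lc n (unit_vector R i) a \<oplus>\<^bsub>R\<^esub> ?lc n (\<lambda>l. (\<ominus>\<^bsub>R\<^esub> \<one>\<^bsub>R\<^esub>) \<otimes>\<^bsub>R\<^esub> W (u i) l) a"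
      unfolding N_def[abs_def] using RM.lc_add_left[of n "unit_vector R i" "\<lambda>l. (\<ominus>\<^bsub>R\<^esub> \<one>\<^bsub>R\<^esub>) \<otimes>\<^bsub>R\<^esub> W (u i) l" a] uv w a
      by simp
    also have "?lc n (unit_vector R i) a = a i"
      using RM.lc_single[OF i, of a] a by (simp add: unit_vector_def)
    also have "?lc n (\<lambda>l. (\<ominus>\<^bsub>R\<^esub> \<one>\<^bsub>R\<^esub>) \<otimes>\<^bsub>R\<^esub> W (u i) l) a = (\<ominus>\<^bsub>R\<^esub> \<one>\<^bsub>R\<^esub>) \<otimes>\<^bsub>R\<^esub> ?lc n (W (u i)) a"
      using RM.lc_smult_left[of "\<ominus>\<^bsub>R\<^esub> \<one>\<^bsub>R\<^esub>" n "W (u i)" a] w a by simp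
    also have "?lc n (W (u i)) a = a i" using Wa[of "u i"] u i by simp
    finally show ?thesis using a i by (simp add: R.l_minus R.r_neg)
  qed
  define U where "U q = (if q < p then W (Y q) else N (q - p))" for q
  show ?thesis
    unfolding fg_vectors_def
  proof (intro exI[of _ "p + n"] exI[of _ U] conjI allI impI ballI)
    fix q assume q: "q < p + n"
    show "U q l \<in> carrier R" if "l < n" for l
      using that q Wc Y(1) Nc by (auto simp: U_def)
    show "U q \<in> {x. ?lc n x a = \<zero>\<^bsub>R\<^esub>}"
      using q Wa[of "Y q"] Y Na by (auto simp: U_def)
  next
    fix x assume "x \<in> {x. ?lc n x a = \<zero>\<^bsub>R\<^esub>}" and x: "\<forall>i<n. x i \<in> carrier R"
    then have xa: "?lc n x a = \<zero>\<^bsub>R\<^esub>" by simp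
    define w where "w j = ?lc n x (\<lambda>i. u i j)" for j
    have wc: "\<forall>j<m. w j \<in> carrier R" unfolding w_def using x u by (auto intro!: cl)
    have "?lc m w b = ?lc n x (\<lambda>i. ?lc m (u i) b)"
      using RM.lc_swap[of n m u b x] u(1) b x by (simp add: w_def[abs_def])
    also have "\<dots> = ?lc n x a" by (rule lc_cong) (use u(2) in auto)
    finally obtain z where z: "\<forall>q<p. z q \<in> carrier R" "\<forall>j<m. w j = ?lc p z (\<lambda>q. Y q j)"
      using gen[of w] xa wc by auto
    define Z where "Z q = (if q < p then z q else x (q - p))" for q
    show "\<exists>Z. (\<forall>q<p + n. Z q \<in> carrier R) \<and> (\<forall>l<n. x l = ?lc (p + n) Z (\<lambda>q. U q l))"
    proof (intro exI[of _ Z] conjI allI impI)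
      show Zc: "Z q \<in> carrier R" if "q < p + n" for q using that z x by (auto simp: Z_def)
      fix l assume l: "l < n"
      have Uc: "\<forall>q<p + n. U q l \<in> carrier R" using l Wc Y(1) Nc by (auto simp: U_def)
      have wl: "W w l \<in> carrier R" using Wc[OF wc l] .
      have "?lc (p + n) Z (\<lambda>q. U q l) = ?lc p Z (\<lambda>q. U q l) \<oplus>\<^bsub>R\<^esub> ?lc n (\<lambda>i. Z (p + i)) (\<lambda>i. U (p + i) l)"
        using RM.lc_append[of p n Z "\<lambda>q. U q l"] Zc Uc by simp
      also have "?lc p Z (\<lambda>q. U q l) = ?lc p z (\<lambda>q. ?lc m (Y q) (\<lambda>j. v j l))"
        by (rule lc_cong) (auto simp: Z_def U_def W_def)
      also have "\<dots> = ?lc m (\<lambda>j. ?lc p z (\<lambda>q. Y q j)) (\<lambda>j. v j l)"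
        using RM.lc_swap[of p m Y "\<lambda>j. v j l" z] Y(1) v(1) z(1) l by simp
      also have "\<dots> = W w l" unfolding W_def by (rule lc_cong) (use z(2) in auto)
      also have "?lc n (\<lambda>i. Z (p + i)) (\<lambda>i. U (p + i) l) = ?lc n x (\<lambda>i. N i l)"
        by (rule lc_cong) (auto simp: Z_def U_def)
      also have "\<dots> = ?lc n x (\<lambda>i. unit_vector R i l) \<oplus>\<^bsub>R\<^esub> ?lc n x (\<lambda>i. (\<ominus>\<^bsub>R\<^esub> \<one>\<^bsub>R\<^esub>) \<otimes>\<^bsub>R\<^esub> W (u i) l)"
        unfolding N_def
        using RM.lc_add_right[of n x "\<lambda>i. unit_vector R i l" "\<lambda>i. (\<ominus>\<^bsub>R\<^esub> \<one>\<^bsub>R\<^esub>) \<otimes>\<^bsub>R\<^esub> W (u i) l"] uv x Wc u(1) l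
        by simp
      also have "?lc n x (\<lambda>i. unit_vector R i l) = x l"
      proof -
        have "(\<lambda>i. unit_vector R i l) = (\<lambda>i. if i = l then \<one>\<^bsub>R\<^esub> else \<zero>\<^bsub>R\<^esub>)" by (auto simp: unit_vector_def)
        then show ?thesis using R.lc_single_right[OF l x] by simp
      qed
      also have "?lc n x (\<lambda>i. (\<ominus>\<^bsub>R\<^esub> \<one>\<^bsub>R\<^esub>) \<otimes>\<^bsub>R\<^esub> W (u i) l) = (\<ominus>\<^bsub>R\<^esub> \<one>\<^bsub>R\<^esub>) \<otimes>\<^bsub>R\<^esub> ?lc n x (\<lambda>i. W (u i) l)"
        using RM.lc_smult_right[of "\<ominus>\<^bsub>R\<^esub> \<one>\<^bsub>R\<^esub>" n x "\<lambda>i. W (u i) l"] x Wc u(1) l by simp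
      also have "?lc n x (\<lambda>i. W (u i) l) = W w l"
        unfolding W_def w_def using RM.lc_swap[of n m u "\<lambda>j. v j l" x] u(1) v(1) x l by simp
      finally show "x l = ?lc (p + n) Z (\<lambda>q. U q l)"
        using wl x l by (simp add: R.l_minus R.a_lcomm R.r_neg)
    qed
  qed
qed

lemma free_module_simps:
  "xs \<in> carrier (free_module R n) \<longleftrightarrow> length xs = n \<and> set xs \<subseteq> carrier R"
  "\<zero>\<^bsub>free_module R n\<^esub> = replicate n \<zero>\<^bsub>R\<^esub>"
  "xs \<oplus>\<^bsub>free_module R n\<^esub> ys = map2 (add R) xs ys"
  "r \<odot>\<^bsub>free_module R n\<^esub> xs = map (\<lambda>x. r \<otimes>\<^bsub>R\<^esub> x) xs"
  by (simp_all add: free_module_def)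

lemma free_module_module:
  assumes "cring R" shows "module R (free_module R n)"
proof -
  interpret R: cring R by fact
  have c: "length xs = n \<and> (\<forall>i<n. xs ! i \<in> carrier R)" if "xs \<in> carrier (free_module R n)" for xs
    using that by (auto simp: free_module_simps)
  have cI: "xs \<in> carrier (free_module R n)" if "length xs = n" "\<forall>i<n. xs ! i \<in> carrier R" for xs
    using that by (auto simp: free_module_simps in_set_conv_nth)
  show ?thesis
  proof (rule moduleI)
    show "abelian_group (free_module R n)"
    proof (rule abelian_groupI)
      fix x assume x: "x \<in> carrier (free_module R n)"
      show "\<exists>y\<in>carrier (free_module R n). y \<oplus>\<^bsub>free_module R n\<^esub> x = \<zero>\<^bsub>free_module R n\<^esub>"
        using c[OF x] by (intro bexI[of _ "map (\<lambda>t. \<ominus>\<^bsub>R\<^esub> t) x"] cI nth_equalityI)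
          (auto simp: free_module_simps(2-) R.l_neg)
      show "\<zero>\<^bsub>free_module R n\<^esub> \<oplus>\<^bsub>free_module R n\<^esub> x = x"
        using c[OF x] by (intro nth_equalityI) (auto simp: free_module_simps(2-))
      fix y assume y: "y \<in> carrier (free_module R n)"
      show "x \<oplus>\<^bsub>free_module R n\<^esub> y \<in> carrier (free_module R n)"
        using c[OF x] c[OF y] by (intro cI) (auto simp: free_module_simps(2-))
      show "x \<oplus>\<^bsub>free_module R n\<^esub> y = y \<oplus>\<^bsub>free_module R n\<^esub> x"
        using c[OF x] c[OF y] by (intro nth_equalityI) (auto simp: free_module_simps(2-) R.a_comm)
      fix z assume z: "z \<in> carrier (free_module R n)"
      show "x \<oplus>\<^bsub>free_module R n\<^esub> y \<oplus>\<^bsub>free_module R n\<^esub> z = x \<oplus>\<^bsub>free_module R n\<^esub> (y \<oplus>\<^bsub>free_module R n\<^esub> z)"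
        using c[OF x] c[OF y] c[OF z] by (intro nth_equalityI) (auto simp: free_module_simps(2-) R.a_assoc)
    next
      show "\<zero>\<^bsub>free_module R n\<^esub> \<in> carrier (free_module R n)"
        by (intro cI) (auto simp: free_module_simps(2-))
    qed
    fix a x assume a: "a \<in> carrier R" and x: "x \<in> carrier (free_module R n)"
    show "a \<odot>\<^bsub>free_module R n\<^esub> x \<in> carrier (free_module R n)"
      using c[OF x] a by (intro cI) (auto simp: free_module_simps(2-))
    show "(a \<oplus>\<^bsub>R\<^esub> b) \<odot>\<^bsub>free_module R n\<^esub> x = a \<odot>\<^bsub>free_module R n\<^esub> x \<oplus>\<^bsub>free_module R n\<^esub> b \<odot>\<^bsub>free_module R n\<^esub> x"
      if "b \<in> carrier R" for b
      using c[OF x] a that by (intro nth_equalityI) (auto simp: free_module_simps(2-) R.l_distr)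
    show "(a \<otimes>\<^bsub>R\<^esub> b) \<odot>\<^bsub>free_module R n\<^esub> x = a \<odot>\<^bsub>free_module R n\<^esub> (b \<odot>\<^bsub>free_module R n\<^esub> x)"
      if "b \<in> carrier R" for b
      using c[OF x] a that by (intro nth_equalityI) (auto simp: free_module_simps(2-) R.m_assoc)
    show "a \<odot>\<^bsub>free_module R n\<^esub> (x \<oplus>\<^bsub>free_module R n\<^esub> y) =
        a \<odot>\<^bsub>free_module R n\<^esub> x \<oplus>\<^bsub>free_module R n\<^esub> a \<odot>\<^bsub>free_module R n\<^esub> y"
      if "y \<in> carrier (free_module R n)" for y
      using c[OF x] c[OF that] a by (intro nth_equalityI) (auto simp: free_module_simps(2-) R.r_distr)
  next
    fix x assume x: "x \<in> carrier (free_module R n)"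
    show "\<one>\<^bsub>R\<^esub> \<odot>\<^bsub>free_module R n\<^esub> x = x"
      using c[OF x] by (intro nth_equalityI) (auto simp: free_module_simps(2-))
  qed (rule assms)
qed

lemma finitely_presented_ideal_relations:
  assumes R: "cring R" and fp: "finitely_presented R ((ring_module R)\<lparr>carrier := I\<rparr>)" and I: "I \<subseteq> carrier R"
  shows "\<exists>m b. (\<forall>j<m. b j \<in> carrier R) \<and>
    I = {lc (ring_module R) m y b | y. \<forall>j<m. y j \<in> carrier R} \<and>
    fg_vectors R m {y. lc (ring_module R) m y b = \<zero>\<^bsub>R\<^esub>}"
proof -
  interpret R: cring R by fact
  note mRM = module_ring_module[OF R]
  interpret RM: module R "ring_module R" by (rule mRM)
  let ?lc = "lc (ring_module R)"
  let ?N = "(ring_module R)\<lparr>carrier := I\<rparr>"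
  obtain m f A where f: "f \<in> mod_hom R (free_module R m) ?N"
    and surj: "f ` carrier (free_module R m) = carrier ?N"
    and A: "finite A" "A \<subseteq> carrier (free_module R m)"
    and ker: "{x \<in> carrier (free_module R m). f x = \<zero>\<^bsub>?N\<^esub>} = submodule_span R (free_module R m) A"
    using fp unfolding finitely_presented_def by blast
  interpret F: module R "free_module R m" by (rule free_module_module[OF R])
  have mc: "map y [0..<m] \<in> carrier (free_module R m)" if "\<forall>j<m. y j \<in> carrier R" for y
    using that by (auto simp: free_module_simps)
  define g where "g h = f (map h [0..<m])" for h
  have g: "g \<in> mod_hom R (coord_module R m) (ring_module R)"
  proof (rule mod_homI)
    fix x assume x: "x \<in> carrier (coord_module R m)"
    have xm: "map x [0..<m] \<in> carrier (free_module R m)" using x by (intro mc) (simp add: coord_module_simps)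
    show "g x \<in> carrier (ring_module R)" using mod_hom_closed[OF f xm] I by (auto simp: g_def)
    show "g (x \<oplus>\<^bsub>coord_module R m\<^esub> y) = g x \<oplus>\<^bsub>ring_module R\<^esub> g y" if y: "y \<in> carrier (coord_module R m)" for y
    proof -
      have ym: "map y [0..<m] \<in> carrier (free_module R m)" using y by (intro mc) (simp add: coord_module_simps)
      have "map (x \<oplus>\<^bsub>coord_module R m\<^esub> y) [0..<m] = map x [0..<m] \<oplus>\<^bsub>free_module R m\<^esub> map y [0..<m]"
        by (intro nth_equalityI) (auto simp: coord_module_simps free_module_simps)
      then show ?thesis using mod_hom_add[OF f xm ym] by (simp add: g_def)
    qed
    show "g (r \<odot>\<^bsub>coord_module R m\<^esub> x) = r \<odot>\<^bsub>ring_module R\<^esub> g x" if r: "r \<in> carrier R" for r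
    proof -
      have "map (r \<odot>\<^bsub>coord_module R m\<^esub> x) [0..<m] = r \<odot>\<^bsub>free_module R m\<^esub> map x [0..<m]"
        by (intro nth_equalityI) (auto simp: coord_module_simps free_module_simps)
      then show ?thesis using mod_hom_smult[OF f r xm] by (simp add: g_def)
    qed
  qed
  define b where "b j = g (unit_vector R j)" for j
  have bc: "\<forall>j<m. b j \<in> carrier R"
    using mod_hom_closed[OF g] by (auto simp: b_def coord_module_simps unit_vector_def)
  have fb: "f (map y [0..<m]) = ?lc m y b" if y: "\<forall>j<m. y j \<in> carrier R" for y
  proof -
    let ?y = "\<lambda>j. if j < m then y j else \<zero>\<^bsub>R\<^esub>"
    have "f (map y [0..<m]) = g ?y" unfolding g_def by (rule arg_cong[where f = f]) simp
    also have "\<dots> = ?lc m ?y (\<lambda>j. g (unit_vector R j))"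
      using y by (intro coord_module_hom[OF mRM g]) (auto simp: coord_module_simps)
    also have "\<dots> = ?lc m y b" by (rule lc_cong) (auto simp: b_def)
    finally show ?thesis .
  qed
  have vec: "\<exists>y. xs = map y [0..<m] \<and> (\<forall>j<m. y j \<in> carrier R)" if "xs \<in> carrier (free_module R m)" for xs
    using that by (intro exI[of _ "(!) xs"]) (auto simp: free_module_simps subset_iff intro: nth_equalityI)
  have Ieq: "I = {?lc m y b | y. \<forall>j<m. y j \<in> carrier R}"
  proof (intro equalityI subsetI)
    fix x assume "x \<in> I"
    then obtain xs where "xs \<in> carrier (free_module R m)" "x = f xs" using surj by auto
    then show "x \<in> {?lc m y b | y. \<forall>j<m. y j \<in> carrier R}" using vec fb by blast
  next
    fix x assume "x \<in> {?lc m y b | y. \<forall>j<m. y j \<in> carrier R}"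
    then obtain y where "\<forall>j<m. y j \<in> carrier R" "x = f (map y [0..<m])" using fb by auto
    then show "x \<in> I" using mod_hom_closed[OF f mc] by simp
  qed
  obtain p Y where Y: "A = Y ` {q::nat. q < p}" using finite_imp_nat_seg_image_inj_on[OF A(1)] by blast
  have Yc: "Y q \<in> carrier (free_module R m)" if "q < p" for q using that A(2) Y by blast
  let ?H = "{map (\<lambda>j. ?lc p z (\<lambda>q. Y q ! j)) [0..<m] | z. \<forall>q<p. z q \<in> carrier R}"
  have Yj: "\<forall>q<p. Y q ! j \<in> carrier R" if "j < m" for j
    using Yc that by (auto simp: free_module_simps subset_iff)
  have "submodule ?H R (free_module R m)"
  proof (rule F.submoduleI')
    show "?H \<subseteq> carrier (free_module R m)"
      using RM.lc_closed[of p] Yj by (auto intro!: mc)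
    have "?lc p (\<lambda>_. \<zero>\<^bsub>R\<^esub>) (\<lambda>q. Y q ! j) = \<zero>\<^bsub>R\<^esub>" if "j < m" for j
      using RM.lc_zero_left[of p "\<lambda>_. \<zero>\<^bsub>R\<^esub>"] Yj[OF that] by simp
    then show "\<zero>\<^bsub>free_module R m\<^esub> \<in> ?H"
      by (intro CollectI exI[of _ "\<lambda>_. \<zero>\<^bsub>R\<^esub>"]) (auto simp: free_module_simps intro!: nth_equalityI)
  next
    fix xs ys assume "xs \<in> ?H" "ys \<in> ?H"
    then obtain z t where z: "\<forall>q<p. z q \<in> carrier R" "xs = map (\<lambda>j. ?lc p z (\<lambda>q. Y q ! j)) [0..<m]"
      and t: "\<forall>q<p. t q \<in> carrier R" "ys = map (\<lambda>j. ?lc p t (\<lambda>q. Y q ! j)) [0..<m]" by blast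
    have "?lc p (\<lambda>q. z q \<oplus>\<^bsub>R\<^esub> t q) (\<lambda>q. Y q ! j) = ?lc p z (\<lambda>q. Y q ! j) \<oplus>\<^bsub>R\<^esub> ?lc p t (\<lambda>q. Y q ! j)"
      if "j < m" for j
      using RM.lc_add_left[OF z(1) t(1)] Yj[OF that] by simp
    then show "xs \<oplus>\<^bsub>free_module R m\<^esub> ys \<in> ?H"
      using z t by (intro CollectI exI[of _ "\<lambda>q. z q \<oplus>\<^bsub>R\<^esub> t q"])
        (auto simp: free_module_simps intro!: nth_equalityI)
  next
    fix r xs assume r: "r \<in> carrier R" and "xs \<in> ?H"
    then obtain z where z: "\<forall>q<p. z q \<in> carrier R" "xs = map (\<lambda>j. ?lc p z (\<lambda>q. Y q ! j)) [0..<m]" by blast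
    have "?lc p (\<lambda>q. r \<otimes>\<^bsub>R\<^esub> z q) (\<lambda>q. Y q ! j) = r \<otimes>\<^bsub>R\<^esub> ?lc p z (\<lambda>q. Y q ! j)" if "j < m" for j
      using RM.lc_smult_left[OF r z(1)] Yj[OF that] by simp
    then show "r \<odot>\<^bsub>free_module R m\<^esub> xs \<in> ?H"
      using z r by (intro CollectI exI[of _ "\<lambda>q. r \<otimes>\<^bsub>R\<^esub> z q"])
        (auto simp: free_module_simps intro!: nth_equalityI)
  qed
  moreover have "A \<subseteq> ?H"
  proof
    fix xs assume "xs \<in> A"
    then obtain q where q: "q < p" "xs = Y q" using Y by blast
    have "?lc p (\<lambda>l. if l = q then \<one>\<^bsub>R\<^esub> else \<zero>\<^bsub>R\<^esub>) (\<lambda>q. Y q ! j) = Y q ! j" if "j < m" for j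
      using RM.lc_single[OF q(1), of "\<lambda>q. Y q ! j"] Yj[OF that] by simp
    then show "xs \<in> ?H" using q Yc[OF q(1)]
      by (intro CollectI exI[of _ "\<lambda>l. if l = q then \<one>\<^bsub>R\<^esub> else \<zero>\<^bsub>R\<^esub>"])
        (auto simp: free_module_simps intro!: nth_equalityI)
  qed
  ultimately have span: "submodule_span R (free_module R m) A \<subseteq> ?H"
    unfolding submodule_span_def by blast
  have "fg_vectors R m {y. ?lc m y b = \<zero>\<^bsub>R\<^esub>}"
    unfolding fg_vectors_def
  proof (intro exI[of _ p] exI[of _ "\<lambda>q j. Y q ! j"] conjI allI impI ballI)
    fix q assume q: "q < p"
    show "Y q ! j \<in> carrier R" if "j < m" for j using Yj[OF that] q by simp
    have "Y q \<in> submodule_span R (free_module R m) A"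
      unfolding submodule_span_def using Y q by blast
    then have "f (Y q) = \<zero>\<^bsub>R\<^esub>" using ker by auto
    moreover have "map (\<lambda>j. Y q ! j) [0..<m] = Y q"
      using Yc[OF q] by (auto simp: free_module_simps intro: nth_equalityI)
    ultimately show "(\<lambda>j. Y q ! j) \<in> {y. ?lc m y b = \<zero>\<^bsub>R\<^esub>}"
      using fb[of "\<lambda>j. Y q ! j"] Yj q by simp
  next
    fix y assume y: "y \<in> {y. ?lc m y b = \<zero>\<^bsub>R\<^esub>}" "\<forall>j<m. y j \<in> carrier R"
    then have "map y [0..<m] \<in> {x \<in> carrier (free_module R m). f x = \<zero>\<^bsub>?N\<^esub>}"
      using fb mc by simp
    then obtain z where z: "\<forall>q<p. z q \<in> carrier R" "map y [0..<m] = map (\<lambda>j. ?lc p z (\<lambda>q. Y q ! j)) [0..<m]"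
      using span ker by blast
    then show "\<exists>z. (\<forall>q<p. z q \<in> carrier R) \<and> (\<forall>j<m. y j = ?lc p z (\<lambda>q. Y q ! j))"
      by (intro exI[of _ z]) auto
  qed
  then show ?thesis using bc Ieq by blast
qed

lemma coherent_relations:
  assumes coh: "coherent_ring R" and a: "\<forall>i<n. a i \<in> carrier R"
  shows "fg_vectors R n {x. lc (ring_module R) n x a = \<zero>\<^bsub>R\<^esub>}"
proof -
  have R: "cring R" using coh by (simp add: coherent_ring_def)
  interpret R: cring R by fact
  interpret RM: module R "ring_module R" by (intro module_ring_module R)
  let ?lc = "lc (ring_module R)"
  define I where "I = {?lc n y a | y. \<forall>i<n. y i \<in> carrier R}"
  have "fg_ideal R I" unfolding R.fg_ideal_iff I_def using a by blast
  then have fp: "finitely_presented R ((ring_module R)\<lparr>carrier := I\<rparr>)" using coh by (simp add: coherent_ring_def)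
  have Ic: "I \<subseteq> carrier R" using RM.lc_closed[of n _ a] a by (auto simp: I_def)
  obtain m b where b: "\<forall>j<m. b j \<in> carrier R" "I = {?lc m y b | y. \<forall>j<m. y j \<in> carrier R}"
    and fg: "fg_vectors R m {y. ?lc m y b = \<zero>\<^bsub>R\<^esub>}"
    using finitely_presented_ideal_relations[OF R fp Ic] by blast
  have unit: "\<forall>i<k. unit_vector R l i \<in> carrier R" for k l by (simp add: unit_vector_def)
  have "a i \<in> I" if "i < n" for i
    using RM.lc_single[OF that, of a] a unit[of n i] unfolding I_def
    by (intro CollectI exI[of _ "unit_vector R i"]) (simp add: unit_vector_def)
  then have "\<forall>i. \<exists>u. i < n \<longrightarrow> (\<forall>j<m. u j \<in> carrier R) \<and> a i = ?lc m u b" unfolding b(2) by blast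
  then obtain u where u: "\<And>i. i < n \<Longrightarrow> (\<forall>j<m. u i j \<in> carrier R) \<and> a i = ?lc m (u i) b" by metis
  have "b j \<in> I" if "j < m" for j
    using RM.lc_single[OF that, of b] b(1) unit[of m j] unfolding b(2)
    by (intro CollectI exI[of _ "unit_vector R j"]) (simp add: unit_vector_def)
  then have "\<forall>j. \<exists>v. j < m \<longrightarrow> (\<forall>i<n. v i \<in> carrier R) \<and> b j = ?lc n v a" unfolding I_def by blast
  then obtain v where v: "\<And>j. j < m \<Longrightarrow> (\<forall>i<n. v j i \<in> carrier R) \<and> b j = ?lc n (v j) a" by metis
  show ?thesis
    by (rule fg_relations_change_generators[OF R a b(1) _ _ _ _ fg, of u v]) (use u v in auto)
qed

text \<open>
  Induction on the number of equations: a solution of the first \<open>K\<close> equations is a combination of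
  finitely many of them, and the last equation becomes a single relation between its values at those.
\<close>

lemma coherent_systems:
  fixes R :: "('a, 'r) ring_scheme"
  assumes coh: "coherent_ring R" and A: "\<forall>k<K::nat. \<forall>i<n. A k i \<in> carrier R"
  shows "fg_vectors R n {x. \<forall>k<K. lc (ring_module R) n x (A k) = \<zero>\<^bsub>R\<^esub>}"
  using A
proof (induction K)
  case 0
  have "cring R" using coh by (simp add: coherent_ring_def)
  then interpret R: cring R .
  have comb: "x i = lc (ring_module R) n x (\<lambda>q. unit_vector R q i)" if "i < n" "\<forall>i<n. x i \<in> carrier R" for x i
  proof -
    have "(\<lambda>q. unit_vector R q i) = (\<lambda>q. if q = i then \<one>\<^bsub>R\<^esub> else \<zero>\<^bsub>R\<^esub>)" by (auto simp: unit_vector_def)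
    then show ?thesis using R.lc_single_right[OF that] by simp
  qed
  show ?case unfolding fg_vectors_def
  proof (intro exI[of _ n] exI[of _ "unit_vector R"] conjI allI impI ballI)
    fix x :: "nat \<Rightarrow> 'a" assume "\<forall>i<n. x i \<in> carrier R"
    then show "\<exists>z. (\<forall>q<n. z q \<in> carrier R) \<and> (\<forall>i<n. x i = lc (ring_module R) n z (\<lambda>q. unit_vector R q i))"
      using comb by blast
  qed (auto simp: unit_vector_def)
next
  case (Suc K)
  have R: "cring R" using coh by (simp add: coherent_ring_def)
  interpret R: cring R by fact
  interpret RM: module R "ring_module R" by (intro module_ring_module R)
  let ?lc = "lc (ring_module R)"
  have "fg_vectors R n {x. \<forall>k<K. ?lc n x (A k) = \<zero>\<^bsub>R\<^esub>}" using Suc by simp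
  then obtain p U where U: "\<forall>q<p. \<forall>i<n. U q i \<in> carrier R"
    and U0: "\<forall>q<p. U q \<in> {x. \<forall>k<K. ?lc n x (A k) = \<zero>\<^bsub>R\<^esub>}"
    and genU: "\<And>x. x \<in> {x. \<forall>k<K. ?lc n x (A k) = \<zero>\<^bsub>R\<^esub>} \<Longrightarrow> \<forall>i<n. x i \<in> carrier R \<Longrightarrow>
      \<exists>z. (\<forall>q<p. z q \<in> carrier R) \<and> (\<forall>i<n. x i = ?lc p z (\<lambda>q. U q i))"
    by (rule fg_vectorsE) (rule that; assumption)
  note U = U U0[unfolded mem_Collect_eq]
  have AK: "\<forall>i<n. A k i \<in> carrier R" if "k < Suc K" for k using Suc.prems that by blast
  define b where "b q = ?lc n (U q) (A K)" for q
  have bc: "\<forall>q<p. b q \<in> carrier R" using RM.lc_closed[of n _ "A K"] U AK[of K] by (simp add: b_def)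
  obtain p' W where W: "\<forall>r<p'. \<forall>q<p. W r q \<in> carrier R"
    and W0: "\<forall>r<p'. W r \<in> {z. ?lc p z b = \<zero>\<^bsub>R\<^esub>}"
    and genW: "\<And>z. z \<in> {z. ?lc p z b = \<zero>\<^bsub>R\<^esub>} \<Longrightarrow> \<forall>q<p. z q \<in> carrier R \<Longrightarrow>
      \<exists>t. (\<forall>r<p'. t r \<in> carrier R) \<and> (\<forall>q<p. z q = ?lc p' t (\<lambda>r. W r q))"
    by (rule fg_vectorsE[OF coherent_relations[OF coh bc]]) (rule that; assumption)
  note W = W W0[unfolded mem_Collect_eq]
  have comb: "?lc n (\<lambda>i. ?lc p z (\<lambda>q. U q i)) (A k) = ?lc p z (\<lambda>q. ?lc n (U q) (A k))"
    if "\<forall>q<p. z q \<in> carrier R" "k < Suc K" for z k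
    using RM.lc_swap[of p n U "A k" z] U(1) AK[OF that(2)] that(1) by simp
  define X where "X r i = ?lc p (W r) (\<lambda>q. U q i)" for r i
  show ?case
    unfolding fg_vectors_def
  proof (intro exI[of _ p'] exI[of _ X] conjI allI impI ballI)
    fix r assume r: "r < p'"
    show "X r i \<in> carrier R" if "i < n" for i
      unfolding X_def using RM.lc_closed[of p "W r" "\<lambda>q. U q i"] U(1) W(1) r that by simp
    have "?lc n (X r) (A k) = \<zero>\<^bsub>R\<^esub>" if k: "k < Suc K" for k
    proof (cases "k = K")
      case True
      then show ?thesis using comb[of "W r" K] W r by (simp add: X_def[abs_def] b_def[abs_def])
    next
      case False
      then have "?lc p (W r) (\<lambda>q. ?lc n (U q) (A k)) = \<zero>\<^bsub>R\<^esub>"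
        using RM.lc_zero_right[of p "W r" "\<lambda>q. ?lc n (U q) (A k)"] U(2) W(1) r k by simp
      then show ?thesis using comb[of "W r" k] W r k by (simp add: X_def[abs_def])
    qed
    then show "X r \<in> {x. \<forall>k<Suc K. ?lc n x (A k) = \<zero>\<^bsub>R\<^esub>}" by blast
  next
    fix x assume xS: "x \<in> {x. \<forall>k<Suc K. ?lc n x (A k) = \<zero>\<^bsub>R\<^esub>}" and x: "\<forall>i<n. x i \<in> carrier R"
    then obtain z where z: "\<forall>q<p. z q \<in> carrier R" "\<forall>i<n. x i = ?lc p z (\<lambda>q. U q i)"
      using genU[of x] by auto
    have "?lc n x (A K) = ?lc n (\<lambda>i. ?lc p z (\<lambda>q. U q i)) (A K)" by (rule lc_cong) (use z in auto)
    then have "?lc p z b = \<zero>\<^bsub>R\<^esub>" using comb[OF z(1), of K] xS by (simp add: b_def[abs_def])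
    then obtain t where t: "\<forall>r<p'. t r \<in> carrier R" "\<forall>q<p. z q = ?lc p' t (\<lambda>r. W r q)"
      using genW[of z] z(1) by auto
    have "x i = ?lc p' t (\<lambda>r. X r i)" if i: "i < n" for i
    proof -
      have "x i = ?lc p (\<lambda>q. ?lc p' t (\<lambda>r. W r q)) (\<lambda>q. U q i)"
        using z(2) i t(2) by (auto intro: lc_cong)
      also have "\<dots> = ?lc p' t (\<lambda>r. X r i)"
        unfolding X_def using RM.lc_swap[of p' p W "\<lambda>q. U q i" t] W(1) U(1) t(1) i by simp
      finally show ?thesis .
    qed
    then show "\<exists>t. (\<forall>r<p'. t r \<in> carrier R) \<and> (\<forall>i<n. x i = ?lc p' t (\<lambda>r. X r i))" using t(1) by blast
  qed
qed

lemma coherent_pp_definable_fg: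
  assumes coh: "coherent_ring R" and I: "pp_definable_ideal R I"
  shows "fg_ideal R I"
proof -
  have R: "cring R" using coh by (simp add: coherent_ring_def)
  interpret R: cring R by fact
  interpret RM: module R "ring_module R" by (intro module_ring_module R)
  let ?lc = "lc (ring_module R)"
  obtain m K a B where a: "\<forall>k<K. a k \<in> carrier R" and B: "\<forall>k<K. \<forall>j<m. B k j \<in> carrier R"
    and I: "I = solution_ideal R m K a B" using I unfolding pp_definable_ideal_iff[OF R] by blast
  \<comment> \<open>the free variable becomes the last of \<open>m + 1\<close> unknowns\<close>
  define A where "A k j = (if j < m then B k j else a k)" for k j
  have Ac: "\<forall>k<K. \<forall>j<Suc m. A k j \<in> carrier R" using a B by (auto simp: A_def)
  have lcA: "?lc (Suc m) y (A k) = a k \<otimes>\<^bsub>R\<^esub> y m \<oplus>\<^bsub>R\<^esub> ?lc m (B k) y"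
    if k: "k < K" and y: "\<forall>j<Suc m. y j \<in> carrier R" for k y
  proof -
    have "?lc m y (A k) = ?lc m y (B k)" by (rule lc_cong) (auto simp: A_def)
    also have "\<dots> = ?lc m (B k) y" using k B y by (intro R.lc_ring_comm) auto
    finally have "?lc m y (A k) = ?lc m (B k) y" .
    moreover have "?lc m (B k) y \<in> carrier R" using RM.lc_closed[of m "B k" y] k B y by simp
    ultimately show ?thesis using k a y by (simp add: A_def R.m_comm R.a_comm)
  qed
  let ?S = "{y. \<forall>k<K. ?lc (Suc m) y (A k) = \<zero>\<^bsub>R\<^esub>}"
  have I': "I = {y m | y. y \<in> ?S \<and> (\<forall>j<Suc m. y j \<in> carrier R)}"
  proof (intro equalityI subsetI)
    fix x assume "x \<in> I"
    then obtain y where x: "x \<in> carrier R" and y: "\<forall>j<m. y j \<in> carrier R"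
      "\<forall>k<K. a k \<otimes>\<^bsub>R\<^esub> x \<oplus>\<^bsub>R\<^esub> ?lc m (B k) y = \<zero>\<^bsub>R\<^esub>"
      unfolding I solution_ideal_def solvable_def by auto
    let ?y = "\<lambda>j. if j < m then y j else x"
    have "?lc m (B k) ?y = ?lc m (B k) y" for k by (rule lc_cong) auto
    then have "?y \<in> ?S" using lcA[of _ ?y] x y by simp
    then show "x \<in> {y m | y. y \<in> ?S \<and> (\<forall>j<Suc m. y j \<in> carrier R)}"
      using x y by (intro CollectI exI[of _ ?y]) auto
  next
    fix x assume "x \<in> {y m | y. y \<in> ?S \<and> (\<forall>j<Suc m. y j \<in> carrier R)}"
    then obtain y where y: "x = y m" "y \<in> ?S" "\<forall>j<Suc m. y j \<in> carrier R" by blast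
    then show "x \<in> I" unfolding I solution_ideal_def solvable_def
      using lcA[OF _ y(3)] by (intro CollectI conjI exI[of _ y]) auto
  qed
  obtain p U where U: "\<forall>q<p. \<forall>j<Suc m. U q j \<in> carrier R" "\<forall>q<p. U q \<in> ?S"
    and gen: "\<And>y. y \<in> ?S \<Longrightarrow> \<forall>j<Suc m. y j \<in> carrier R \<Longrightarrow>
      \<exists>z. (\<forall>q<p. z q \<in> carrier R) \<and> (\<forall>j<Suc m. y j = ?lc p z (\<lambda>q. U q j))"
    by (rule fg_vectorsE[OF coherent_systems[OF coh Ac]]) (rule that; assumption)
  have Um: "\<forall>q<p. U q m \<in> carrier R" using U(1) by simp
  interpret I: ideal I R unfolding I by (rule R.solution_ideal_ideal[OF a B])
  have "I = {?lc p z (\<lambda>q. U q m) | z. \<forall>q<p. z q \<in> carrier R}"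
  proof (intro equalityI subsetI)
    fix x assume "x \<in> I"
    then obtain y where "x = y m" "y \<in> ?S" "\<forall>j<Suc m. y j \<in> carrier R" unfolding I' by blast
    then show "x \<in> {?lc p z (\<lambda>q. U q m) | z. \<forall>q<p. z q \<in> carrier R}" using gen[of y] by blast
  next
    fix x assume "x \<in> {?lc p z (\<lambda>q. U q m) | z. \<forall>q<p. z q \<in> carrier R}"
    then obtain z where z: "\<forall>q<p. z q \<in> carrier R" "x = ?lc p z (\<lambda>q. U q m)" by blast
    have Uq: "U q m \<in> I" if "q < p" for q unfolding I'
      using U that by (intro CollectI exI[of _ "U q"] conjI) auto
    have "?lc l z (\<lambda>q. U q m) \<in> I" if "l \<le> p" for l
      using that
    proof (induction l)
      case (Suc l)
      then show ?case using z(1) Uq I.I_l_closed by simp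
    qed simp
    then show "x \<in> I" using z(2) by simp
  qed
  then show ?thesis unfolding R.fg_ideal_iff
    using Um by (intro exI[of _ p] exI[of _ "\<lambda>q. U q m"] conjI)
qed


section \<open>The topologies on the spectrum\<close>

lemma (in cring) V_genideal:
  assumes "A \<subseteq> carrier R" shows "V R (Idl A) = {P \<in> Spec R. A \<subseteq> P}"
proof -
  have "Idl A \<subseteq> P \<longleftrightarrow> A \<subseteq> P" if "P \<in> Spec R" for P
    using genideal_self[OF assms] genideal_minimal[OF SpecD(2)[OF that]] by blast
  then show ?thesis by (auto simp: V_def)
qed

lemma V_Int_ideal:
  assumes R: "cring R" and I: "ideal I R" "ideal J R"
  shows "\<exists>K. ideal K R \<and> V R K = V R I \<inter> V R J"
proof -
  interpret R: cring R by fact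
  have sub: "I \<union> J \<subseteq> carrier R" using additive_subgroup.a_subset[OF ideal.axioms(1)] I by blast
  show ?thesis using R.genideal_ideal[OF sub] R.V_genideal[OF sub]
    by (intro exI[of _ "Idl\<^bsub>R\<^esub> (I \<union> J)"]) (auto simp: V_def)
qed

lemma V_Int_fg:
  assumes R: "cring R" and I: "fg_ideal R I" "fg_ideal R J"
  shows "\<exists>K. fg_ideal R K \<and> V R K = V R I \<inter> V R J"
proof -
  interpret R: cring R by fact
  obtain A B where AB: "A \<subseteq> carrier R" "finite A" "I = Idl\<^bsub>R\<^esub> A" "B \<subseteq> carrier R" "finite B" "J = Idl\<^bsub>R\<^esub> B"
    using I by (auto simp: fg_ideal_def)
  have "fg_ideal R (Idl\<^bsub>R\<^esub> (A \<union> B))"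
    unfolding fg_ideal_def using AB by (intro exI[of _ "A \<union> B"]) auto
  moreover have "V R (Idl\<^bsub>R\<^esub> (A \<union> B)) = V R I \<inter> V R J"
    using AB R.V_genideal[of A] R.V_genideal[of B] R.V_genideal[of "A \<union> B"] by auto
  ultimately show ?thesis by blast
qed

lemma V_Int_pp:
  assumes R: "cring R" and I: "pp_definable_ideal R I" "pp_definable_ideal R J"
  shows "\<exists>K. pp_definable_ideal R K \<and> V R K = V R I \<inter> V R J"
proof -
  interpret R: cring R by fact
  interpret I: ideal I R using I(1) by (simp add: pp_definable_ideal_def)
  interpret J: ideal J R using I(2) by (simp add: pp_definable_ideal_def)
  have "I <+>\<^bsub>R\<^esub> J \<subseteq> P \<longleftrightarrow> I \<subseteq> P \<and> J \<subseteq> P" if P: "P \<in> Spec R" for P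
  proof
    interpret P: ideal P R using SpecD(2)[OF P] .
    show "I <+>\<^bsub>R\<^esub> J \<subseteq> P" if "I \<subseteq> P \<and> J \<subseteq> P" using that by (auto simp: set_add_def')
    assume IJ: "I <+>\<^bsub>R\<^esub> J \<subseteq> P"
    have "i \<in> P" if "i \<in> I" for i
    proof -
      have "i \<oplus>\<^bsub>R\<^esub> \<zero>\<^bsub>R\<^esub> \<in> I <+>\<^bsub>R\<^esub> J" unfolding set_add_def' using that J.zero_closed by blast
      then show ?thesis using IJ I.Icarr[OF that] by auto
    qed
    moreover have "j \<in> P" if "j \<in> J" for j
    proof -
      have "\<zero>\<^bsub>R\<^esub> \<oplus>\<^bsub>R\<^esub> j \<in> I <+>\<^bsub>R\<^esub> J" unfolding set_add_def' using that I.zero_closed by blast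
      then show ?thesis using IJ J.Icarr[OF that] by auto
    qed
    ultimately show "I \<subseteq> P \<and> J \<subseteq> P" by blast
  qed
  then have "V R (I <+>\<^bsub>R\<^esub> J) = V R I \<inter> V R J" by (auto simp: V_def)
  then show ?thesis using pp_definable_sum[OF R I] by blast
qed

lemma specialisation_closed_iff:
  assumes R: "cring R"
  shows "specialisation_closed R X \<longleftrightarrow> (\<exists>\<I>. \<I> \<subseteq> {I. ideal I R} \<and> X = (\<Union>I\<in>\<I>. V R I))"
proof
  assume X: "specialisation_closed R X"
  then have "X = (\<Union>P\<in>X. V R P)" unfolding specialisation_closed_def V_def by blast
  moreover have "X \<subseteq> {I. ideal I R}" using X SpecD(2) unfolding specialisation_closed_def by blast
  ultimately show "\<exists>\<I>. \<I> \<subseteq> {I. ideal I R} \<and> X = (\<Union>I\<in>\<I>. V R I)" by blast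
next
  assume "\<exists>\<I>. \<I> \<subseteq> {I. ideal I R} \<and> X = (\<Union>I\<in>\<I>. V R I)"
  then show "specialisation_closed R X" unfolding specialisation_closed_def V_def by blast
qed

text \<open>
  If the generating sets of a topology trace unions of sets \<open>V(I)\<close> with \<open>Q I\<close> on the spectrum, each
  such \<open>V(I)\<close> is a trace, and these \<open>V(I)\<close> are closed under binary intersection, then the open sets
  are exactly the unions of such \<open>V(I)\<close>.
\<close>

lemma openin_restrict_to_Spec_generated:
  fixes R :: "('a, 'r) ring_scheme" and \<S> :: "('a, 'm) module set set set"
  assumes basis: "\<And>U. U \<in> \<S> \<Longrightarrow> \<exists>\<I>. \<I> \<subseteq> {I. Q I} \<and> {P \<in> Spec R. hull_type R P \<in> U} = (\<Union>I\<in>\<I>. V R I)"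
    and V: "\<And>I. Q I \<Longrightarrow> \<exists>U\<in>\<S>. {P \<in> Spec R. hull_type R P \<in> U} = V R I"
    and Int: "\<And>I J. Q I \<Longrightarrow> Q J \<Longrightarrow> \<exists>K. Q K \<and> V R K = V R I \<inter> V R J"
  shows "{X. openin (restrict_to_Spec R (topology_generated_by \<S>)) X} =
    {\<Union>I\<in>\<I>. V R I | \<I>. \<I> \<subseteq> {I. Q I}}"
proof -
  let ?pre = "\<lambda>U. {P \<in> Spec R. (hull_type R P :: ('a, 'm) module set) \<in> U}"
  let ?O = "\<lambda>X. \<exists>\<I>. \<I> \<subseteq> {I. Q I} \<and> X = (\<Union>I\<in>\<I>. V R I)"
  have fwd: "?O (?pre U)" if "generate_topology_on \<S> U" for U
    using that
  proof induction
    case Empty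
    show ?case by (intro exI[of _ "{}"]) simp
  next
    case (Int a b)
    obtain \<I> \<J> where \<I>: "\<I> \<subseteq> {I. Q I}" "?pre a = (\<Union>I\<in>\<I>. V R I)"
      and \<J>: "\<J> \<subseteq> {I. Q I}" "?pre b = (\<Union>I\<in>\<J>. V R I)" using Int.IH by blast
    let ?K = "{K. Q K \<and> (\<exists>I\<in>\<I>. \<exists>J\<in>\<J>. V R K = V R I \<inter> V R J)}"
    have "?pre (a \<inter> b) = ?pre a \<inter> ?pre b" by blast
    also have "\<dots> = (\<Union>K\<in>?K. V R K)"
    proof
      show "?pre a \<inter> ?pre b \<subseteq> (\<Union>K\<in>?K. V R K)"
      proof
        fix P assume "P \<in> ?pre a \<inter> ?pre b"
        then obtain I J where IJ: "I \<in> \<I>" "J \<in> \<J>" "P \<in> V R I" "P \<in> V R J" unfolding \<I>(2) \<J>(2) by blast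
        then obtain K where "Q K" "V R K = V R I \<inter> V R J" using assms(3)[of I J] \<I>(1) \<J>(1) by blast
        then show "P \<in> (\<Union>K\<in>?K. V R K)" using IJ by blast
      qed
      show "(\<Union>K\<in>?K. V R K) \<subseteq> ?pre a \<inter> ?pre b" unfolding \<I>(2) \<J>(2) by blast
    qed
    finally have "?pre (a \<inter> b) = (\<Union>K\<in>?K. V R K)" .
    moreover have "?K \<subseteq> {I. Q I}" by blast
    ultimately show ?case by (intro exI[of _ ?K] conjI)
  next
    case (UN \<K>)
    have "\<forall>k\<in>\<K>. ?O (?pre k)" using UN.IH by (intro ballI)
    from bchoice[OF this] obtain F where
      F: "\<forall>k\<in>\<K>. F k \<subseteq> {I. Q I} \<and> ?pre k = (\<Union>I\<in>F k. V R I)" by (elim exE)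
    have "?pre (\<Union>\<K>) = (\<Union>k\<in>\<K>. ?pre k)" by blast
    also have "\<dots> = (\<Union>k\<in>\<K>. \<Union>I\<in>F k. V R I)" using F by auto
    also have "\<dots> = (\<Union>I\<in>(\<Union>k\<in>\<K>. F k). V R I)" by blast
    finally show ?case using F by (intro exI[of _ "\<Union>k\<in>\<K>. F k"] conjI) auto
  next
    case (Basis s)
    then show ?case using basis[of s] by blast
  qed
  have bwd: "\<exists>U. openin (topology_generated_by \<S>) U \<and> X = ?pre U" if O: "?O X" for X
  proof -
    obtain \<I> where \<I>: "\<I> \<subseteq> {I. Q I}" "X = (\<Union>I\<in>\<I>. V R I)"
      using O by (elim exE conjE) (rule that)
    let ?U = "\<Union>{U \<in> \<S>. \<exists>I\<in>\<I>. ?pre U = V R I}"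
    have "openin (topology_generated_by \<S>) ?U"
      by (rule openin_Union) (auto intro: topology_generated_by_Basis)
    moreover have "X = ?pre ?U"
    proof
      show "?pre ?U \<subseteq> X" unfolding \<I>(2) by blast
      show "X \<subseteq> ?pre ?U"
      proof
        fix P assume "P \<in> X"
        then obtain I where I: "I \<in> \<I>" "P \<in> V R I" unfolding \<I>(2) by blast
        then obtain U where "U \<in> \<S>" "?pre U = V R I" using V[of I] \<I>(1) by blast
        then show "P \<in> ?pre ?U" using I by blast
      qed
    qed
    ultimately show ?thesis by blast
  qed
  have pre: "hull_type R -` U \<inter> Spec R = ?pre U" for U by blast
  have "openin (restrict_to_Spec R (topology_generated_by \<S>)) X \<longleftrightarrow> ?O X" for X
    unfolding restrict_to_Spec_def openin_pullback_topology pre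
  proof
    assume "\<exists>U. openin (topology_generated_by \<S>) U \<and> X = ?pre U"
    then obtain U where U: "openin (topology_generated_by \<S>) U" "X = ?pre U" by (elim exE conjE)
    show "?O X" unfolding U(2) using fwd[OF openin_topology_generated_by[OF U(1)]] .
  qed (rule bwd)
  then show ?thesis by (intro Collect_cong) (simp add: conj_commute)
qed

lemma hom_support_hull_type_iff:
  fixes R :: "('a, 'r) ring_scheme"
  assumes "cring R" "large_universe R TYPE('m)" "P \<in> Spec R"
  shows "(hull_type R P :: ('a, 'm) module set) \<in> hom_support R M \<longleftrightarrow>
    (\<exists>E \<in> (hull_type R P :: ('a, 'm) module set). nonzero_hom R M E)"
  using hull_type_inj_types[OF assms] by (auto simp: hom_support_def)

lemma nonzero_hom_specialise:
  fixes M E E' :: "('a, 'm) module"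
  assumes M: "module R M" and E: "module R E" "essential_generator R P E e" and P: "primeideal P R"
    and E': "injective_module R E'" "essential_generator R Q E' e'" and Q: "primeideal Q R"
    and PQ: "P \<subseteq> Q" and "nonzero_hom R M E"
  shows "nonzero_hom R M E'"
proof -
  interpret M: module R M by fact
  interpret E: module R E by fact
  obtain f x where f: "f \<in> mod_hom R M E" and x: "x \<in> carrier M" "f x \<noteq> \<zero>\<^bsub>E\<^esub>"
    using assms(9) by (auto simp: nonzero_hom_def)
  have fx: "f x \<in> carrier E" using mod_hom_closed[OF f x(1)] .
  obtain r where r: "r \<in> carrier R" "annihilator R E (r \<odot>\<^bsub>E\<^esub> f x) = P"
    using essential_generator_prime[OF E P fx x(2)] by blast
  have "annihilator R M (r \<odot>\<^bsub>M\<^esub> x) \<subseteq> annihilator R E (r \<odot>\<^bsub>E\<^esub> f x)"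
  proof
    fix t assume t: "t \<in> annihilator R M (r \<odot>\<^bsub>M\<^esub> x)"
    then have tR: "t \<in> carrier R" and "f (t \<odot>\<^bsub>M\<^esub> (r \<odot>\<^bsub>M\<^esub> x)) = \<zero>\<^bsub>E\<^esub>"
      using mod_hom_zero[OF M E(1) f] by (simp_all add: annihilator_def)
    moreover have "f (t \<odot>\<^bsub>M\<^esub> (r \<odot>\<^bsub>M\<^esub> x)) = t \<odot>\<^bsub>E\<^esub> (r \<odot>\<^bsub>E\<^esub> f x)"
      using mod_hom_smult[OF f tR M.smult_closed[OF r(1) x(1)]] mod_hom_smult[OF f r(1) x(1)] by simp
    ultimately show "t \<in> annihilator R E (r \<odot>\<^bsub>E\<^esub> f x)" by (simp add: annihilator_def)
  qed
  then have "annihilator R M (r \<odot>\<^bsub>M\<^esub> x) \<subseteq> annihilator R E' e'"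
    using r PQ E'(2) by (auto simp: essential_generator_def)
  then obtain g where "g \<in> mod_hom R M E'" "g (r \<odot>\<^bsub>M\<^esub> x) = e'"
    using injective_extends_cyclic[OF E'(1) M, of "r \<odot>\<^bsub>M\<^esub> x" e'] r(1) x(1) E'(2)
    by (auto simp: essential_generator_def)
  moreover have "e' \<noteq> \<zero>\<^bsub>E'\<^esub>"
    using essential_generator_nonzero[OF injective_module_module[OF E'(1)] E'(2) Q] .
  ultimately show ?thesis unfolding nonzero_hom_def using M.smult_closed[OF r(1) x(1)] by metis
qed

lemma nonzero_hom_cyclic_iff:
  fixes M E :: "('a, 'm) module"
  assumes M: "module R M" and m: "m \<in> carrier M" "carrier M = {r \<odot>\<^bsub>M\<^esub> m | r. r \<in> carrier R}"
    and E: "injective_module R E" "essential_generator R P E e" and P: "primeideal P R"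
  shows "nonzero_hom R M E \<longleftrightarrow> annihilator R M m \<subseteq> P"
proof
  note mE = injective_module_module[OF E(1)]
  interpret M: module R M by fact
  interpret E: module R E by (rule mE)
  {
    assume "nonzero_hom R M E"
    then obtain f x where f: "f \<in> mod_hom R M E" and x: "x \<in> carrier M" "f x \<noteq> \<zero>\<^bsub>E\<^esub>"
      by (auto simp: nonzero_hom_def)
    obtain r where r: "r \<in> carrier R" "x = r \<odot>\<^bsub>M\<^esub> m" using x m(2) by blast
    have fm: "f m \<in> carrier E" using mod_hom_closed[OF f m(1)] .
    have "f m \<noteq> \<zero>\<^bsub>E\<^esub>" using x(2) r mod_hom_smult[OF f r(1) m(1)] by auto
    then have "annihilator R E (f m) \<subseteq> P" using annihilator_subset_prime[OF mE E(2) P fm] by blast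
    moreover have "annihilator R M m \<subseteq> annihilator R E (f m)"
      using mod_hom_smult[OF f _ m(1), symmetric] mod_hom_zero[OF M mE f] by (auto simp: annihilator_def)
    ultimately show "annihilator R M m \<subseteq> P" by blast
  next
    assume "annihilator R M m \<subseteq> P"
    then have "\<exists>g\<in>mod_hom R M E. g m = e"
      using E(2) by (intro injective_extends_cyclic[OF E(1) M m(1)]) (auto simp: essential_generator_def)
    then show "nonzero_hom R M E"
      unfolding nonzero_hom_def using m(1) essential_generator_nonzero[OF mE E(2) P] by metis
  }
qed

lemma nonzero_hom_quot_iff:
  assumes E: "module R E" "essential_generator R P E e" and P: "primeideal P R" and I: "ideal I R"
  shows "nonzero_hom R (quot_module R I) E \<longleftrightarrow> I \<subseteq> P"
proof
  interpret E: module R E by fact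
  interpret I: ideal I R by fact
  note qs = quot_module_carrier quot_module_smult[OF I]
  {
    assume "nonzero_hom R (quot_module R I) E"
    then obtain f X where f: "f \<in> mod_hom R (quot_module R I) E" and X: "X \<in> carrier (quot_module R I)" "f X \<noteq> \<zero>\<^bsub>E\<^esub>"
      by (auto simp: nonzero_hom_def)
    obtain r where r: "r \<in> carrier R" "X = I +>\<^bsub>R\<^esub> r" using X by (auto simp: qs)
    have "I \<subseteq> annihilator R E (f X)"
    proof
      fix i assume i: "i \<in> I"
      have iR: "i \<in> carrier R" using I.Icarr[OF i] .
      have "i \<otimes>\<^bsub>R\<^esub> r \<in> I" using I.I_r_closed[OF i r(1)] .
      then have "I +>\<^bsub>R\<^esub> (i \<otimes>\<^bsub>R\<^esub> r) = I +>\<^bsub>R\<^esub> (\<zero>\<^bsub>R\<^esub> \<otimes>\<^bsub>R\<^esub> r)"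
        using E.R.quotient_eq_iff_same_a_r_cos[OF I, of "i \<otimes>\<^bsub>R\<^esub> r" "\<zero>\<^bsub>R\<^esub>"] iR r(1) by (simp add: a_minus_def)
      then have "i \<odot>\<^bsub>quot_module R I\<^esub> X = \<zero>\<^bsub>R\<^esub> \<odot>\<^bsub>quot_module R I\<^esub> X" using iR r by (simp add: qs)
      then have "i \<odot>\<^bsub>E\<^esub> f X = \<zero>\<^bsub>R\<^esub> \<odot>\<^bsub>E\<^esub> f X"
        using mod_hom_smult[OF f iR X(1)] mod_hom_smult[OF f E.R.zero_closed X(1)] by simp
      then show "i \<in> annihilator R E (f X)"
        using iR mod_hom_closed[OF f X(1)] by (simp add: annihilator_def)
    qed
    then show "I \<subseteq> P" using annihilator_subset_prime[OF E P mod_hom_closed[OF f X(1)] X(2)] by blast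
  next
    assume "I \<subseteq> P"
    then obtain f where f: "f \<in> mod_hom R (quot_module R I) E" "\<forall>r\<in>carrier R. f (I +>\<^bsub>R\<^esub> r) = r \<odot>\<^bsub>E\<^esub> e"
      using quot_module_hom[OF E(1) I, of e] E(2) by (auto simp: essential_generator_def)
    have "e \<in> carrier E" using E(2) by (simp add: essential_generator_def)
    then have "f (I +>\<^bsub>R\<^esub> \<one>\<^bsub>R\<^esub>) \<noteq> \<zero>\<^bsub>E\<^esub>" using f(2) essential_generator_nonzero[OF E P] by simp
    moreover have "I +>\<^bsub>R\<^esub> \<one>\<^bsub>R\<^esub> \<in> carrier (quot_module R I)" by (simp add: qs)
    ultimately show "nonzero_hom R (quot_module R I) E" unfolding nonzero_hom_def using f(1) by blast
  }
qed

lemma cyclic_module_exists: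
  fixes R :: "('a, 'r) ring_scheme"
  assumes "cring R" "large_universe R TYPE('m)" "ideal I R"
  shows "\<exists>(M :: ('a, 'm) module) m. module R M \<and> m \<in> carrier M \<and>
    carrier M = {r \<odot>\<^bsub>M\<^esub> m | r. r \<in> carrier R} \<and> annihilator R M m = I"
proof -
  obtain W :: "('a, 'm) module" and w where W: "injective_module R W" "w \<in> carrier W" "annihilator R W w = I"
    using ambient_injective[OF assms(1,2)] assms(3) by blast
  interpret W: module R W using W(1) by (rule injective_module_module)
  let ?H = "{r \<odot>\<^bsub>W\<^esub> w | r. r \<in> carrier R}"
  have "module R (W\<lparr>carrier := ?H\<rparr>)"
    using submodule.submodule_is_module[OF W.submodule_cyclic[OF W(2)] W.module_axioms] .
  moreover have "w \<in> ?H" using W(2) by (intro CollectI exI[of _ "\<one>\<^bsub>R\<^esub>"]) simp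
  ultimately show ?thesis using W(3)
    by (intro exI[of _ "W\<lparr>carrier := ?H\<rparr>"] exI[of _ w]) (simp add: annihilator_def)
qed

lemma full_support_open_sets:
  fixes R :: "('a, 'r) ring_scheme"
  assumes R: "cring R" "large_universe R TYPE('m)"
  shows "{X. openin (restrict_to_Spec R (full_support_topology R :: ('a, 'm) module set topology)) X} =
    {\<Union>I\<in>\<I>. V R I | \<I>. \<I> \<subseteq> {I. ideal I R}}"
  unfolding full_support_topology_def
proof (rule openin_restrict_to_Spec_generated)
  fix U :: "('a, 'm) module set set"
  assume "U \<in> {hom_support R M | M :: ('a, 'm) module. module R M}"
  then obtain M :: "('a, 'm) module" where M: "module R M" and U: "U = hom_support R M" by blast
  have "Q \<in> {P \<in> Spec R. hull_type R P \<in> U}" if P: "P \<in> {P \<in> Spec R. hull_type R P \<in> U}"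
    and Q: "Q \<in> Spec R" "P \<subseteq> Q" for P Q
  proof -
    have PS: "P \<in> Spec R" using P by simp
    obtain E :: "('a, 'm) module" where E: "E \<in> hull_type R P" "nonzero_hom R M E"
      using P hom_support_hull_type_iff[OF R PS] by (auto simp: U)
    obtain E' :: "('a, 'm) module" where E': "E' \<in> hull_type R Q" using hull_type_nonempty[OF R Q(1)] by blast
    obtain e e' where "essential_generator R P E e" "essential_generator R Q E' e'"
      using hull_typeD(2)[OF R(1)] PS Q(1) E E' by blast
    then have "nonzero_hom R M E'"
      using nonzero_hom_specialise[OF M injective_module_module[OF hull_typeD(1)[OF R(1) PS E(1)]] _ SpecD(1)[OF PS]
        hull_typeD(1)[OF R(1) Q(1) E'] _ SpecD(1)[OF Q(1)] Q(2) E(2)] by blast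
    then show ?thesis using hom_support_hull_type_iff[OF R Q(1)] E' Q(1) U by blast
  qed
  then have "specialisation_closed R {P \<in> Spec R. hull_type R P \<in> U}"
    unfolding specialisation_closed_def by blast
  then show "\<exists>\<I>. \<I> \<subseteq> {I. ideal I R} \<and> {P \<in> Spec R. hull_type R P \<in> U} = (\<Union>I\<in>\<I>. V R I)"
    unfolding specialisation_closed_iff[OF R(1)] .
next
  fix I assume I: "ideal I R"
  obtain M :: "('a, 'm) module" and m where M: "module R M" "m \<in> carrier M"
      "carrier M = {r \<odot>\<^bsub>M\<^esub> m | r. r \<in> carrier R}" "annihilator R M m = I"
    using cyclic_module_exists[OF R I] by blast
  have "hull_type R P \<in> (hom_support R M :: ('a, 'm) module set set) \<longleftrightarrow> I \<subseteq> P" if P: "P \<in> Spec R" for P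
  proof -
    have "nonzero_hom R M E \<longleftrightarrow> I \<subseteq> P" if E: "E \<in> hull_type R P" for E :: "('a, 'm) module"
      using nonzero_hom_cyclic_iff[OF M(1-3) hull_typeD(1)[OF R(1) P E] _ SpecD(1)[OF P]]
        hull_typeD(2)[OF R(1) P E] M(4) by blast
    then show ?thesis using hom_support_hull_type_iff[OF R P] hull_type_nonempty[OF R P] by blast
  qed
  then have pre: "{P \<in> Spec R. hull_type R P \<in> (hom_support R M :: ('a, 'm) module set set)} = V R I"
    by (auto simp: V_def)
  show "\<exists>U\<in>{hom_support R M :: ('a, 'm) module set set | M :: ('a, 'm) module. module R M}. {P \<in> Spec R. hull_type R P \<in> U} = V R I"
  proof (rule bexI[where x = "hom_support R M"])
    show "{P \<in> Spec R. hull_type R P \<in> (hom_support R M :: ('a, 'm) module set set)} = V R I" by (rule pre)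
    show "hom_support R M \<in> {hom_support R M :: ('a, 'm) module set set | M :: ('a, 'm) module. module R M}" using M(1) by blast
  qed
next
  show "\<exists>K. ideal K R \<and> V R K = V R I \<inter> V R J" if "ideal I R" "ideal J R" for I J
    using V_Int_ideal[OF R(1) that] .
qed

lemma fg_ideal_ideal: "cring R \<Longrightarrow> fg_ideal R I \<Longrightarrow> ideal I R"
  using ring.genideal_ideal[OF cring.axioms(1)] by (auto simp: fg_ideal_def)

lemma thomason_open_sets:
  fixes R :: "('a, 'r) ring_scheme"
  assumes R: "cring R" "large_universe R TYPE('m)"
  shows "{X. openin (restrict_to_Spec R (thomason_topology R :: ('a, 'm) module set topology)) X} =
    {\<Union>I\<in>\<I>. V R I | \<I>. \<I> \<subseteq> {I. fg_ideal R I}}"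
  unfolding thomason_topology_def
proof -
  have pre: "{P \<in> Spec R. hull_type R P \<in> (hom_support R (quot_module R I) :: ('a, 'm) module set set)} = V R I"
    if I: "fg_ideal R I" for I
  proof -
    have "hull_type R P \<in> (hom_support R (quot_module R I) :: ('a, 'm) module set set) \<longleftrightarrow> I \<subseteq> P"
      if P: "P \<in> Spec R" for P
    proof -
      have "nonzero_hom R (quot_module R I) E \<longleftrightarrow> I \<subseteq> P" if E: "E \<in> hull_type R P" for E :: "('a, 'm) module"
        using nonzero_hom_quot_iff[OF injective_module_module[OF hull_typeD(1)[OF R(1) P E]] _ SpecD(1)[OF P]
            fg_ideal_ideal[OF R(1) I]] hull_typeD(2)[OF R(1) P E] by blast
      then show ?thesis using hom_support_hull_type_iff[OF R P] hull_type_nonempty[OF R P] by blast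
    qed
    then show ?thesis by (auto simp: V_def)
  qed
  show "{X. openin (restrict_to_Spec R (topology_generated_by
      {hom_support R (quot_module R I) :: ('a, 'm) module set set | I. fg_ideal R I})) X} =
    {\<Union>I\<in>\<I>. V R I | \<I>. \<I> \<subseteq> {I. fg_ideal R I}}"
  proof (rule openin_restrict_to_Spec_generated)
    fix U :: "('a, 'm) module set set"
    assume "U \<in> {hom_support R (quot_module R I) | I. fg_ideal R I}"
    then obtain I where "fg_ideal R I" "U = hom_support R (quot_module R I)" by blast
    then show "\<exists>\<I>. \<I> \<subseteq> {I. fg_ideal R I} \<and> {P \<in> Spec R. hull_type R P \<in> U} = (\<Union>I\<in>\<I>. V R I)"
      using pre by (intro exI[of _ "{I}"]) simp
  next
    fix I assume I: "fg_ideal R I"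
    show "\<exists>U\<in>{hom_support R (quot_module R I) :: ('a, 'm) module set set | I. fg_ideal R I}.
        {P \<in> Spec R. hull_type R P \<in> U} = V R I"
    proof (rule bexI[where x = "hom_support R (quot_module R I)"])
      show "{P \<in> Spec R. hull_type R P \<in> (hom_support R (quot_module R I) :: ('a, 'm) module set set)} = V R I"
        by (rule pre[OF I])
      show "hom_support R (quot_module R I) \<in>
        {hom_support R (quot_module R I) :: ('a, 'm) module set set | I. fg_ideal R I}" using I by blast
    qed
  next
    show "\<exists>K. fg_ideal R K \<and> V R K = V R I \<inter> V R J" if "fg_ideal R I" "fg_ideal R J" for I J
      using V_Int_fg[OF R(1) that] .
  qed
qed

text \<open>
  Duality in one variable. If \<open>I\<close> is given by \<open>a k \<cdot> x + \<Sum>\<^sub>j B k j \<cdot> y j = 0\<close>, then \<open>I = D\<^sub>\<phi>\<close> for the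
  formula \<open>\<phi>\<close> with the equations \<open>\<Sum>\<^sub>l B l j \<cdot> w l = 0\<close> and, as the last one, \<open>x + \<Sum>\<^sub>l a l \<cdot> w l = 0\<close>.
\<close>

lemma pp_definable_dual:
  assumes R: "cring R" and I: "pp_definable_ideal R I"
  shows "\<exists>\<phi>. pp_over R \<phi> \<and> free_vars \<phi> = 1 \<and> (\<forall>d. d \<in> dual_vectors R \<phi> \<longleftrightarrow> d 0 \<in> I)"
proof -
  interpret R: cring R by fact
  interpret RM: module R "ring_module R" by (intro module_ring_module R)
  let ?lc = "lc (ring_module R)"
  obtain m K a B where a: "\<forall>k<K. a k \<in> carrier R" and B: "\<forall>k<K. \<forall>j<m. B k j \<in> carrier R"
    and I: "I = solution_ideal R m K a B" using I unfolding pp_definable_ideal_iff[OF R] by blast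
  define A :: "nat \<Rightarrow> nat \<Rightarrow> 'a" where "A k i = (if k < m then \<zero>\<^bsub>R\<^esub> else \<one>\<^bsub>R\<^esub>)" for k i
  define C where "C k l = (if k < m then B l k else a l)" for k l
  let ?\<phi> = "matrix_formula 1 K (Suc m) A C"
  have Ac: "\<forall>k<Suc m. \<forall>i<1. A k i \<in> carrier R" and Cc: "\<forall>k<Suc m. \<forall>l<K. C k l \<in> carrier R"
    using a B by (auto simp: A_def C_def)
  have 1: "?lc (Suc m) c (\<lambda>k. A k 0) = c m" if c: "\<forall>k<Suc m. c k \<in> carrier R" for c
    using RM.lc_zero_right[of m c "\<lambda>k. A k 0"] c by (simp add: A_def)
  have 2: "?lc (Suc m) c (\<lambda>k. C k l) = a l \<otimes>\<^bsub>R\<^esub> c m \<oplus>\<^bsub>R\<^esub> ?lc m (B l) c"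
    if c: "\<forall>k<Suc m. c k \<in> carrier R" and l: "l < K" for c l
  proof -
    have "?lc m c (\<lambda>k. C k l) = ?lc m c (B l)" by (rule lc_cong) (auto simp: C_def)
    also have "\<dots> = ?lc m (B l) c" using c l B by (intro R.lc_ring_comm) auto
    finally have "?lc m c (\<lambda>k. C k l) = ?lc m (B l) c" .
    moreover have "?lc m (B l) c \<in> carrier R" using RM.lc_closed[of m "B l" c] c l B by simp
    ultimately show ?thesis using a c l by (simp add: C_def R.m_comm R.a_comm)
  qed
  have dual: "d \<in> dual_vectors R ?\<phi> \<longleftrightarrow> (\<exists>c. (\<forall>k<Suc m. c k \<in> carrier R) \<and>
      (\<forall>l<K. ?lc (Suc m) c (\<lambda>k. C k l) = \<zero>\<^bsub>R\<^esub>) \<and> d 0 = ?lc (Suc m) c (\<lambda>k. A k 0))" for d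
  proof -
    have "?lc (Suc m) c (\<lambda>k. bound_coeff ?\<phi> k l) = ?lc (Suc m) c (\<lambda>k. C k l)" if "l < K" for c l
      by (rule lc_cong) (use that in auto)
    moreover have "?lc (Suc m) c (\<lambda>k. free_coeff ?\<phi> k 0) = ?lc (Suc m) c (\<lambda>k. A k 0)" for c
      by (rule lc_cong) auto
    ultimately show ?thesis unfolding dual_vectors_def by (simp del: lc.simps)
  qed
  have "(\<exists>c. (\<forall>k<Suc m. c k \<in> carrier R) \<and>
      (\<forall>l<K. ?lc (Suc m) c (\<lambda>k. C k l) = \<zero>\<^bsub>R\<^esub>) \<and> d 0 = ?lc (Suc m) c (\<lambda>k. A k 0)) \<longleftrightarrow> d 0 \<in> I" for d :: "nat \<Rightarrow> 'a"
  proof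
    assume "\<exists>c. (\<forall>k<Suc m. c k \<in> carrier R) \<and>
      (\<forall>l<K. ?lc (Suc m) c (\<lambda>k. C k l) = \<zero>\<^bsub>R\<^esub>) \<and> d 0 = ?lc (Suc m) c (\<lambda>k. A k 0)"
    then obtain c where c: "\<forall>k<Suc m. c k \<in> carrier R" "\<forall>l<K. ?lc (Suc m) c (\<lambda>k. C k l) = \<zero>\<^bsub>R\<^esub>"
      "d 0 = ?lc (Suc m) c (\<lambda>k. A k 0)" by blast
    then show "d 0 \<in> I" unfolding I solution_ideal_def solvable_def using 1[OF c(1)] 2[OF c(1)]
      by (intro CollectI conjI exI[of _ c]) (auto simp del: lc.simps)
  next
    assume "d 0 \<in> I"
    then obtain y where d: "d 0 \<in> carrier R" and y: "\<forall>j<m. y j \<in> carrier R"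
      "\<forall>k<K. a k \<otimes>\<^bsub>R\<^esub> d 0 \<oplus>\<^bsub>R\<^esub> ?lc m (B k) y = \<zero>\<^bsub>R\<^esub>"
      unfolding I solution_ideal_def solvable_def by auto
    let ?c = "\<lambda>k. if k < m then y k else d 0"
    have c: "\<forall>k<Suc m. ?c k \<in> carrier R" using d y by auto
    have "?lc m (B l) ?c = ?lc m (B l) y" for l by (rule lc_cong) auto
    then show "\<exists>c. (\<forall>k<Suc m. c k \<in> carrier R) \<and>
      (\<forall>l<K. ?lc (Suc m) c (\<lambda>k. C k l) = \<zero>\<^bsub>R\<^esub>) \<and> d 0 = ?lc (Suc m) c (\<lambda>k. A k 0)"
      using 1[OF c] 2[OF c] y c by (intro exI[of _ ?c]) (auto simp del: lc.simps)
  qed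
  then have "d \<in> dual_vectors R ?\<phi> \<longleftrightarrow> d 0 \<in> I" for d using dual by blast
  then show ?thesis using pp_over_matrix_formula[OF Ac Cc] by (intro exI[of _ ?\<phi>]) auto
qed

lemma Union_Collect_conj: "(\<Union>d\<in>D. {x \<in> A. Q d x}) = {x \<in> A. \<exists>d\<in>D. Q d x}"
  by blast

lemma restrict_to_Spec_subtopology:
  fixes R :: "('a, 'r) ring_scheme" and T :: "('a, 'm) module set topology"
  assumes R: "cring R" "large_universe R TYPE('m)"
  shows "restrict_to_Spec R (subtopology T (inj_types R)) = restrict_to_Spec R T"
  unfolding topology_eq
proof (intro allI iffI)
  have eq: "hull_type R -` (U \<inter> inj_types R) \<inter> Spec R = hull_type R -` U \<inter> Spec R" for U :: "('a, 'm) module set set"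
    using hull_type_inj_types[OF R] by blast
  fix X
  {
    assume "openin (restrict_to_Spec R (subtopology T (inj_types R))) X"
    then obtain U where "openin T U" "X = hull_type R -` (U \<inter> inj_types R) \<inter> Spec R"
      unfolding restrict_to_Spec_def openin_pullback_topology openin_subtopology by auto
    then show "openin (restrict_to_Spec R T) X"
      unfolding restrict_to_Spec_def openin_pullback_topology eq by (intro exI[of _ U] conjI)
  next
    assume "openin (restrict_to_Spec R T) X"
    then obtain U where U: "openin T U" "X = hull_type R -` U \<inter> Spec R"
      unfolding restrict_to_Spec_def openin_pullback_topology by (elim exE conjE)
    have "openin (subtopology T (inj_types R)) (U \<inter> inj_types R)"
      using U(1) by (auto simp: openin_subtopology)
    moreover have "X = hull_type R -` (U \<inter> inj_types R) \<inter> Spec R" unfolding eq by (rule U(2))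
    ultimately show "openin (restrict_to_Spec R (subtopology T (inj_types R))) X"
      unfolding restrict_to_Spec_def openin_pullback_topology by (intro exI[of _ "U \<inter> inj_types R"] conjI)
  }
qed

lemma ziegler_open_sets:
  fixes R :: "('a, 'r) ring_scheme"
  assumes R: "cring R" "large_universe R TYPE('m)"
  shows "{X. openin (restrict_to_Spec R (ziegler_topology R :: ('a, 'm) module set topology)) X} =
    {\<Union>I\<in>\<I>. V R I | \<I>. \<I> \<subseteq> {I. pp_definable_ideal R I}}"
proof -
  interpret R: cring R by fact
  let ?U = "\<lambda>\<phi> \<psi>. {C \<in> pinj_types R. \<exists>E\<in>C. pp_sol E \<phi> \<noteq> pp_sol E \<psi>} :: ('a, 'm) module set set"
  let ?S = "{?U \<phi> \<psi> | \<phi> \<psi>. pp_over R \<phi> \<and> pp_over R \<psi> \<and> pp_le TYPE('m) R \<psi> \<phi>}"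
  have restr: "restrict_to_Spec R (ziegler_topology R :: ('a, 'm) module set topology) =
      restrict_to_Spec R (topology_generated_by ?S)"
    unfolding ziegler_topology_def ziegler_pinj_topology_def
    by (rule restrict_to_Spec_subtopology[OF R])
  have pre: "{P \<in> Spec R. hull_type R P \<in> ?U \<phi> \<psi>} = (\<Union>d\<in>dual_vectors R \<psi>. V R (residual R \<phi> d))"
    if le: "pp_over R \<phi>" "pp_over R \<psi>" "pp_le TYPE('m) R \<psi> \<phi>" for \<phi> \<psi>
  proof -
    have "hull_type R P \<in> ?U \<phi> \<psi> \<longleftrightarrow> (\<exists>d\<in>dual_vectors R \<psi>. residual R \<phi> d \<subseteq> P)" if P: "P \<in> Spec R" for P
    proof -
      have "pp_sol E \<phi> \<noteq> pp_sol E \<psi> \<longleftrightarrow> (\<exists>d\<in>dual_vectors R \<psi>. residual R \<phi> d \<subseteq> P)"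
        if E: "E \<in> hull_type R P" for E :: "('a, 'm) module"
        using pp_pair_open_iff[OF R(2) hull_typeD(1)[OF R(1) P E] _ SpecD(1)[OF P] le]
          hull_typeD(2)[OF R(1) P E] by blast
      moreover have "(hull_type R P :: ('a, 'm) module set) \<in> pinj_types R"
        using hull_type_inj_types[OF R P] inj_types_subset_pinj_types by blast
      ultimately show ?thesis using hull_type_nonempty[OF R P] by blast
    qed
    then have "{P \<in> Spec R. hull_type R P \<in> ?U \<phi> \<psi>} =
        {P \<in> Spec R. \<exists>d\<in>dual_vectors R \<psi>. residual R \<phi> d \<subseteq> P}"
      by (intro Collect_cong conj_cong refl)
    also have "\<dots> = (\<Union>d\<in>dual_vectors R \<psi>. V R (residual R \<phi> d))" unfolding V_def by blast
    finally show ?thesis .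
  qed
  have "{X. openin (restrict_to_Spec R (topology_generated_by ?S)) X} =
    {\<Union>I\<in>\<I>. V R I | \<I>. \<I> \<subseteq> {I. pp_definable_ideal R I}}"
  proof (rule openin_restrict_to_Spec_generated)
    fix U assume "U \<in> ?S"
    then obtain \<phi> \<psi> where le: "pp_over R \<phi>" "pp_over R \<psi>" "pp_le TYPE('m) R \<psi> \<phi>" and U: "U = ?U \<phi> \<psi>" by blast
    have "pp_definable_ideal R (residual R \<phi> d)" if "d \<in> dual_vectors R \<psi>" for d
      using dual_vectors_closed[OF R(1) le(2) that] le(3)
      by (intro pp_definable_residual[OF R(1) le(1)]) (simp add: pp_le_def)
    then show "\<exists>\<I>. \<I> \<subseteq> {I. pp_definable_ideal R I} \<and> {P \<in> Spec R. hull_type R P \<in> U} = (\<Union>I\<in>\<I>. V R I)"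
      unfolding U pre[OF le] by (intro exI[of _ "residual R \<phi> ` dual_vectors R \<psi>"]) auto
  next
    fix I assume I: "pp_definable_ideal R I"
    interpret I: ideal I R using I by (simp add: pp_definable_ideal_def)
    obtain \<phi> where \<phi>: "pp_over R \<phi>" "free_vars \<phi> = 1" "\<And>d. d \<in> dual_vectors R \<phi> \<longleftrightarrow> d 0 \<in> I"
      using pp_definable_dual[OF R(1) I] by blast
    have one: "\<forall>k<1::nat. \<forall>i<1::nat. \<one>\<^bsub>R\<^esub> \<in> carrier R" and none: "\<forall>k<1::nat. \<forall>j<0::nat. \<zero>\<^bsub>R\<^esub> \<in> carrier R" by auto
    \<comment> \<open>the formula \<open>x = 0\<close>; the pair of \<open>\<phi>\<close> and \<open>\<psi>\<close> has the trace \<open>V(I)\<close>\<close>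
    let ?\<psi> = "matrix_formula 1 0 1 (\<lambda>_ _. \<one>\<^bsub>R\<^esub>) (\<lambda>_ _. \<zero>\<^bsub>R\<^esub>)"
    have \<psi>: "pp_over R ?\<psi>" by (rule pp_over_matrix_formula[OF one none])
    have "pp_sol M ?\<psi> \<subseteq> pp_sol M \<phi>" if M: "module R M" for M :: "('a, 'm) module"
    proof
      interpret M: module R M by (rule M)
      fix x assume "x \<in> pp_sol M ?\<psi>"
      then have x: "length x = 1" "set x \<subseteq> carrier M" and
        s: "solvable M 0 1 (\<lambda>_ _. \<zero>\<^bsub>R\<^esub>) (\<lambda>k. lc M 1 (\<lambda>_. \<one>\<^bsub>R\<^esub>) ((!) x))"
        using pp_sol_matrix_formula[OF M one none] by auto
      have x0: "x ! 0 \<in> carrier M" using x by auto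
      then have "x ! 0 = \<zero>\<^bsub>M\<^esub>" using s by (simp add: solvable_def)
      note co = pp_over_coeffs[OF \<phi>(1)]
      have "solvable M (bound_vars \<phi>) (length (equations \<phi>)) (bound_coeff \<phi>)
          (\<lambda>k. lc M (free_vars \<phi>) (free_coeff \<phi> k) ((!) x))"
        unfolding solvable_def
      proof (intro exI[of _ "\<lambda>_. \<zero>\<^bsub>M\<^esub>"] conjI allI impI)
        fix k assume k: "k < length (equations \<phi>)"
        have "lc M (free_vars \<phi>) (free_coeff \<phi> k) ((!) x) = \<zero>\<^bsub>M\<^esub>"
          using \<open>x ! 0 = \<zero>\<^bsub>M\<^esub>\<close> co(1)[OF k] \<phi>(2) by (intro M.lc_zero_right) auto
        moreover have "lc M (bound_vars \<phi>) (bound_coeff \<phi> k) (\<lambda>_. \<zero>\<^bsub>M\<^esub>) = \<zero>\<^bsub>M\<^esub>"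
          using co(2)[OF k] by (intro M.lc_zero_right) auto
        ultimately show "lc M (free_vars \<phi>) (free_coeff \<phi> k) ((!) x) \<oplus>\<^bsub>M\<^esub>
            lc M (bound_vars \<phi>) (bound_coeff \<phi> k) (\<lambda>_. \<zero>\<^bsub>M\<^esub>) = \<zero>\<^bsub>M\<^esub>" by simp
      qed simp
      then show "x \<in> pp_sol M \<phi>" using pp_sol_iff_solvable[OF M \<phi>(1)] x \<phi>(2) by auto
    qed
    then have le: "pp_le TYPE('m) R ?\<psi> \<phi>" using \<phi>(2) by (simp add: pp_le_def)
    have d: "d \<in> dual_vectors R ?\<psi> \<longleftrightarrow> d 0 \<in> carrier R" for d
    proof
      show "d 0 \<in> carrier R" if "d \<in> dual_vectors R ?\<psi>" using dual_vectors_closed[OF R(1) \<psi> that, of 0] by simp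
      show "d \<in> dual_vectors R ?\<psi>" if "d 0 \<in> carrier R"
        using that unfolding dual_vectors_def by (intro CollectI exI[of _ "\<lambda>_. d 0"]) simp
    qed
    have res: "(\<exists>d\<in>dual_vectors R ?\<psi>. residual R \<phi> d \<subseteq> P) \<longleftrightarrow> I \<subseteq> P" for P
    proof
      assume "\<exists>d\<in>dual_vectors R ?\<psi>. residual R \<phi> d \<subseteq> P"
      then obtain d where "d 0 \<in> carrier R" "residual R \<phi> d \<subseteq> P" using d by blast
      moreover have "I \<subseteq> residual R \<phi> d" if d0: "d 0 \<in> carrier R" for d
      proof
        fix i assume i: "i \<in> I"
        then show "i \<in> residual R \<phi> d"
          unfolding residual_def using \<phi>(3)[of "\<lambda>j. i \<otimes>\<^bsub>R\<^esub> d j"] I.I_r_closed[OF i d0] I.Icarr[OF i] by simp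
      qed
      ultimately show "I \<subseteq> P" by blast
    next
      assume "I \<subseteq> P"
      moreover have "residual R \<phi> (\<lambda>_. \<one>\<^bsub>R\<^esub>) \<subseteq> I"
      proof
        fix a assume "a \<in> residual R \<phi> (\<lambda>_. \<one>\<^bsub>R\<^esub>)"
        then show "a \<in> I"
          unfolding residual_def using \<phi>(3)[of "\<lambda>_. a \<otimes>\<^bsub>R\<^esub> \<one>\<^bsub>R\<^esub>"] by auto
      qed
      ultimately show "\<exists>d\<in>dual_vectors R ?\<psi>. residual R \<phi> d \<subseteq> P"
        using d[of "\<lambda>_. \<one>\<^bsub>R\<^esub>"] by (intro bexI[of _ "\<lambda>_. \<one>\<^bsub>R\<^esub>"]) auto
    qed
    have "{P \<in> Spec R. hull_type R P \<in> ?U \<phi> ?\<psi>} = {P \<in> Spec R. \<exists>d\<in>dual_vectors R ?\<psi>. residual R \<phi> d \<subseteq> P}"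
      unfolding pre[OF \<phi>(1) \<psi> le] V_def by (rule Union_Collect_conj)
    then have V: "{P \<in> Spec R. hull_type R P \<in> ?U \<phi> ?\<psi>} = V R I"
      by (simp only: res V_def)
    show "\<exists>U\<in>?S. {P \<in> Spec R. hull_type R P \<in> U} = V R I"
    proof (rule bexI[where x = "?U \<phi> ?\<psi>"])
      show "{P \<in> Spec R. hull_type R P \<in> ?U \<phi> ?\<psi>} = V R I" by (rule V)
      show "?U \<phi> ?\<psi> \<in> ?S" using \<phi>(1) \<psi> le by blast
    qed
  next
    show "\<exists>K. pp_definable_ideal R K \<and> V R K = V R I \<inter> V R J"
      if "pp_definable_ideal R I" "pp_definable_ideal R J" for I J
      using V_Int_pp[OF R(1) that] .
  qed
  then show ?thesis unfolding restr .
qed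

theorem corollary6p4:
  fixes R :: "('a, 'r) ring_scheme"
  assumes "cring R"
    and "large_universe R TYPE('m)"
  shows
    "inj_on (hull_type R :: 'a set \<Rightarrow> ('a, 'm) module set) (Spec R) \<and>
     (hull_type R :: 'a set \<Rightarrow> ('a, 'm) module set) ` Spec R \<subseteq> inj_types R \<and>
     {X. openin (restrict_to_Spec R (full_support_topology R :: ('a, 'm) module set topology)) X}
       = {\<Union>I\<in>\<I>. V R I | \<I>. \<I> \<subseteq> {I. ideal I R}} \<and>
     {\<Union>I\<in>\<I>. V R I | \<I>. \<I> \<subseteq> {I. ideal I R}} = {X. specialisation_closed R X} \<and>
     {X. openin (restrict_to_Spec R (ziegler_topology R :: ('a, 'm) module set topology)) X}
       = {\<Union>I\<in>\<I>. V R I | \<I>. \<I> \<subseteq> {I. pp_definable_ideal R I}} \<and>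
     {X. openin (restrict_to_Spec R (thomason_topology R :: ('a, 'm) module set topology)) X}
       = {\<Union>I\<in>\<I>. V R I | \<I>. \<I> \<subseteq> {I. fg_ideal R I}} \<and>
     (coherent_ring R \<longrightarrow>
        restrict_to_Spec R (ziegler_topology R :: ('a, 'm) module set topology)
          = restrict_to_Spec R (thomason_topology R :: ('a, 'm) module set topology)) \<and>
     (noetherian_ring R \<longrightarrow>
        restrict_to_Spec R (full_support_topology R :: ('a, 'm) module set topology)
          = restrict_to_Spec R (ziegler_topology R :: ('a, 'm) module set topology) \<and>
        restrict_to_Spec R (ziegler_topology R :: ('a, 'm) module set topology)
          = restrict_to_Spec R (thomason_topology R :: ('a, 'm) module set topology))"
proof (intro conjI impI)
  note full = full_support_open_sets[OF assms] and zg = ziegler_open_sets[OF assms]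
    and thomason = thomason_open_sets[OF assms]
  have topology_eqI: "T = T'" if "{X. openin T X} = {X. openin T' X}" for T T' :: "'a set topology"
    using that unfolding topology_eq by blast
  have fg_pp: "fg_ideal R I \<Longrightarrow> pp_definable_ideal R I" for I
    using fg_ideal_pp_definable[OF assms(1)] .
  show "inj_on (hull_type R :: 'a set \<Rightarrow> ('a, 'm) module set) (Spec R)"
    by (rule hull_type_inj_on[OF assms])
  show "(hull_type R :: 'a set \<Rightarrow> ('a, 'm) module set) ` Spec R \<subseteq> inj_types R"
    using hull_type_inj_types[OF assms] by blast
  show "{\<Union>I\<in>\<I>. V R I | \<I>. \<I> \<subseteq> {I. ideal I R}} = {X. specialisation_closed R X}"
    using specialisation_closed_iff[OF assms(1)] by blast
  show "restrict_to_Spec R (ziegler_topology R :: ('a, 'm) module set topology)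
      = restrict_to_Spec R (thomason_topology R :: ('a, 'm) module set topology)" if coh: "coherent_ring R"
  proof -
    have "{I. pp_definable_ideal R I} = {I. fg_ideal R I}"
      using fg_pp coherent_pp_definable_fg[OF coh] by blast
    then show ?thesis by (intro topology_eqI) (simp only: zg thomason)
  qed
  have noetherian: "{I. ideal I R} = {I. fg_ideal R I}" "{I. pp_definable_ideal R I} = {I. fg_ideal R I}"
    if N: "noetherian_ring R"
  proof -
    have "fg_ideal R I" if "ideal I R" for I
      using noetherian_ring.finetely_gen[OF N that] by (auto simp: fg_ideal_def)
    then show "{I. ideal I R} = {I. fg_ideal R I}" "{I. pp_definable_ideal R I} = {I. fg_ideal R I}"
      using fg_pp fg_ideal_ideal[OF assms(1)] by (auto simp: pp_definable_ideal_def)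
  qed
  show "restrict_to_Spec R (full_support_topology R :: ('a, 'm) module set topology)
      = restrict_to_Spec R (ziegler_topology R :: ('a, 'm) module set topology)" if "noetherian_ring R"
    by (intro topology_eqI) (simp only: full zg noetherian[OF that])
  show "restrict_to_Spec R (ziegler_topology R :: ('a, 'm) module set topology)
      = restrict_to_Spec R (thomason_topology R :: ('a, 'm) module set topology)" if "noetherian_ring R"
    by (intro topology_eqI) (simp only: zg thomason noetherian[OF that])
qed (fact full_support_open_sets[OF assms] ziegler_open_sets[OF assms] thomason_open_sets[OF assms])+

end
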